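(* Let $N$ be an analytic connected manifold and $x_0\in N$. If $G$ is a countable group of analytic diffeomorphisms of $N$ fixing the point $x_0$, then $G$ is locally embeddable into Hilbert space.
   Context: A countable discrete group $G'$ is coarsely embeddable into a Hilbert space $H$ if there is a map $f:G'\to H$ such that (i) for any finite $F\subseteq G'$ there is $R>0$ such that $g^{-1}h\in F$ implies $d(f(g),f(h))\le R$; (ii) for any $S>0$ there is a finite $E\subseteq G'$ such that $g^{-1}h\in G'-E$ implies $d(f(g),f(h))\ge S$. A countable discrete group $G$ is locally embeddable into Hilbert space $H$ if for any finite subset $F\subseteq G$ there exist a group $G'$ coarsely embeddable into $H$ and a map $\phi:F\to G'$ such that (1) $\phi(e)=e$ if $e\in F$; (2) $\phi(gh)=\phi(g)\phi(h)$ if $g,h\in F$ and $gh\in F$; (3) if $g$ and $h$ are distinct elements of $F$, then $\phi(g)\ne\phi(h)$. *)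

theory Defs
  imports "HOL-Analysis.Analysis" "HOL-Algebra.Bij"
begin

section \<open>The Hilbert space of square-summable real sequences\<close>

typedef ell2 = "{x :: nat \<Rightarrow> real. summable (\<lambda>i. (x i)\<^sup>2)}"
  morphisms ell2_coord Abs_ell2
  by (rule exI[of _ "\<lambda>_. 0"]) simp

lemma summable_ell2_coord: "summable (\<lambda>i. (ell2_coord x i)\<^sup>2)"
  using ell2_coord[of x] by simp

lemma summable_ell2_mult:
  fixes x y :: "nat \<Rightarrow> real"
  assumes "summable (\<lambda>i. (x i)\<^sup>2)" "summable (\<lambda>i. (y i)\<^sup>2)"
  shows "summable (\<lambda>i. x i * y i)"
proof (rule summable_comparison_test')
  show "summable (\<lambda>i. (x i)\<^sup>2 + (y i)\<^sup>2)"
    by (intro summable_add assms)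
  fix i :: nat assume "0 \<le> i"
  have "2 * (\<bar>x i\<bar> * \<bar>y i\<bar>) \<le> (x i)\<^sup>2 + (y i)\<^sup>2"
    using zero_le_power2[of "\<bar>x i\<bar> - \<bar>y i\<bar>"] by (simp add: power2_diff)
  moreover have "0 \<le> \<bar>x i\<bar> * \<bar>y i\<bar>"
    by simp
  ultimately show "norm (x i * y i) \<le> (x i)\<^sup>2 + (y i)\<^sup>2"
    unfolding real_norm_def abs_mult by linarith
qed

lemma summable_ell2_add:
  fixes x y :: "nat \<Rightarrow> real"
  assumes "summable (\<lambda>i. (x i)\<^sup>2)" "summable (\<lambda>i. (y i)\<^sup>2)"
  shows "summable (\<lambda>i. (x i + y i)\<^sup>2)"
proof -
  have "summable (\<lambda>i. (x i)\<^sup>2 + (y i)\<^sup>2 + 2 * (x i * y i))"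
    by (intro summable_add summable_mult summable_ell2_mult assms)
  then show ?thesis
    by (simp add: power2_sum mult.assoc)
qed

lemma summable_ell2_scale:
  fixes x :: "nat \<Rightarrow> real"
  assumes "summable (\<lambda>i. (x i)\<^sup>2)"
  shows "summable (\<lambda>i. (c * x i)\<^sup>2)"
  using summable_mult[OF assms, of "c\<^sup>2"] by (simp add: power_mult_distrib)

instantiation ell2 :: real_inner
begin

definition zero_ell2 :: ell2 where
  "zero_ell2 = Abs_ell2 (\<lambda>_. 0)"
definition plus_ell2 :: "ell2 \<Rightarrow> ell2 \<Rightarrow> ell2" where
  "plus_ell2 x y = Abs_ell2 (\<lambda>i. ell2_coord x i + ell2_coord y i)"
definition uminus_ell2 :: "ell2 \<Rightarrow> ell2" where
  "uminus_ell2 x = Abs_ell2 (\<lambda>i. - ell2_coord x i)"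
definition minus_ell2 :: "ell2 \<Rightarrow> ell2 \<Rightarrow> ell2" where
  "minus_ell2 x y = Abs_ell2 (\<lambda>i. ell2_coord x i - ell2_coord y i)"
definition scaleR_ell2 :: "real \<Rightarrow> ell2 \<Rightarrow> ell2" where
  "scaleR_ell2 c x = Abs_ell2 (\<lambda>i. c * ell2_coord x i)"
definition inner_ell2 :: "ell2 \<Rightarrow> ell2 \<Rightarrow> real" where
  "inner_ell2 x y = (\<Sum>i. ell2_coord x i * ell2_coord y i)"
definition norm_ell2 :: "ell2 \<Rightarrow> real" where
  "norm_ell2 x = sqrt (inner x x)"
definition dist_ell2 :: "ell2 \<Rightarrow> ell2 \<Rightarrow> real" where
  "dist_ell2 x y = norm (x - y)"
definition sgn_ell2 :: "ell2 \<Rightarrow> ell2" where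
  "sgn_ell2 x = inverse (norm x) *\<^sub>R x"
definition uniformity_ell2 :: "(ell2 \<times> ell2) filter" where
  "uniformity_ell2 = (INF e\<in>{0<..}. principal {(x, y). dist x y < e})"
definition open_ell2 :: "ell2 set \<Rightarrow> bool" where
  "open_ell2 U = (\<forall>x\<in>U. eventually (\<lambda>(x', y). x' = x \<longrightarrow> y \<in> U) uniformity)"

lemma ell2_coord_zero: "ell2_coord 0 = (\<lambda>_. 0)"
  unfolding zero_ell2_def by (simp add: Abs_ell2_inverse)

lemma ell2_coord_plus: "ell2_coord (x + y) = (\<lambda>i. ell2_coord x i + ell2_coord y i)"
  unfolding plus_ell2_def
  by (simp add: Abs_ell2_inverse summable_ell2_add summable_ell2_coord)

lemma ell2_coord_uminus: "ell2_coord (- x) = (\<lambda>i. - ell2_coord x i)"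
  unfolding uminus_ell2_def by (simp add: Abs_ell2_inverse summable_ell2_coord)

lemma ell2_coord_minus: "ell2_coord (x - y) = (\<lambda>i. ell2_coord x i - ell2_coord y i)"
proof -
  have "summable (\<lambda>i. (ell2_coord x i + - ell2_coord y i)\<^sup>2)"
    by (rule summable_ell2_add) (simp_all add: summable_ell2_coord)
  then show ?thesis
    unfolding minus_ell2_def by (simp add: Abs_ell2_inverse)
qed

lemma ell2_coord_scaleR: "ell2_coord (c *\<^sub>R x) = (\<lambda>i. c * ell2_coord x i)"
  unfolding scaleR_ell2_def
  by (simp add: Abs_ell2_inverse summable_ell2_scale summable_ell2_coord)

lemmas ell2_coord_simps =
  ell2_coord_zero ell2_coord_plus ell2_coord_uminus ell2_coord_minus ell2_coord_scaleR

instance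
proof
  fix x y z :: ell2 and a b :: real
  note mult_summable = summable_ell2_mult[OF summable_ell2_coord summable_ell2_coord]
  show "x + y + z = x + (y + z)" "x + y = y + x" "0 + x = x" "- x + x = 0" "x - y = x + - y"
    "a *\<^sub>R (x + y) = a *\<^sub>R x + a *\<^sub>R y" "(a + b) *\<^sub>R x = a *\<^sub>R x + b *\<^sub>R x"
    "a *\<^sub>R b *\<^sub>R x = (a * b) *\<^sub>R x" "1 *\<^sub>R x = x"
    by (simp_all add: ell2_coord_inject[symmetric] ell2_coord_simps algebra_simps)
  show "dist x y = norm (x - y)" "sgn x = inverse (norm x) *\<^sub>R x" "norm x = sqrt (inner x x)"
    by (simp_all add: dist_ell2_def sgn_ell2_def norm_ell2_def)
  show "(uniformity :: (ell2 \<times> ell2) filter) = (INF e\<in>{0<..}. principal {(x, y). dist x y < e})"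
    by (rule uniformity_ell2_def)
  show "open U = (\<forall>x\<in>U. eventually (\<lambda>(x', y). x' = x \<longrightarrow> y \<in> U) uniformity)" for U :: "ell2 set"
    by (rule open_ell2_def)
  show "inner x y = inner y x"
    by (simp add: inner_ell2_def mult.commute)
  show "inner (x + y) z = inner x z + inner y z"
    by (simp add: inner_ell2_def ell2_coord_simps distrib_right suminf_add mult_summable)
  show "inner (a *\<^sub>R x) y = a * inner x y"
    by (simp add: inner_ell2_def ell2_coord_simps mult.assoc suminf_mult mult_summable)
  show "0 \<le> inner x x"
    by (simp add: inner_ell2_def suminf_nonneg mult_summable)
  show "(inner x x = 0) = (x = 0)"
    using suminf_eq_zero_iff[OF mult_summable[of x x]]
    by (auto simp: inner_ell2_def ell2_coord_inject[symmetric] ell2_coord_zero fun_eq_iff)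
qed

end

lemma norm_ell2_eq: "norm x = sqrt (\<Sum>i. (ell2_coord x i)\<^sup>2)"
  by (simp add: norm_ell2_def inner_ell2_def power2_eq_square)

lemma sum_coord_le_norm_ell2: "(\<Sum>i<K. (ell2_coord x i)\<^sup>2) \<le> (norm x)\<^sup>2"
proof -
  have "(\<Sum>i<K. (ell2_coord x i)\<^sup>2) \<le> (\<Sum>i. (ell2_coord x i)\<^sup>2)"
    by (rule sum_le_suminf) (auto simp: summable_ell2_coord)
  then show ?thesis
    by (simp add: norm_ell2_eq suminf_nonneg summable_ell2_coord)
qed

lemma coord_le_norm_ell2: "\<bar>ell2_coord x i\<bar> \<le> norm x"
proof -
  have "(ell2_coord x i)\<^sup>2 \<le> (\<Sum>j<Suc i. (ell2_coord x j)\<^sup>2)"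
    by (simp add: sum_nonneg)
  also have "\<dots> \<le> (norm x)\<^sup>2"
    by (rule sum_coord_le_norm_ell2)
  finally show ?thesis
    by (simp add: abs_le_square_iff[symmetric])
qed

instance ell2 :: complete_space
proof
  fix X :: "nat \<Rightarrow> ell2"
  assume X: "Cauchy X"
  have "Cauchy (\<lambda>m. ell2_coord (X m) i)" for i
  proof (rule metric_CauchyI)
    fix e :: real assume "0 < e"
    then obtain M where M: "dist (X m) (X k) < e" if "m \<ge> M" "k \<ge> M" for m k
      using metric_CauchyD[OF X] by blast
    have "dist (ell2_coord (X m) i) (ell2_coord (X k) i) < e" if "m \<ge> M" "k \<ge> M" for m k
      using M[OF that] coord_le_norm_ell2[of "X m - X k" i]
      by (simp add: dist_norm ell2_coord_minus)
    then show "\<exists>M. \<forall>m\<ge>M. \<forall>k\<ge>M. dist (ell2_coord (X m) i) (ell2_coord (X k) i) < e"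
      by blast
  qed
  then have "\<exists>l. (\<lambda>m. ell2_coord (X m) i) \<longlonglongrightarrow> l" for i
    using Cauchy_convergent convergent_def by blast
  then obtain l where l: "(\<lambda>m. ell2_coord (X m) i) \<longlonglongrightarrow> l i" for i
    by metis
  have bound: "\<exists>M. \<forall>m\<ge>M. \<forall>K. (\<Sum>i<K. (ell2_coord (X m) i - l i)\<^sup>2) \<le> e\<^sup>2" if "0 < e" for e
  proof -
    obtain M where M: "dist (X m) (X k) < e" if "m \<ge> M" "k \<ge> M" for m k
      using metric_CauchyD[OF X \<open>0 < e\<close>] by blast
    have "(\<Sum>i<K. (ell2_coord (X m) i - l i)\<^sup>2) \<le> e\<^sup>2" if "m \<ge> M" for m K
    proof (rule LIMSEQ_le_const2)
      show "(\<lambda>k. \<Sum>i<K. (ell2_coord (X m) i - ell2_coord (X k) i)\<^sup>2)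
              \<longlonglongrightarrow> (\<Sum>i<K. (ell2_coord (X m) i - l i)\<^sup>2)"
        by (intro tendsto_intros l)
      have "(\<Sum>i<K. (ell2_coord (X m) i - ell2_coord (X k) i)\<^sup>2) \<le> e\<^sup>2" if "k \<ge> M" for k
      proof -
        have "(\<Sum>i<K. (ell2_coord (X m) i - ell2_coord (X k) i)\<^sup>2) \<le> (norm (X m - X k))\<^sup>2"
          using sum_coord_le_norm_ell2[of "X m - X k" K] by (simp add: ell2_coord_minus)
        also have "\<dots> \<le> e\<^sup>2"
          using M[OF \<open>m \<ge> M\<close> that] by (intro power_mono) (auto simp: dist_norm)
        finally show ?thesis .
      qed
      then show "\<exists>N. \<forall>k\<ge>N. (\<Sum>i<K. (ell2_coord (X m) i - ell2_coord (X k) i)\<^sup>2) \<le> e\<^sup>2"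
        by blast
    qed
    then show ?thesis by blast
  qed
  have diff_summable: "summable (\<lambda>i. (ell2_coord (X m) i - l i)\<^sup>2)"
    if "\<forall>K. (\<Sum>i<K. (ell2_coord (X m) i - l i)\<^sup>2) \<le> e\<^sup>2" for m e
    using that by (intro summableI_nonneg_bounded[where x = "e\<^sup>2"]) auto
  obtain M1 where M1: "\<forall>K. (\<Sum>i<K. (ell2_coord (X M1) i - l i)\<^sup>2) \<le> 1\<^sup>2"
    using bound[of 1] by auto
  have "summable (\<lambda>i. (ell2_coord (X M1) i + (-1) * (ell2_coord (X M1) i - l i))\<^sup>2)"
    by (intro summable_ell2_add summable_ell2_coord summable_ell2_scale diff_summable[OF M1])
  then have L: "ell2_coord (Abs_ell2 l) = l"
    by (simp add: Abs_ell2_inverse)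
  have "X \<longlonglongrightarrow> Abs_ell2 l"
  proof (rule metric_LIMSEQ_I)
    fix e :: real assume "0 < e"
    then obtain M where M: "\<forall>m\<ge>M. \<forall>K. (\<Sum>i<K. (ell2_coord (X m) i - l i)\<^sup>2) \<le> (e/2)\<^sup>2"
      using bound[of "e/2"] by auto
    have "dist (X m) (Abs_ell2 l) < e" if "m \<ge> M" for m
    proof -
      have *: "\<forall>K. (\<Sum>i<K. (ell2_coord (X m) i - l i)\<^sup>2) \<le> (e/2)\<^sup>2"
        using M that by blast
      have "(\<Sum>i. (ell2_coord (X m) i - l i)\<^sup>2) \<le> (e/2)\<^sup>2"
        using diff_summable[OF *] * by (intro suminf_le_const) auto
      then have "sqrt (\<Sum>i. (ell2_coord (X m) i - l i)\<^sup>2) \<le> sqrt ((e/2)\<^sup>2)"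
        by (rule real_sqrt_le_mono)
      then have "norm (X m - Abs_ell2 l) \<le> e/2"
        using \<open>0 < e\<close> by (simp add: norm_ell2_eq ell2_coord_minus L real_sqrt_abs del: real_sqrt_le_iff)
      then show ?thesis
        using \<open>0 < e\<close> by (simp add: dist_norm)
    qed
    then show "\<exists>M. \<forall>m\<ge>M. dist (X m) (Abs_ell2 l) < e"
      by blast
  qed
  then show "convergent X"
    by (rule convergentI)
qed


section \<open>Local embeddability into a Hilbert space\<close>

definition coarse_embedding ::
    "('g, 'm) monoid_scheme \<Rightarrow> ('g \<Rightarrow> 'h::{real_inner, complete_space}) \<Rightarrow> bool" where
  "coarse_embedding G f \<longleftrightarrow>
     (\<forall>F. finite F \<and> F \<subseteq> carrier G \<longrightarrow>
        (\<exists>R>0. \<forall>g\<in>carrier G. \<forall>h\<in>carrier G.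
           inv\<^bsub>G\<^esub> g \<otimes>\<^bsub>G\<^esub> h \<in> F \<longrightarrow> dist (f g) (f h) \<le> R)) \<and>
     (\<forall>S>0. \<exists>E. finite E \<and> E \<subseteq> carrier G \<and>
        (\<forall>g\<in>carrier G. \<forall>h\<in>carrier G.
           inv\<^bsub>G\<^esub> g \<otimes>\<^bsub>G\<^esub> h \<in> carrier G - E \<longrightarrow> dist (f g) (f h) \<ge> S))"

definition coarsely_embeddable ::
    "'h::{real_inner, complete_space} itself \<Rightarrow> ('g, 'm) monoid_scheme \<Rightarrow> bool" where
  "coarsely_embeddable _ G \<longleftrightarrow>
     group G \<and> countable (carrier G) \<and> (\<exists>f :: 'g \<Rightarrow> 'h. coarse_embedding G f)"

text \<open>The target groups \<open>G'\<close> are countable, so up to isomorphism their carriers may be taken to be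
  sets of natural numbers.\<close>

definition locally_embeddable ::
    "'h::{real_inner, complete_space} itself \<Rightarrow> ('g, 'm) monoid_scheme \<Rightarrow> bool" where
  "locally_embeddable H G \<longleftrightarrow>
     group G \<and> countable (carrier G) \<and>
     (\<forall>F. finite F \<and> F \<subseteq> carrier G \<longrightarrow>
        (\<exists>(G' :: nat monoid) \<phi>.
           coarsely_embeddable H G' \<and> \<phi> \<in> F \<rightarrow> carrier G' \<and>
           (\<one>\<^bsub>G\<^esub> \<in> F \<longrightarrow> \<phi> \<one>\<^bsub>G\<^esub> = \<one>\<^bsub>G'\<^esub>) \<and>
           (\<forall>g\<in>F. \<forall>h\<in>F. g \<otimes>\<^bsub>G\<^esub> h \<in> F \<longrightarrow>
              \<phi> (g \<otimes>\<^bsub>G\<^esub> h) = \<phi> g \<otimes>\<^bsub>G'\<^esub> \<phi> h) \<and>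
           (\<forall>g\<in>F. \<forall>h\<in>F. g \<noteq> h \<longrightarrow> \<phi> g \<noteq> \<phi> h)))"


section \<open>Real-analytic manifolds and diffeomorphisms\<close>

text \<open>Points of \<open>\<real>\<^sup>n\<close> are the points of \<^term>\<open>Euclidean_space n\<close>, i.e. sequences that vanish from
  index \<open>n\<close> on; multi-indices are encoded in the same way.\<close>

definition multi_indices :: "nat \<Rightarrow> (nat \<Rightarrow> nat) set" where
  "multi_indices n = {\<alpha>. \<forall>i\<ge>n. \<alpha> i = 0}"

text \<open>For \<open>S\<close> open in \<open>\<real>\<^sup>n\<close>, this says that around every point of \<open>S\<close> the function is given by a
  convergent power series. The polydisc of radius \<open>r\<close> may be shrunk so as to lie in \<open>S\<close>,
  hence the values of \<open>f\<close> outside \<open>S\<close> are irrelevant. Convergence of \<open>has_sum\<close> is unconditional,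
  i.e. absolute.\<close>

definition real_analytic_on ::
    "nat \<Rightarrow> ((nat \<Rightarrow> real) \<Rightarrow> real) \<Rightarrow> (nat \<Rightarrow> real) set \<Rightarrow> bool" where
  "real_analytic_on n f S \<longleftrightarrow>
     openin (Euclidean_space n) S \<and>
     (\<forall>x\<in>S. \<exists>r>0. \<exists>c :: (nat \<Rightarrow> nat) \<Rightarrow> real.
        \<forall>y\<in>topspace (Euclidean_space n). (\<forall>i<n. \<bar>y i - x i\<bar> < r) \<longrightarrow>
          ((\<lambda>\<alpha>. c \<alpha> * (\<Prod>i<n. (y i - x i) ^ \<alpha> i)) has_sum f y) (multi_indices n))"

definition real_analytic_map_on ::
    "nat \<Rightarrow> ((nat \<Rightarrow> real) \<Rightarrow> (nat \<Rightarrow> real)) \<Rightarrow> (nat \<Rightarrow> real) set \<Rightarrow> bool" where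
  "real_analytic_map_on n f S \<longleftrightarrow> (\<forall>j<n. real_analytic_on n (\<lambda>x. f x j) S)"

type_synonym 'a chart = "'a set \<times> ('a \<Rightarrow> nat \<Rightarrow> real)"

definition is_chart :: "nat \<Rightarrow> 'a topology \<Rightarrow> 'a set \<Rightarrow> ('a \<Rightarrow> nat \<Rightarrow> real) \<Rightarrow> bool" where
  "is_chart n N U \<phi> \<longleftrightarrow>
     openin N U \<and>
     (\<exists>V. openin (Euclidean_space n) V \<and>
        homeomorphic_map (subtopology N U) (subtopology (Euclidean_space n) V) \<phi>)"

text \<open>An \<open>n\<close>-dimensional real-analytic manifold; the atlas is not required to be maximal.\<close>

definition analytic_manifold :: "nat \<Rightarrow> 'a topology \<Rightarrow> 'a chart set \<Rightarrow> bool" where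
  "analytic_manifold n N \<A> \<longleftrightarrow>
     Hausdorff_space N \<and> second_countable N \<and>
     (\<forall>(U, \<phi>)\<in>\<A>. is_chart n N U \<phi>) \<and>
     (\<Union>(U, \<phi>)\<in>\<A>. U) = topspace N \<and>
     (\<forall>(U, \<phi>)\<in>\<A>. \<forall>(V, \<psi>)\<in>\<A>.
        real_analytic_map_on n (\<psi> \<circ> inv_into U \<phi>) (\<phi> ` (U \<inter> V)))"

definition analytic_self_map ::
    "nat \<Rightarrow> 'a topology \<Rightarrow> 'a chart set \<Rightarrow> ('a \<Rightarrow> 'a) \<Rightarrow> bool" where
  "analytic_self_map n N \<A> f \<longleftrightarrow>
     continuous_map N N f \<and>
     (\<forall>(U, \<phi>)\<in>\<A>. \<forall>(V, \<psi>)\<in>\<A>.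
        real_analytic_map_on n (\<psi> \<circ> f \<circ> inv_into U \<phi>) (\<phi> ` (U \<inter> f -` V)))"

text \<open>As in \<^const>\<open>BijGroup\<close>, maps of \<open>N\<close> to itself are extensional on \<^term>\<open>topspace N\<close>.\<close>

definition analytic_diffeos :: "nat \<Rightarrow> 'a topology \<Rightarrow> 'a chart set \<Rightarrow> ('a \<Rightarrow> 'a) set" where
  "analytic_diffeos n N \<A> =
     {f \<in> Bij (topspace N). analytic_self_map n N \<A> f \<and>
        analytic_self_map n N \<A> (restrict (inv_into (topspace N) f) (topspace N))}"

end

theory Submission
  imports Defs "HOL-Complex_Analysis.Complex_Analysis" "HOL-Algebra.Weak_Morphisms"
    "HOL-Algebra.Generated_Groups"
begin

text \<open>In a chart around the common fixed point, composition with \<open>g\<close> acts linearly on polynomials of degree at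
  most \<open>k\<close> modulo functions vanishing to order \<open>k + 1\<close>, so taking \<open>k\<close>-jets is a linear representation
  of \<open>G\<close>. By the identity theorem on the connected manifold, an analytic map is determined by its jets
  of all orders, so for large \<open>k\<close> the representation separates the elements of a given finite set \<open>F\<close>. The
  image of the subgroup generated by \<open>F\<close> is a finitely generated linear group, hence residually finite
  by Malcev, so \<open>F\<close> is even separated by a homomorphism to a finite group, which is trivially
  coarsely embeddable. Residual finiteness comes down to the fact that each nonzero element of a
  finitely generated domain of characteristic 0 is a unit modulo some proper ideal of finite index;
  this is proved by adjoining the generators one at a time.\<close>

section \<open>Finitely generated domains\<close>

text \<open>Everything algebraic happens inside one fixed type: subrings, ideals and polynomials
  over a subring are sets, so that a chain of rings can be built there. Requiring a unit modulo the
  ideal, rather than just an element outside it, has two payoffs. The leading coefficient of a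
  relation for a new generator can be inverted, which permits division modulo the ideal; and
  inverting the product of finitely many nonzero elements keeps all of them outside one ideal. The
  domain that matters is generated by the matrix entries of the elements of \<open>F\<close> and of
  their inverses; it lies in the reals, and the chain starts at \<open>\<int>\<close>. On the
  analytic side, jets are coefficients of polynomials that approximate a function up to a big-O
  error along the neighbourhood filter of the point; fixing the point is what makes this error
  survive composition. The identity theorem in several variables is reduced to one variable along
  rays from the centre of an expansion, and there to complex analysis.\<close>

definition unital_subring :: "'a::comm_ring_1 set \<Rightarrow> bool" where
  "unital_subring A \<longleftrightarrow> 1 \<in> A \<and> (\<forall>x\<in>A. \<forall>y\<in>A. x - y \<in> A \<and> x * y \<in> A)"

definition ideal_in :: "'a::comm_ring_1 set \<Rightarrow> 'a set \<Rightarrow> bool" where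
  "ideal_in A I \<longleftrightarrow> I \<subseteq> A \<and> 0 \<in> I \<and> (\<forall>x\<in>I. \<forall>y\<in>I. x - y \<in> I) \<and> (\<forall>a\<in>A. \<forall>x\<in>I. a * x \<in> I)"

text \<open>Finite index is expressed by a finite set of representatives, so that no quotient ring
  has to be formed.\<close>

definition finite_modulo :: "'a::comm_ring_1 set \<Rightarrow> 'a set \<Rightarrow> bool" where
  "finite_modulo A I \<longleftrightarrow> (\<exists>R. finite R \<and> R \<subseteq> A \<and> (\<forall>a\<in>A. \<exists>r\<in>R. a - r \<in> I))"

definition polys_over :: "'a::zero set \<Rightarrow> 'a poly set" where
  "polys_over A = {p. \<forall>i. coeff p i \<in> A}"

definition adjoin :: "'a::comm_ring_1 set \<Rightarrow> 'a \<Rightarrow> 'a set" where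
  "adjoin A b = (\<lambda>p. poly p b) ` polys_over A"

definition residually_finite_domain :: "'a::idom set \<Rightarrow> bool" where
  "residually_finite_domain A \<longleftrightarrow> unital_subring A \<and>
     (\<forall>s\<in>A - {0}. \<exists>I. ideal_in A I \<and> 1 \<notin> I \<and> finite_modulo A I \<and> (\<exists>u\<in>A. s * u - 1 \<in> I))"

lemma subring_closed:
  assumes "unital_subring A"
  shows subring_1: "1 \<in> A" and subring_0: "0 \<in> A"
    and subring_diff: "x \<in> A \<Longrightarrow> y \<in> A \<Longrightarrow> x - y \<in> A"
    and subring_mult: "x \<in> A \<Longrightarrow> y \<in> A \<Longrightarrow> x * y \<in> A"
    and subring_uminus: "x \<in> A \<Longrightarrow> - x \<in> A"
    and subring_add: "x \<in> A \<Longrightarrow> y \<in> A \<Longrightarrow> x + y \<in> A"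
    and subring_power: "x \<in> A \<Longrightarrow> x ^ k \<in> A"
proof -
  show 1: "1 \<in> A" and d: "x \<in> A \<Longrightarrow> y \<in> A \<Longrightarrow> x - y \<in> A"
    and m: "x \<in> A \<Longrightarrow> y \<in> A \<Longrightarrow> x * y \<in> A" for x y
    using assms by (auto simp: unital_subring_def)
  show z: "0 \<in> A" using d[OF 1 1] by simp
  show u: "x \<in> A \<Longrightarrow> - x \<in> A" for x using d[OF z] by simp
  show "x \<in> A \<Longrightarrow> y \<in> A \<Longrightarrow> x + y \<in> A" using d[OF _ u] by simp
  show "x \<in> A \<Longrightarrow> x ^ k \<in> A" by (induction k) (auto intro: 1 m)
qed

lemma ideal_closed:
  assumes "ideal_in A I"
  shows ideal_0: "0 \<in> I"
    and ideal_diff: "x \<in> I \<Longrightarrow> y \<in> I \<Longrightarrow> x - y \<in> I"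
    and ideal_mult: "a \<in> A \<Longrightarrow> x \<in> I \<Longrightarrow> a * x \<in> I"
    and ideal_mult_right: "a \<in> A \<Longrightarrow> x \<in> I \<Longrightarrow> x * a \<in> I"
    and ideal_uminus: "x \<in> I \<Longrightarrow> - x \<in> I"
    and ideal_add: "x \<in> I \<Longrightarrow> y \<in> I \<Longrightarrow> x + y \<in> I"
    and ideal_subset: "x \<in> I \<Longrightarrow> x \<in> A"
proof -
  show z: "0 \<in> I" and d: "x \<in> I \<Longrightarrow> y \<in> I \<Longrightarrow> x - y \<in> I" 
    and m: "a \<in> A \<Longrightarrow> x \<in> I \<Longrightarrow> a * x \<in> I" and "x \<in> I \<Longrightarrow> x \<in> A" for x y
    using assms by (auto simp: ideal_in_def)
  show "a \<in> A \<Longrightarrow> x \<in> I \<Longrightarrow> x * a \<in> I" using m by (subst mult.commute)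
  show u: "x \<in> I \<Longrightarrow> - x \<in> I" for x using d[OF z] by simp
  show "x \<in> I \<Longrightarrow> y \<in> I \<Longrightarrow> x + y \<in> I" using d[OF _ u] by simp
qed

lemma ideal_sum:
  assumes "ideal_in A I" "\<And>x. x \<in> X \<Longrightarrow> f x \<in> I"
  shows "sum f X \<in> I"
  using assms(2) by (induction X rule: infinite_finite_induct)
    (auto intro: ideal_0[OF assms(1)] ideal_add[OF assms(1)])

lemma ideal_in_self: "unital_subring A \<Longrightarrow> ideal_in A A"
  by (auto simp: ideal_in_def subring_closed)

lemma subring_polys_over:
  assumes "unital_subring A"
  shows "unital_subring (polys_over A)"
  unfolding unital_subring_def polys_over_def
  by (auto simp: coeff_mult intro!: ideal_sum[OF ideal_in_self[OF assms]] subring_closed[OF assms])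

lemma ideal_polys_over:
  assumes "unital_subring A" "ideal_in A I"
  shows "ideal_in (polys_over A) (polys_over I)"
  unfolding ideal_in_def polys_over_def
  by (auto simp: coeff_mult intro!: ideal_sum[OF assms(2)] ideal_0[OF assms(2)] ideal_diff[OF assms(2)]
      ideal_mult[OF assms(2)] intro: ideal_subset[OF assms(2)])

lemma polys_over_monom: "0 \<in> A \<Longrightarrow> c \<in> A \<Longrightarrow> monom c k \<in> polys_over A"
  by (auto simp: polys_over_def)

lemma polys_over_smult: "(\<And>x. x \<in> A \<Longrightarrow> c * x \<in> A) \<Longrightarrow> p \<in> polys_over A \<Longrightarrow> smult c p \<in> polys_over A"
  by (auto simp: polys_over_def)

lemma polys_over_coeff: "p \<in> polys_over A \<Longrightarrow> coeff p i \<in> A"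
  by (auto simp: polys_over_def)

lemma subring_adjoin:
  assumes "unital_subring A"
  shows "unital_subring (adjoin A b)" "A \<subseteq> adjoin A b" "b \<in> adjoin A b"
proof -
  note P = subring_polys_over[OF assms]
  show "unital_subring (adjoin A b)"
    unfolding unital_subring_def adjoin_def
  proof (intro conjI ballI)
    show "1 \<in> (\<lambda>p. poly p b) ` polys_over A"
      using subring_1[OF P] by (force intro: image_eqI[of _ _ 1])
    fix x y assume "x \<in> (\<lambda>p. poly p b) ` polys_over A" "y \<in> (\<lambda>p. poly p b) ` polys_over A"
    then obtain p q where "p \<in> polys_over A" "q \<in> polys_over A" "x = poly p b" "y = poly q b"
      by auto
    then show "x - y \<in> (\<lambda>p. poly p b) ` polys_over A" "x * y \<in> (\<lambda>p. poly p b) ` polys_over A"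
      by (auto intro: image_eqI[of _ _ "p - q"] image_eqI[of _ _ "p * q"] subring_closed[OF P])
  qed
  show "A \<subseteq> adjoin A b"
    unfolding adjoin_def
    by (auto intro!: image_eqI[of _ _ "monom _ 0"] polys_over_monom subring_0[OF assms] simp: poly_monom)
  show "b \<in> adjoin A b"
    unfolding adjoin_def
    by (auto intro!: image_eqI[of _ _ "monom 1 1"] polys_over_monom subring_0 subring_1 assms simp: poly_monom)
qed

section \<open>Division of polynomials over a subring and modulo an ideal\<close>

text \<open>\<open>lead_coeff f\<close> need not be invertible in \<open>A\<close>, so each
  cancellation of the top term of \<open>h\<close> first multiplies \<open>h\<close> by it; these
  factors accumulate to \<open>lead_coeff f ^ N\<close>.\<close>

lemma pseudo_division_over:
  fixes f :: "'a::idom poly"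
  assumes A: "unital_subring A" and f: "f \<in> polys_over A" "degree f \<ge> 1"
    and h: "h \<in> polys_over A"
  shows "\<exists>N. \<exists>q\<in>polys_over A. \<exists>r\<in>polys_over A.
           smult (lead_coeff f ^ N) h = f * q + r \<and> degree r < degree f"
  using h
proof (induction "degree h" arbitrary: h rule: less_induct)
  case less
  note P = subring_polys_over[OF A]
  show ?case
  proof (cases "degree h < degree f")
    case True
    then show ?thesis using less.prems subring_0[OF P]
      by (intro exI[of _ 0] bexI[of _ 0] bexI[of _ h]) auto
  next
    case False
    define a m where "a = lead_coeff f" and "m = monom (lead_coeff h) (degree h - degree f)"
    define h' where "h' = smult a h - f * m"
    have a: "a \<in> A" using f by (simp add: a_def polys_over_coeff)
    have m: "m \<in> polys_over A"
      unfolding m_def using less.prems by (intro polys_over_monom subring_0[OF A] polys_over_coeff)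
    have a0: "a \<noteq> 0" using f by (auto simp: a_def)
    have h': "h' \<in> polys_over A"
      unfolding h'_def using less.prems m f a
      by (intro subring_diff[OF P] subring_mult[OF P] polys_over_smult subring_mult[OF A])
    have h0: "h \<noteq> 0" using False f by auto
    have "degree (f * m) = degree h"
      using f False h0 by (subst degree_mult_eq) (auto simp: m_def degree_monom_eq monom_eq_0_iff)
    then have le: "degree h' \<le> degree h"
      unfolding h'_def using a0 by (intro degree_diff_le) auto
    have "coeff (f * m) (degree h) = coeff (f * m) (degree f + degree m)"
      using False h0 by (simp add: m_def degree_monom_eq)
    also have "\<dots> = a * lead_coeff h"
      using h0 unfolding coeff_mult_degree_sum by (simp add: a_def m_def degree_monom_eq)
    finally have "coeff h' (degree h) = 0"
      by (simp add: h'_def)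
    then have "degree h' < degree h"
      using le f False by (metis degree_0 le_neq_implies_less leading_coeff_0_iff order_less_le_trans zero_less_one)
    from less.hyps[OF this h'] obtain N q r where *: "q \<in> polys_over A" "r \<in> polys_over A"
      "smult (a ^ N) h' = f * q + r" "degree r < degree f"
      unfolding a_def by blast
    have "smult (a ^ Suc N) h = f * (q + smult (a ^ N) m) + r"
      using *(3) by (simp add: h'_def smult_diff_right algebra_simps)
    moreover have "q + smult (a ^ N) m \<in> polys_over A"
      using * m a by (intro subring_add[OF P] polys_over_smult subring_closed[OF A])
    ultimately show ?thesis using * unfolding a_def by blast
  qed
qed

text \<open>The leading coefficient of \<open>f\<close> is invertible only modulo \<open>I\<close>,
  so cancelling the top coefficient \<open>c\<close> by means of \<open>u * c\<close> leaves an
  error in \<open>I\<close>, which is collected in \<open>i\<close>. Saying from which index on the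
  coefficients vanish, instead of speaking of degrees, treats the zero polynomial and the case
  \<open>degree f = 0\<close> uniformly.\<close>

lemma division_mod_ideal:
  fixes f :: "'a::idom poly"
  assumes A: "unital_subring A" and I: "ideal_in A I"
    and f: "f \<in> polys_over A" and u: "u \<in> A" "lead_coeff f * u - 1 \<in> I"
    and h: "h \<in> polys_over A" "\<And>i. i \<ge> m \<Longrightarrow> coeff h i = 0"
  shows "\<exists>q\<in>polys_over A. \<exists>i\<in>polys_over I. \<exists>r\<in>polys_over A.
           h = f * q + i + r \<and> (\<forall>j\<ge>degree f. coeff r j = 0)"
  using h
proof (induction m arbitrary: h)
  case 0
  note P = subring_polys_over[OF A]
  from 0 have "h = 0" by (simp add: poly_eq_iff)
  then show ?case
    using subring_0[OF P] ideal_0[OF ideal_polys_over[OF A I]]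
    by (intro bexI[of _ 0]) auto
next
  case (Suc m)
  note P = subring_polys_over[OF A] and J = ideal_polys_over[OF A I]
  show ?case
  proof (cases "m < degree f")
    case True
    then show ?thesis
      using subring_0[OF P] ideal_0[OF J] Suc.prems
      by (intro bexI[of _ 0] bexI[of _ h]) auto
  next
    case False
    define c where "c = coeff h m"
    have c: "c \<in> A" using Suc.prems by (simp add: c_def polys_over_coeff)
    define q where "q = monom (u * c) (m - degree f)"
    define e where "e = c - lead_coeff f * (u * c)"
    define h' where "h' = h - f * q - monom e m"
    have e: "e \<in> I"
    proof -
      have "e = - (c * (lead_coeff f * u - 1))" by (simp add: e_def algebra_simps)
      then show ?thesis using u c by (auto intro: ideal_uminus[OF I] ideal_mult[OF I])
    qed
    have q: "q \<in> polys_over A"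
      unfolding q_def using u c by (intro polys_over_monom subring_closed[OF A])
    have mon: "monom e m \<in> polys_over I"
      using e by (intro polys_over_monom ideal_0[OF I])
    have h': "h' \<in> polys_over A"
      unfolding h'_def using Suc.prems q f ideal_subset[OF J mon]
      by (intro subring_diff[OF P] subring_mult[OF P])
    have "coeff h' i = 0" if "i \<ge> m" for i
    proof (cases "i = m")
      case True
      have "coeff (f * q) m = lead_coeff f * (u * c)"
      proof -
        have "coeff (f * q) m = (\<Sum>j\<le>m. coeff f j * (if m - degree f = m - j then u * c else 0))"
          by (simp add: coeff_mult q_def)
        also have "\<dots> = (\<Sum>j\<le>m. if j = degree f then coeff f j * (u * c) else 0)"
          using False by (intro sum.cong) auto
        finally show ?thesis using False by simp
      qed
      then show ?thesis using True by (simp add: h'_def e_def c_def)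
    next
      case False
      then have "i > m" using that by simp
      moreover have "coeff (f * q) i = 0" if "i > m"
      proof (rule coeff_eq_0)
        have "degree (f * q) \<le> degree f + degree q" by (rule degree_mult_le)
        also have "degree q \<le> m - degree f" unfolding q_def by (rule degree_monom_le)
        finally show "degree (f * q) < i" using that \<open>\<not> m < degree f\<close> by simp
      qed
      ultimately show ?thesis using Suc.prems(2)[of i] by (simp add: h'_def)
    qed
    from Suc.IH[OF h' this] obtain q' i r where *: "q' \<in> polys_over A" "i \<in> polys_over I"
      "r \<in> polys_over A" "h' = f * q' + i + r" "\<forall>j\<ge>degree f. coeff r j = 0"
      by blast
    have "h = f * (q' + q) + (i + monom e m) + r"
      using *(4) by (simp add: h'_def algebra_simps)
    then show ?thesis
      using *(5) subring_add[OF P *(1) q] ideal_add[OF J *(2) mon] *(3) by blast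
  qed
qed

text \<open>Modulo \<open>I\<close>, the leading coefficient of \<open>f\<close> is a unit, so \<open>f * q\<close> cannot be a nonzero constant.\<close>

lemma constant_multiple_mod_ideal:
  fixes f :: "'a::idom poly"
  assumes A: "unital_subring A" and I: "ideal_in A I"
    and f: "f \<in> polys_over A" "degree f \<ge> 1" and u: "u \<in> A" "lead_coeff f * u - 1 \<in> I"
    and q: "q \<in> polys_over A" and c: "f * q - [:c:] \<in> polys_over I"
  shows "c \<in> I"
proof -
  have qI: "coeff q j \<in> I" for j
  proof (rule ccontr)
    assume j: "coeff q j \<notin> I"
    define S where "S = {j. coeff q j \<notin> I}"
    have "S \<subseteq> {..degree q}"
      unfolding S_def using ideal_0[OF I] coeff_eq_0[of q] by (force simp: not_le[symmetric])
    then have fin: "finite S" by (rule finite_subset) simp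
    define k where "k = Max S"
    have k: "coeff q k \<notin> I" "\<And>l. l > k \<Longrightarrow> coeff q l \<in> I"
    proof -
      have "k \<in> S" unfolding k_def using fin j by (intro Max_in) (auto simp: S_def)
      then show "coeff q k \<notin> I" by (simp add: S_def)
      show "coeff q l \<in> I" if "l > k" for l
        using Max_ge[OF fin, of l] that by (force simp: k_def S_def)
    qed
    define d where "d = degree f"
    \<comment> \<open>\<open>k\<close> is the last index at which \<open>q\<close> has a coefficient
      outside \<open>I\<close>. At \<open>d + k\<close> the constant \<open>c\<close> is invisible
      because \<open>d \<ge> 1\<close>, and all terms of the product other than
      \<open>coeff f d * coeff q k\<close> lie in \<open>I\<close>.\<close>
    have "coeff (f * q - [:c:]) (d + k) \<in> I" using c by (rule polys_over_coeff)
    moreover have "coeff [:c:] (d + k) = 0"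
      using f by (simp add: d_def coeff_eq_0)
    ultimately have "coeff (f * q) (d + k) \<in> I" by simp
    moreover have "coeff (f * q) (d + k) =
        coeff f d * coeff q k + (\<Sum>l\<in>{..d + k} - {d}. coeff f l * coeff q (d + k - l))"
      by (simp add: coeff_mult sum.remove[of "{..d + k}" d])
    moreover have "(\<Sum>l\<in>{..d + k} - {d}. coeff f l * coeff q (d + k - l)) \<in> I"
    proof (rule ideal_sum[OF I])
      fix l assume "l \<in> {..d + k} - {d}"
      then consider "l < d" | "l > d" by fastforce
      then show "coeff f l * coeff q (d + k - l) \<in> I"
      proof cases
        case 1
        then show ?thesis by (intro ideal_mult[OF I] k(2) polys_over_coeff[OF f(1)]) auto
      next
        case 2
        then show ?thesis by (simp add: d_def coeff_eq_0 ideal_0[OF I])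
      qed
    qed
    ultimately have "coeff f d * coeff q k \<in> I"
      using ideal_diff[OF I] by (metis add_diff_cancel_right')
    \<comment> \<open>The difference on the left is just \<open>coeff q k\<close>.\<close>
    then have "u * (coeff f d * coeff q k) - coeff q k * (lead_coeff f * u - 1) \<in> I"
      by (rule ideal_diff[OF I ideal_mult[OF I u(1)] ideal_mult[OF I polys_over_coeff[OF q] u(2)]])
    then show False using k(1) by (simp add: d_def algebra_simps)
  qed
  have "coeff (f * q - [:c:]) 0 \<in> I" using c by (rule polys_over_coeff)
  moreover have "coeff (f * q) 0 \<in> I"
    using qI polys_over_coeff[OF f(1)] by (simp add: coeff_mult ideal_mult[OF I])
  ultimately have "coeff (f * q) 0 - coeff (f * q - [:c:]) 0 \<in> I" by (intro ideal_diff[OF I])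
  then show ?thesis by simp
qed

text \<open>\<open>J\<close> is the image of the ideal generated by \<open>I\<close> and
  \<open>f\<close> in the polynomial ring under evaluation at \<open>b\<close>. The danger is that
  evaluation makes it improper; the hypothesis on polynomials vanishing at \<open>b\<close> excludes
  this. That hypothesis serves two cases at once: \<open>b\<close> transcendental, where only
  \<open>h = 0\<close> occurs, and \<open>f\<close> a relation of least degree for
  \<open>b\<close>.\<close>

lemma ideal_extension:
  fixes f :: "'a::idom poly"
  assumes A: "unital_subring A" and I: "ideal_in A I" "1 \<notin> I" "finite_modulo A I"
    and f: "f \<in> polys_over A" "degree f \<ge> 1" and u: "u \<in> A" "lead_coeff f * u - 1 \<in> I"
    and ker: "\<And>h. h \<in> polys_over A \<Longrightarrow> poly h b = 0 \<Longrightarrow>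
               \<exists>N. \<exists>q\<in>polys_over A. smult (lead_coeff f ^ N) h = f * q"
  shows "\<exists>J. ideal_in (adjoin A b) J \<and> 1 \<notin> J \<and> finite_modulo (adjoin A b) J \<and> I \<subseteq> J \<and> poly f b \<in> J"
proof (intro exI conjI)
  note P = subring_polys_over[OF A] and IP = ideal_polys_over[OF A I(1)]
  define J where "J = (\<lambda>(i, q). poly (i + f * q) b) ` (polys_over I \<times> polys_over A)"
  have JI: "poly (i + f * q) b \<in> J" if "i \<in> polys_over I" "q \<in> polys_over A" for i q
    unfolding J_def using that by (intro image_eqI[of _ _ "(i, q)"]) auto
  show "ideal_in (adjoin A b) J"
    unfolding ideal_in_def
  proof (intro conjI ballI subsetI)
    fix x assume "x \<in> J"
    then obtain i q where x: "i \<in> polys_over I" "q \<in> polys_over A" "x = poly (i + f * q) b"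
      by (auto simp: J_def)
    then have "i + f * q \<in> polys_over A"
      using f ideal_subset[OF IP] by (intro subring_add[OF P] subring_mult[OF P])
    then show "x \<in> adjoin A b" using x(3) unfolding adjoin_def by blast
    show "x - y \<in> J" if "y \<in> J" for y
    proof -
      from that obtain i' q' where y: "i' \<in> polys_over I" "q' \<in> polys_over A" "y = poly (i' + f * q') b"
        by (auto simp: J_def)
      have "x - y = poly ((i - i') + f * (q - q')) b" using x y by (simp add: algebra_simps)
      then show ?thesis using JI[OF ideal_diff[OF IP] subring_diff[OF P]] x y by metis
    qed
    show "a * x \<in> J" if "a \<in> adjoin A b" for a
    proof -
      from that obtain p where p: "p \<in> polys_over A" "a = poly p b" by (auto simp: adjoin_def)
      have "a * x = poly (p * i + f * (p * q)) b" using x p by (simp add: algebra_simps)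
      then show ?thesis using JI[OF ideal_mult[OF IP] subring_mult[OF P]] x p by metis
    qed
  next
    show "0 \<in> J" using JI[OF ideal_0[OF IP] subring_0[OF P]] by simp
  qed
  show "I \<subseteq> J"
    using JI[OF polys_over_monom[OF ideal_0[OF I(1)], of _ 0] subring_0[OF P]] by (auto simp: poly_monom)
  show "poly f b \<in> J" using JI[OF ideal_0[OF IP] subring_1[OF P]] by simp
  show "1 \<notin> J"
  proof
    assume "1 \<in> J"
    then obtain i q where iq: "i \<in> polys_over I" "q \<in> polys_over A" "1 = poly (i + f * q) b"
      by (auto simp: J_def)
    define h where "h = 1 - i - f * q"
    have "h \<in> polys_over A"
      unfolding h_def using iq f ideal_subset[OF IP]
      by (intro subring_diff[OF P] subring_mult[OF P] subring_1[OF P])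
    moreover have "poly h b = 0" using iq by (simp add: h_def algebra_simps)
    ultimately obtain N q' where q': "q' \<in> polys_over A" "smult (lead_coeff f ^ N) h = f * q'"
      using ker by blast
    define a where "a = lead_coeff f"
    have a: "a \<in> A" unfolding a_def using f by (intro polys_over_coeff)
    have aN: "a ^ N \<in> A" by (rule subring_power[OF A a])
    \<comment> \<open>From \<open>h = 1 - i - f * q\<close> and \<open>a ^ N * h = f * q'\<close>,
      the constant \<open>a ^ N\<close> is a multiple of \<open>f\<close> up to a polynomial over
      \<open>I\<close>. It therefore lies in \<open>I\<close>, which is absurd because
      \<open>a\<close> is a unit modulo the proper ideal \<open>I\<close>.\<close>
    have "f * (q' + smult (a ^ N) q) - [:a ^ N:] = - smult (a ^ N) i"
      using q'(2) by (simp add: h_def a_def algebra_simps smult_diff_right smult_add_right one_pCons)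
    moreover have "- smult (a ^ N) i \<in> polys_over I"
      using iq aN by (intro ideal_uminus[OF IP] polys_over_smult ideal_mult[OF I(1)])
    moreover have "q' + smult (a ^ N) q \<in> polys_over A"
      using iq q' aN by (intro subring_add[OF P] polys_over_smult subring_mult[OF A])
    ultimately have "a ^ N \<in> I"
      using constant_multiple_mod_ideal[OF A I(1) f u] by metis
    moreover have "a ^ k * x \<in> I \<Longrightarrow> x \<in> A \<Longrightarrow> x \<in> I" for k x
    proof (induction k)
      case (Suc k)
      have "u * (a ^ Suc k * x) - (a ^ k * x) * (a * u - 1) \<in> I"
        using Suc.prems u a unfolding a_def
        by (intro ideal_diff[OF I(1) ideal_mult[OF I(1)] ideal_mult[OF I(1)]] subring_mult[OF A] subring_power[OF A])
      then have "a ^ k * x \<in> I" by (simp add: algebra_simps)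
      then show ?case using Suc by simp
    qed simp
    from this[of N 1] have "1 \<in> I" using calculation subring_1[OF A] by simp
    then show False using I by simp
  qed
  show "finite_modulo (adjoin A b) J"
  proof -
    obtain R where R: "finite R" "R \<subseteq> A" "\<And>a. a \<in> A \<Longrightarrow> \<exists>r\<in>R. a - r \<in> I"
      using I(3) unfolding finite_modulo_def by blast
    obtain \<rho> where \<rho>: "\<And>a. a \<in> A \<Longrightarrow> \<rho> a \<in> R \<and> a - \<rho> a \<in> I" using R(3) by metis
    define d where "d = degree f"
    \<comment> \<open>Division by \<open>f\<close> modulo \<open>I\<close> leaves remainders with at
      most \<open>d\<close> coefficients, and each of these may be replaced by its representative in
      \<open>R\<close>.\<close>
    define R' where "R' = (\<lambda>c :: nat \<Rightarrow> 'a. poly (\<Sum>l<d. monom (c l) l) b) ` (Pi\<^sub>E {..<d} (\<lambda>_. R))"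
    have "(\<Sum>l<d. monom (c l) l) \<in> polys_over A" if "c \<in> Pi\<^sub>E {..<d} (\<lambda>_. R)" for c
      using that R(2)
      by (intro ideal_sum[OF ideal_in_self[OF P]] polys_over_monom subring_0[OF A]) (auto simp: PiE_iff)
    then have "R' \<subseteq> adjoin A b"
      unfolding R'_def adjoin_def by auto
    moreover have "finite R'" unfolding R'_def using R(1) by (intro finite_imageI finite_PiE) auto
    moreover have "\<exists>r\<in>R'. a - r \<in> J" if "a \<in> adjoin A b" for a
    proof -
      from that obtain h where h: "h \<in> polys_over A" "a = poly h b" by (auto simp: adjoin_def)
      obtain q i r where *: "q \<in> polys_over A" "i \<in> polys_over I" "r \<in> polys_over A"
        "h = f * q + i + r" "\<forall>j\<ge>d. coeff r j = 0"
        using division_mod_ideal[OF A I(1) f(1) u h(1), of "Suc (degree h)"] coeff_eq_0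
        unfolding d_def by (metis Suc_le_lessD)
      define c where "c = restrict (\<lambda>l. \<rho> (coeff r l)) {..<d}"
      have "c \<in> Pi\<^sub>E {..<d} (\<lambda>_. R)" using \<rho> *(3) by (auto simp: c_def polys_over_coeff)
      moreover have "r - (\<Sum>l<d. monom (c l) l) \<in> polys_over I"
        unfolding polys_over_def mem_Collect_eq
      proof
        fix j
        have "coeff (\<Sum>l<d. monom (c l) l) j = (if j < d then c j else 0)"
          by (simp add: coeff_sum)
        then show "coeff (r - (\<Sum>l<d. monom (c l) l)) j \<in> I"
          using \<rho>[OF polys_over_coeff[OF *(3)], of j] *(5) ideal_0[OF I(1)] by (auto simp: c_def)
      qed
      from JI[OF ideal_add[OF IP *(2) this] *(1)]
      have "a - poly (\<Sum>l<d. monom (c l) l) b \<in> J" using h *(4) by (simp add: algebra_simps)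
      ultimately show ?thesis unfolding R'_def by blast
    qed
    ultimately show ?thesis unfolding finite_modulo_def by blast
  qed
qed

section \<open>Units modulo ideals of finite index: the integers and simple extensions\<close>

lemma Ints_residually_finite_domain:
  "residually_finite_domain (\<int> :: 'a::{idom, ring_char_0} set)"
  unfolding residually_finite_domain_def
proof (intro conjI ballI)
  show "unital_subring (\<int> :: 'a set)" by (auto simp: unital_subring_def)
  fix s :: 'a assume "s \<in> \<int> - {0}"
  then obtain z where z: "s = of_int z" "z \<noteq> 0" by (auto elim: Ints_cases)
  \<comment> \<open>With this modulus the inverse of \<open>z\<close> is explicit:
    \<open>z * (- sgn z) = - \<bar>z\<bar> = 1 - m\<close>. Since \<open>z\<close> is nonzero,
    \<open>m \<ge> 2\<close>, so the ideal is proper.\<close>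
  define m where "m = \<bar>z\<bar> + 1"
  have m: "m \<ge> 2" using z by (simp add: m_def)
  define I where "I = range (\<lambda>k. of_int (m * k) :: 'a)"
  have "ideal_in \<int> I"
    unfolding ideal_in_def
  proof (intro conjI ballI)
    show "I \<subseteq> \<int>" by (auto simp: I_def)
    show "0 \<in> I" unfolding I_def by (rule image_eqI[of _ _ 0]) auto
    fix x assume "x \<in> I"
    then obtain k where k: "x = of_int (m * k)" by (auto simp: I_def)
    show "x - y \<in> I" if "y \<in> I" for y
    proof -
      from that obtain l where "y = of_int (m * l)" by (auto simp: I_def)
      then have "x - y = of_int (m * (k - l))" using k by (simp add: algebra_simps)
      then show ?thesis unfolding I_def by blast
    qed
    show "a * x \<in> I" if "a \<in> \<int>" for a
    proof -
      from that obtain l where "a = of_int l" by (auto elim: Ints_cases)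
      then have "a * x = of_int (m * (l * k))" using k by simp
      then show ?thesis unfolding I_def by blast
    qed
  qed
  moreover have "1 \<notin> I"
  proof
    assume "1 \<in> I"
    then obtain k where "(1::'a) = of_int (m * k)" by (auto simp: I_def)
    then have "m * k = 1" by (metis of_int_1 of_int_eq_iff)
    then show False using m by (auto simp: zmult_eq_1_iff)
  qed
  moreover have "finite_modulo \<int> I"
    unfolding finite_modulo_def
  proof (intro exI conjI ballI)
    show "finite (of_int ` {0..<m} :: 'a set)" by simp
    show "of_int ` {0..<m} \<subseteq> (\<int> :: 'a set)" by auto
    fix a :: 'a assume "a \<in> \<int>"
    then obtain l where l: "a = of_int l" by (auto elim: Ints_cases)
    have "a - of_int (l mod m) = of_int (m * (l div m))"
      unfolding l by (metis add_diff_cancel_right' mult_div_mod_eq of_int_diff)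
    then show "\<exists>r\<in>of_int ` {0..<m}. a - r \<in> I"
      using m by (intro bexI[of _ "of_int (l mod m)"]) (auto simp: I_def)
  qed
  moreover have "\<exists>u\<in>\<int>. s * u - 1 \<in> I"
  proof
    have "s * of_int (- sgn z) - 1 = of_int (m * - 1)"
      unfolding z by (simp add: m_def abs_sgn mult.commute flip: of_int_mult)
    then show "s * of_int (- sgn z) - 1 \<in> I" unfolding I_def by blast
  qed simp
  ultimately show "\<exists>I. ideal_in \<int> I \<and> 1 \<notin> I \<and> finite_modulo \<int> I \<and> (\<exists>u\<in>\<int>. s * u - 1 \<in> I)"
    by blast
qed

text \<open>A combination of least degree that does not vanish at \<open>b\<close> is constant: otherwise pseudo-dividing
  the minimal relation \<open>f\<close> by it would give a smaller relation or a smaller combination.\<close>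

lemma constant_multiple_over_minimal_relation:
  fixes f g :: "'a::idom poly"
  assumes A: "unital_subring A"
    and f: "f \<in> polys_over A" "degree f \<ge> 1" "poly f b = 0"
    and min: "\<And>h. h \<in> polys_over A \<Longrightarrow> poly h b = 0 \<Longrightarrow> degree h < degree f \<Longrightarrow> h = 0"
    and g: "g \<in> polys_over A" "poly g b \<noteq> 0"
  shows "\<exists>v\<in>adjoin A b. poly g b * v \<in> A - {0}"
proof -
  note P = subring_polys_over[OF A] and B = subring_adjoin(1)[OF A, of b]
  \<comment> \<open>\<open>C w\<close> says that \<open>w\<close> represents a nonzero element of
    the principal ideal of \<open>adjoin A b\<close> generated by \<open>poly g b\<close>; a
    constant \<open>w\<close> of this kind is what is sought.\<close>
  define C where "C w \<longleftrightarrow> w \<in> polys_over A \<and> poly w b \<noteq> 0 \<and> (\<exists>v\<in>adjoin A b. poly w b = poly g b * v)" for w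
  have "C g" using g subring_1[OF B] by (auto simp: C_def intro!: bexI[of _ 1])
  then obtain w where w: "C w" and w_min: "\<And>w'. C w' \<Longrightarrow> degree w \<le> degree w'"
    using exists_least_lemma[of "\<lambda>k. \<exists>w. C w \<and> degree w = k"] by (metis ex_has_least_nat)
  from w obtain v where wP: "w \<in> polys_over A" and wb: "poly w b \<noteq> 0" and v: "v \<in> adjoin A b" "poly w b = poly g b * v"
    by (auto simp: C_def)
  have inB: "poly p b \<in> adjoin A b" if "p \<in> polys_over A" for p
    using that by (auto simp: adjoin_def)
  \<comment> \<open>Replacing \<open>w\<close> by its remainder modulo \<open>f\<close> multiplies
    the value at \<open>b\<close> only by a nonzero element of \<open>A\<close>, because
    \<open>f\<close> vanishes at \<open>b\<close>; so the remainder satisfies \<open>C\<close>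
    again.\<close>
  have deg_lt: "degree w < degree f"
  proof (rule ccontr)
    assume "\<not> degree w < degree f"
    obtain N q r where *: "q \<in> polys_over A" "r \<in> polys_over A"
      "smult (lead_coeff f ^ N) w = f * q + r" "degree r < degree f"
      using pseudo_division_over[OF A f(1,2) wP] by blast
    have c: "lead_coeff f ^ N \<in> A" "lead_coeff f ^ N \<noteq> 0"
      using f by (auto intro!: subring_power[OF A] polys_over_coeff)
    have "poly r b = lead_coeff f ^ N * poly w b"
      using arg_cong[OF *(3), of "\<lambda>p. poly p b"] f(3) by simp
    then have "poly r b = poly g b * (lead_coeff f ^ N * v)" "poly r b \<noteq> 0"
      using v c wb by (auto simp: mult_ac)
    moreover have "lead_coeff f ^ N * v \<in> adjoin A b"
      using c v subring_adjoin(2)[OF A] by (intro subring_mult[OF B]) auto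
    ultimately have "C r" unfolding C_def using *(2) by blast
    then show False using w_min[of r] *(4) \<open>\<not> degree w < degree f\<close> by simp
  qed
  have "degree w = 0"
  proof (rule ccontr)
    assume "degree w \<noteq> 0"
    then have w1: "degree w \<ge> 1" by simp
    obtain N q r where *: "q \<in> polys_over A" "r \<in> polys_over A"
      "smult (lead_coeff w ^ N) f = w * q + r" "degree r < degree w"
      using pseudo_division_over[OF A wP w1 f(1)] by blast
    have r: "poly r b = poly g b * (- (v * poly q b))"
      using arg_cong[OF *(3), of "\<lambda>p. poly p b"] f(3) v(2) by (simp add: eq_neg_iff_add_eq_0 algebra_simps)
    have "- (v * poly q b) \<in> adjoin A b"
      by (intro subring_uminus[OF B] subring_mult[OF B] v(1) inB *(1))
    with r *(2) have "C r" if "poly r b \<noteq> 0" unfolding C_def using that by blast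
    then have rb: "poly r b = 0" using w_min[of r] *(4) by auto
    then have "r = 0" using *(4) deg_lt by (intro min[OF *(2)]) auto
    moreover have "poly q b = 0" using r rb v wb by auto
    ultimately have eq: "smult (lead_coeff w ^ N) f = w * q" and q: "poly q b = 0" using * by auto
    have w0: "w \<noteq> 0" "f \<noteq> 0" using w1 f by auto
    then have "q \<noteq> 0" using eq by auto
    then have "degree f = degree w + degree q"
      using arg_cong[OF eq, of degree] w0 by (simp add: degree_mult_eq)
    then have "q = 0" using w1 by (intro min[OF *(1) q]) auto
    then show False using \<open>q \<noteq> 0\<close> by simp
  qed
  then obtain c where "w = [:c:]" by (metis degree_0_id)
  then have "poly w b \<in> A" using polys_over_coeff[OF wP, of 0] by simp
  then show ?thesis using v wb by auto
qed

text \<open>The task is to choose \<open>f\<close> and one nonzero \<open>t\<close> in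
  \<open>A\<close> such that invertibility of \<open>t\<close> modulo an ideal of \<open>A\<close>
  makes both the leading coefficient of \<open>f\<close> invertible there and \<open>s\<close>
  invertible modulo the extended ideal. \<open>Z\<close> is the set of nonzero relations satisfied
  by \<open>b\<close>, so the case split is whether \<open>b\<close> is transcendental over
  \<open>A\<close>.\<close>

lemma adjoin_residually_finite_domain:
  assumes good: "residually_finite_domain A"
  shows "residually_finite_domain (adjoin A b)"
proof -
  have A: "unital_subring A" using good by (simp add: residually_finite_domain_def)
  note P = subring_polys_over[OF A] and B = subring_adjoin[OF A, of b]
  have goodA: "\<exists>I. ideal_in A I \<and> 1 \<notin> I \<and> finite_modulo A I \<and> (\<exists>u\<in>A. t * u - 1 \<in> I)"
    if "t \<in> A" "t \<noteq> 0" for t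
    using that good by (auto simp: residually_finite_domain_def)
  have "\<exists>J. ideal_in (adjoin A b) J \<and> 1 \<notin> J \<and> finite_modulo (adjoin A b) J \<and>
           (\<exists>u\<in>adjoin A b. s * u - 1 \<in> J)" if s: "s \<in> adjoin A b" "s \<noteq> 0" for s
  proof -
    obtain g where g: "g \<in> polys_over A" "s = poly g b" using s by (auto simp: adjoin_def)
    define Z where "Z = {h \<in> polys_over A. h \<noteq> 0 \<and> poly h b = 0}"
    show ?thesis
    proof (cases "Z = {}")
      case True
      text \<open>\<open>b\<close> is transcendental: adjoin a root of \<open>f = g - 1\<close>, which makes \<open>s\<close> congruent to \<open>1\<close>. If \<open>g\<close>
        is constant, any monic \<open>f\<close> will do.\<close>
      define f where "f = (if degree g = 0 then [:0, 1:] else g - 1)"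
      define t where "t = (if degree g = 0 then s else lead_coeff g)"
      have tA: "t \<in> A" "t \<noteq> 0"
      proof -
        have "s = coeff g 0" if "degree g = 0" using degree_0_id[OF that] g by (metis mult_zero_right poly_0 poly_pCons add.right_neutral)
        then show "t \<in> A" using g by (auto simp: t_def polys_over_coeff)
        show "t \<noteq> 0" using s by (auto simp: t_def)
      qed
      have f: "f \<in> polys_over A" "degree f \<ge> 1"
      proof -
        have "[:0, 1:] \<in> polys_over A"
          using subring_0[OF A] subring_1[OF A] by (auto simp: polys_over_def coeff_pCons split: nat.splits)
        then show "f \<in> polys_over A"
          unfolding f_def using g by (auto intro!: subring_diff[OF P] subring_1[OF P])
        have "degree (g - 1) = degree g" if "degree g \<noteq> 0"
          using that degree_add_eq_left[of "- 1" g] by simp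
        then show "degree f \<ge> 1" by (auto simp: f_def)
      qed
      have lf: "lead_coeff f = (if degree g = 0 then 1 else lead_coeff g)"
      proof -
        have "degree (g - 1) = degree g" if "degree g \<noteq> 0"
          using that degree_add_eq_left[of "- 1" g] by simp
        then show ?thesis by (auto simp: f_def)
      qed
      obtain I u where I: "ideal_in A I" "1 \<notin> I" "finite_modulo A I" "u \<in> A" "t * u - 1 \<in> I"
        using goodA[OF tA] by blast
      obtain u' where u': "u' \<in> A" "lead_coeff f * u' - 1 \<in> I"
      proof (cases "degree g = 0")
        case True
        then show ?thesis using that[of 1] subring_1[OF A] ideal_0[OF I(1)] by (simp add: lf)
      next
        case False
        then show ?thesis using that[of u] I(4,5) by (simp add: lf t_def)
      qed
      have ker: "\<exists>N. \<exists>q\<in>polys_over A. smult (lead_coeff f ^ N) h = f * q"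
        if "h \<in> polys_over A" "poly h b = 0" for h
      proof -
        have "h = 0" using True that by (auto simp: Z_def)
        then show ?thesis using subring_0[OF P] by (intro exI[of _ 0] bexI[of _ 0]) auto
      qed
      obtain J where J: "ideal_in (adjoin A b) J" "1 \<notin> J" "finite_modulo (adjoin A b) J" "I \<subseteq> J" "poly f b \<in> J"
        using ideal_extension[OF A I(1-3) f u' ker] by blast
      have "\<exists>u\<in>adjoin A b. s * u - 1 \<in> J"
      proof (cases "degree g = 0")
        case True
        then show ?thesis using I J B(2) by (auto simp: t_def)
      next
        case False
        then show ?thesis using J g subring_1[OF B(1)] by (auto simp: f_def intro!: bexI[of _ 1])
      qed
      then show ?thesis using J by blast
    next
      case False
      then obtain h where "h \<in> Z" by blast
      then obtain f where f: "f \<in> Z" and f_min: "\<And>h. h \<in> Z \<Longrightarrow> degree f \<le> degree h"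
        using ex_has_least_nat[of "\<lambda>h. h \<in> Z" h degree] by blast
      then have fP: "f \<in> polys_over A" and f0: "f \<noteq> 0" "poly f b = 0" by (auto simp: Z_def)
      have f1: "degree f \<ge> 1"
      proof (rule ccontr)
        assume "\<not> degree f \<ge> 1"
        then obtain c where "f = [:c:]" by (metis One_nat_def degree_0_id less_Suc0 not_le)
        then show False using f0 by auto
      qed
      have min: "h = 0" if "h \<in> polys_over A" "poly h b = 0" "degree h < degree f" for h
        using f_min[of h] that by (auto simp: Z_def)
      obtain v where v: "v \<in> adjoin A b" "s * v \<in> A" "s * v \<noteq> 0"
        using constant_multiple_over_minimal_relation[OF A fP f1 f0(2) min g(1)] s g by auto
      \<comment> \<open>One inversion serves two ends: the factor \<open>lead_coeff f\<close> makes
        division by \<open>f\<close> possible, and \<open>s * v\<close> is a multiple of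
        \<open>s\<close> that lies in \<open>A\<close>, so inverting it inverts
        \<open>s\<close>.\<close>
      define t where "t = lead_coeff f * (s * v)"
      have "t \<in> A" "t \<noteq> 0"
        using v f0 fP by (auto simp: t_def intro!: subring_mult[OF A] polys_over_coeff)
      then obtain I u where I: "ideal_in A I" "1 \<notin> I" "finite_modulo A I" "u \<in> A" "t * u - 1 \<in> I"
        using goodA by blast
      have u': "(s * v) * u \<in> A" "lead_coeff f * ((s * v) * u) - 1 \<in> I"
        using subring_mult[OF A v(2) I(4)] I(5) by (auto simp: t_def mult.assoc)
      have ker: "\<exists>N. \<exists>q\<in>polys_over A. smult (lead_coeff f ^ N) h = f * q"
        if h: "h \<in> polys_over A" "poly h b = 0" for h
      proof -
        obtain N q r where *: "q \<in> polys_over A" "r \<in> polys_over A"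
          "smult (lead_coeff f ^ N) h = f * q + r" "degree r < degree f"
          using pseudo_division_over[OF A fP f1 h(1)] by blast
        have "poly r b = 0" using arg_cong[OF *(3), of "\<lambda>p. poly p b"] h f0 by simp
        then have "r = 0" using * by (intro min)
        then show ?thesis using * by auto
      qed
      obtain J where J: "ideal_in (adjoin A b) J" "1 \<notin> J" "finite_modulo (adjoin A b) J" "I \<subseteq> J"
        using ideal_extension[OF A I(1-3) fP f1 u' ker] by blast
      have "v * (lead_coeff f * u) \<in> adjoin A b"
        using v I B(2) polys_over_coeff[OF fP] by (intro subring_mult[OF B(1)]) auto
      moreover have "s * (v * (lead_coeff f * u)) - 1 \<in> J"
        using I J by (auto simp: t_def mult_ac)
      ultimately show ?thesis using J by blast
    qed
  qed
  then show ?thesis using B(1) unfolding residually_finite_domain_def by blast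
qed

lemma finite_subset_residually_finite_domain:
  fixes X :: "'a::{idom, ring_char_0} set"
  assumes "finite X"
  shows "\<exists>A. residually_finite_domain A \<and> X \<subseteq> A"
  using assms
proof (induction X rule: finite_induct)
  case empty
  then show ?case using Ints_residually_finite_domain by blast
next
  case (insert b X)
  then obtain A where A: "residually_finite_domain A" "X \<subseteq> A" by blast
  then have "insert b X \<subseteq> adjoin A b"
    using subring_adjoin(2,3)[of A b] by (auto simp: residually_finite_domain_def)
  then show ?case using adjoin_residually_finite_domain[OF A(1)] by blast
qed

section \<open>Finite quotients of linear groups\<close>

text \<open>A constant map works: all distances are 0, and with the whole carrier as exceptional set
  the second condition is vacuous.\<close>

lemma coarsely_embeddable_finite:
  assumes "group G" "finite (carrier G)"
  shows "coarsely_embeddable TYPE('h::{real_inner, complete_space}) G"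
proof -
  have "coarse_embedding G (\<lambda>_. 0 :: 'h)"
    unfolding coarse_embedding_def using assms(2)
    by (auto intro!: exI[of _ 1] exI[of _ "carrier G"])
  then show ?thesis
    unfolding coarsely_embeddable_def using assms by (auto intro: countable_finite)
qed

text \<open>Local embeddability asks for targets whose elements are natural numbers, whereas a
  quotient group consists of cosets; its structure is transported along an injection.\<close>

lemma finite_group_nat_copy:
  assumes "group G" "finite (carrier G)"
  shows "\<exists>(G' :: nat monoid) f. group G' \<and> finite (carrier G') \<and> f \<in> hom G G' \<and> inj_on f (carrier G)"
proof -
  interpret group G by fact
  obtain f :: "'a \<Rightarrow> nat" where f: "inj_on f (carrier G)"
    using finite_imp_inj_to_nat_seg[OF assms(2)] by blast
  then have "group (image_group f G)" "f \<in> hom G (image_group f G)"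
    using inj_imp_image_group_is_group[OF f] inj_imp_image_group_iso[OF f] by (auto simp: iso_def)
  then show ?thesis using f assms(2) by (auto simp: image_group_carrier intro!: exI[of _ "image_group f G"])
qed

text \<open>Malcev: finitely generated linear groups are residually finite. The quotient is by the congruence
  subgroup of an ideal of finite index modulo which all differences of distinct matrices survive.\<close>

lemma (in group) separating_finite_quotient:
  fixes \<rho> :: "'a \<Rightarrow> 'd \<Rightarrow> 'd \<Rightarrow> 'k::{idom, ring_char_0}"
  assumes F: "finite F" "F \<subseteq> carrier G" and D: "finite D"
    and mult: "\<And>g h i j. g \<in> carrier G \<Longrightarrow> h \<in> carrier G \<Longrightarrow> i \<in> D \<Longrightarrow> j \<in> D \<Longrightarrow>
                 \<rho> (g \<otimes> h) i j = (\<Sum>l\<in>D. \<rho> g i l * \<rho> h l j)"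
    and one: "\<And>i j. i \<in> D \<Longrightarrow> j \<in> D \<Longrightarrow> \<rho> \<one> i j = (if i = j then 1 else 0)"
    and sep: "\<And>g h. g \<in> F \<Longrightarrow> h \<in> F \<Longrightarrow> g \<noteq> h \<Longrightarrow> \<exists>i\<in>D. \<exists>j\<in>D. \<rho> g i j \<noteq> \<rho> h i j"
  shows "\<exists>(G' :: nat monoid) \<phi>. group G' \<and> finite (carrier G') \<and> \<phi> \<in> hom (G\<lparr>carrier := generate G F\<rparr>) G' \<and>
           inj_on \<phi> F"
proof -
  define H where "H = G\<lparr>carrier := generate G F\<rparr>"
  have sub: "subgroup (generate G F) G" by (rule generate_is_subgroup[OF F(2)])
  interpret H: group H unfolding H_def by (rule subgroup.subgroup_is_group[OF sub group_axioms])
  have HG: "x \<in> carrier G" if "x \<in> carrier H" for x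
    using that subgroup.subset[OF sub] by (auto simp: H_def)
  have FH: "x \<in> carrier H" if "x \<in> F" for x using that by (auto simp: H_def generate.incl)
  have Hm: "x \<otimes>\<^bsub>H\<^esub> y = x \<otimes> y" "\<one>\<^bsub>H\<^esub> = \<one>" for x y by (auto simp: H_def)
  \<comment> \<open>The entries for inverses are included because the generated subgroup contains
    inverses, whose entries need not be ring expressions in those of the generators.\<close>
  obtain A where A: "residually_finite_domain A"
    "(\<Union>g\<in>F \<union> (\<lambda>g. inv g) ` F. \<Union>i\<in>D. \<rho> g i ` D) \<subseteq> A"
    using finite_subset_residually_finite_domain[of "\<Union>g\<in>F \<union> (\<lambda>g. inv g) ` F. \<Union>i\<in>D. \<rho> g i ` D"] F D by auto
  have S: "unital_subring A" using A by (simp add: residually_finite_domain_def)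
  have inA: "\<rho> g i j \<in> A" if "g \<in> carrier H" "i \<in> D" "j \<in> D" for g i j
  proof -
    from that(1) have "g \<in> generate G F" by (simp add: H_def)
    then show ?thesis using that(2,3)
    proof (induction g arbitrary: i j rule: generate.induct)
      case one
      then show ?case using assms(5) subring_0[OF S] subring_1[OF S] by auto
    next
      case (incl h)
      then show ?case using A(2) by blast
    next
      case (inv h)
      then show ?case using A(2) by blast
    next
      case (eng g h)
      then have "g \<in> carrier G" "h \<in> carrier G" using subgroup.subset[OF sub] by auto
      then show ?case using eng mult
        by (auto intro!: ideal_sum[OF ideal_in_self[OF S]] subring_mult[OF S])
    qed
  qed
  define P where "P = {p \<in> F \<times> F. fst p \<noteq> snd p}"
  have "\<forall>p\<in>P. \<exists>q\<in>D \<times> D. \<rho> (fst p) (fst q) (snd q) - \<rho> (snd p) (fst q) (snd q) \<noteq> 0"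
    using sep unfolding P_def by fastforce
  then obtain q where q: "\<And>p. p \<in> P \<Longrightarrow> q p \<in> D \<times> D \<and>
      \<rho> (fst p) (fst (q p)) (snd (q p)) - \<rho> (snd p) (fst (q p)) (snd (q p)) \<noteq> 0"
    by metis
  define \<delta> where "\<delta> p = \<rho> (fst p) (fst (q p)) (snd (q p)) - \<rho> (snd p) (fst (q p)) (snd (q p))" for p
  have finP: "finite P" unfolding P_def using F by auto
  have \<delta>A: "\<delta> p \<in> A" if "p \<in> P" for p
    unfolding \<delta>_def using that q[OF that] FH by (intro subring_diff[OF S] inA) (auto simp: P_def)
  have prodA: "prod \<delta> X \<in> A" if "X \<subseteq> P" for X
    using that by (induction X rule: infinite_finite_induct)
      (auto intro: subring_1[OF S] subring_mult[OF S] \<delta>A)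
  \<comment> \<open>One ideal has to separate all pairs at once. In a domain the product of the
    differences is nonzero; if it is a unit modulo a proper ideal, none of its factors lies in that
    ideal.\<close>
  have "prod \<delta> P \<noteq> 0" using q finP by (auto simp: \<delta>_def)
  then obtain I u where I: "ideal_in A I" "1 \<notin> I" "finite_modulo A I" "u \<in> A" "prod \<delta> P * u - 1 \<in> I"
    using A(1) prodA[of P] unfolding residually_finite_domain_def by blast
  have \<delta>I: "\<delta> p \<notin> I" if "p \<in> P" for p
  proof
    assume "\<delta> p \<in> I"
    then have "u * (prod \<delta> (P - {p}) * \<delta> p) \<in> I"
      using prodA I(1,4) by (intro ideal_mult[OF I(1)]) auto
    moreover have "prod \<delta> (P - {p}) * \<delta> p = prod \<delta> P"
      using finP that by (subst prod.remove[of P p]) (auto simp: mult.commute)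
    ultimately have "u * prod \<delta> P \<in> I" by simp
    from ideal_diff[OF I(1) this I(5)] have "u * prod \<delta> P - (prod \<delta> P * u - 1) \<in> I" .
    then show False using I by (simp add: algebra_simps)
  qed
  define E where "E g h \<longleftrightarrow> (\<forall>i\<in>D. \<forall>j\<in>D. \<rho> g i j - \<rho> h i j \<in> I)" for g h
  have E_refl: "E g g" for g using ideal_0[OF I(1)] by (simp add: E_def)
  \<comment> \<open>Multiplying on both sides at once covers all later uses: products, inverses and
    conjugates in \<open>K\<close>, and the passage between \<open>E g h\<close> and membership of
    the quotient of \<open>g\<close> and \<open>h\<close> in \<open>K\<close>.\<close>
  have E_mult: "E (x \<otimes>\<^bsub>H\<^esub> g \<otimes>\<^bsub>H\<^esub> y) (x \<otimes>\<^bsub>H\<^esub> h \<otimes>\<^bsub>H\<^esub> y)"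
    if "E g h" "x \<in> carrier H" "y \<in> carrier H" "g \<in> carrier H" "h \<in> carrier H" for x y g h
    unfolding E_def
  proof (intro ballI)
    fix i j assume ij: "i \<in> D" "j \<in> D"
    have expand: "\<rho> (x \<otimes>\<^bsub>H\<^esub> k \<otimes>\<^bsub>H\<^esub> y) i j = (\<Sum>l\<in>D. \<Sum>m\<in>D. \<rho> x i m * \<rho> k m l * \<rho> y l j)"
      if "k \<in> carrier H" for k
      using that \<open>x \<in> carrier H\<close> \<open>y \<in> carrier H\<close> ij HG by (simp add: Hm mult sum_distrib_right)
    have "\<rho> (x \<otimes>\<^bsub>H\<^esub> g \<otimes>\<^bsub>H\<^esub> y) i j - \<rho> (x \<otimes>\<^bsub>H\<^esub> h \<otimes>\<^bsub>H\<^esub> y) i j =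
        (\<Sum>l\<in>D. \<Sum>m\<in>D. \<rho> x i m * ((\<rho> g m l - \<rho> h m l) * \<rho> y l j))"
      using that by (simp add: expand sum_subtractf algebra_simps)
    also have "\<dots> \<in> I"
      using that ij unfolding E_def
      by (intro ideal_sum[OF I(1)] ideal_mult[OF I(1)] ideal_mult_right[OF I(1)] inA) auto
    finally show "\<rho> (x \<otimes>\<^bsub>H\<^esub> g \<otimes>\<^bsub>H\<^esub> y) i j - \<rho> (x \<otimes>\<^bsub>H\<^esub> h \<otimes>\<^bsub>H\<^esub> y) i j \<in> I" .
  qed
  have E_sym: "E h g" if "E g h" for g h
    unfolding E_def
  proof (intro ballI)
    fix i j assume "i \<in> D" "j \<in> D"
    then have "- (\<rho> g i j - \<rho> h i j) \<in> I" using that by (intro ideal_uminus[OF I(1)]) (simp add: E_def)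
    then show "\<rho> h i j - \<rho> g i j \<in> I" by simp
  qed
  have E_trans: "E g k" if "E g h" "E h k" for g h k
    unfolding E_def
  proof (intro ballI)
    fix i j assume "i \<in> D" "j \<in> D"
    then have "(\<rho> g i j - \<rho> h i j) + (\<rho> h i j - \<rho> k i j) \<in> I"
      using that by (intro ideal_add[OF I(1)]) (simp_all add: E_def)
    then show "\<rho> g i j - \<rho> k i j \<in> I" by simp
  qed
  define K where "K = {g \<in> carrier H. E g \<one>\<^bsub>H\<^esub>}"
  have K: "K \<lhd> H"
  proof (rule H.normal_invI)
    show "subgroup K H"
    proof (rule H.subgroupI)
      show "K \<subseteq> carrier H" "K \<noteq> {}" using E_refl by (auto simp: K_def)
      fix a assume a: "a \<in> K"
      then have "E (\<one>\<^bsub>H\<^esub>) (inv\<^bsub>H\<^esub> a)"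
        using E_mult[of a "\<one>\<^bsub>H\<^esub>" "inv\<^bsub>H\<^esub> a" "\<one>\<^bsub>H\<^esub>"] by (simp add: K_def)
      then show "inv\<^bsub>H\<^esub> a \<in> K" using a E_sym by (simp add: K_def)
      fix b assume b: "b \<in> K"
      have "E (a \<otimes>\<^bsub>H\<^esub> b) (\<one>\<^bsub>H\<^esub> \<otimes>\<^bsub>H\<^esub> b)"
        using E_mult[of a "\<one>\<^bsub>H\<^esub>" "\<one>\<^bsub>H\<^esub>" b] a b by (auto simp: K_def)
      then have "E (a \<otimes>\<^bsub>H\<^esub> b) b" using b by (simp add: K_def)
      then show "a \<otimes>\<^bsub>H\<^esub> b \<in> K" using a b E_trans[of _ b] by (simp add: K_def)
    qed
    fix x h assume "x \<in> carrier H" "h \<in> K"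
    then show "x \<otimes>\<^bsub>H\<^esub> h \<otimes>\<^bsub>H\<^esub> inv\<^bsub>H\<^esub> x \<in> K"
      using E_mult[of h "\<one>\<^bsub>H\<^esub>" x "inv\<^bsub>H\<^esub> x"] by (simp add: K_def)
  qed
  have K_E: "g \<otimes>\<^bsub>H\<^esub> inv\<^bsub>H\<^esub> h \<in> K \<longleftrightarrow> E g h" if "g \<in> carrier H" "h \<in> carrier H" for g h
  proof
    assume "g \<otimes>\<^bsub>H\<^esub> inv\<^bsub>H\<^esub> h \<in> K"
    then have "E (g \<otimes>\<^bsub>H\<^esub> inv\<^bsub>H\<^esub> h) \<one>\<^bsub>H\<^esub>" by (simp add: K_def)
    from E_mult[OF this H.one_closed that(2)] that show "E g h"
      by (simp add: H.m_assoc)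
  next
    assume "E g h"
    from E_mult[OF this H.one_closed H.inv_closed[OF that(2)] that]
    show "g \<otimes>\<^bsub>H\<^esub> inv\<^bsub>H\<^esub> h \<in> K" using that by (simp add: K_def)
  qed
  interpret K: normal K H by (rule K)
  have coset_eq: "K #>\<^bsub>H\<^esub> g = K #>\<^bsub>H\<^esub> h \<longleftrightarrow> E g h" if "g \<in> carrier H" "h \<in> carrier H" for g h
  proof -
    have "K #>\<^bsub>H\<^esub> g = K #>\<^bsub>H\<^esub> h \<longleftrightarrow> g \<otimes>\<^bsub>H\<^esub> inv\<^bsub>H\<^esub> h \<in> K"
    proof
      assume eq: "K #>\<^bsub>H\<^esub> g = K #>\<^bsub>H\<^esub> h"
      have "g \<in> K #>\<^bsub>H\<^esub> h" by (rule H.rcos_self[OF that(1) K.subgroup_axioms, unfolded eq])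
      then show "g \<otimes>\<^bsub>H\<^esub> inv\<^bsub>H\<^esub> h \<in> K" by (rule K.rcos_module_imp[OF H.group_axioms that(2)])
    next
      assume "g \<otimes>\<^bsub>H\<^esub> inv\<^bsub>H\<^esub> h \<in> K"
      then have "g \<in> K #>\<^bsub>H\<^esub> h" by (rule K.rcos_module_rev[OF H.group_axioms that(2,1)])
      then show "K #>\<^bsub>H\<^esub> g = K #>\<^bsub>H\<^esub> h"
        by (rule H.repr_independence[OF _ that(2) K.subgroup_axioms, symmetric])
    qed
    then show ?thesis using K_E[OF that] by (rule trans)
  qed
  obtain R where R: "finite R" "\<And>a. a \<in> A \<Longrightarrow> \<exists>r\<in>R. a - r \<in> I"
    using I(3) unfolding finite_modulo_def by blast
  obtain \<tau> where \<tau>: "\<And>a. a \<in> A \<Longrightarrow> \<tau> a \<in> R \<and> a - \<tau> a \<in> I" using R(2) by metis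
  \<comment> \<open>\<open>T g\<close> tabulates the residues of the matrix entries. Only finitely
    many tables exist, and equal tables mean congruent matrices, so \<open>K\<close> has finite
    index.\<close>
  define T where "T g = restrict (\<lambda>(i, j). \<tau> (\<rho> g i j)) (D \<times> D)" for g
  have T_E: "E g h" if "g \<in> carrier H" "h \<in> carrier H" "T g = T h" for g h
    unfolding E_def
  proof (intro ballI)
    fix i j assume ij: "i \<in> D" "j \<in> D"
    then have "\<tau> (\<rho> g i j) = \<tau> (\<rho> h i j)" using fun_cong[OF that(3), of "(i, j)"] by (simp add: T_def)
    moreover have "(\<rho> g i j - \<tau> (\<rho> g i j)) - (\<rho> h i j - \<tau> (\<rho> h i j)) \<in> I"
      using \<tau>[OF inA[OF that(1) ij]] \<tau>[OF inA[OF that(2) ij]] by (blast intro: ideal_diff[OF I(1)])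
    ultimately show "\<rho> g i j - \<rho> h i j \<in> I" by simp
  qed
  have fin: "finite (carrier (H Mod K))"
  proof -
    have "T ` carrier H \<subseteq> Pi\<^sub>E (D \<times> D) (\<lambda>_. R)"
    proof (rule image_subsetI)
      fix g assume "g \<in> carrier H"
      then show "T g \<in> Pi\<^sub>E (D \<times> D) (\<lambda>_. R)"
        using \<tau>[OF inA] unfolding T_def by (intro restrict_PiE_iff[THEN iffD2]) auto
    qed
    then have "finite (T ` carrier H)"
      using finite_PiE[of "D \<times> D" "\<lambda>_. R"] R(1) D by (auto intro: finite_subset)
    moreover have "carrier (H Mod K) \<subseteq> (\<lambda>t. K #>\<^bsub>H\<^esub> inv_into (carrier H) T t) ` (T ` carrier H)"
    proof
      fix X assume "X \<in> carrier (H Mod K)"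
      then obtain g where g: "g \<in> carrier H" "X = K #>\<^bsub>H\<^esub> g"
        by (auto simp: FactGroup_def RCOSETS_def)
      have "E g (inv_into (carrier H) T (T g))"
        using g by (intro T_E) (auto simp: f_inv_into_f inv_into_into)
      then have "X = K #>\<^bsub>H\<^esub> inv_into (carrier H) T (T g)"
        using g coset_eq[of g "inv_into (carrier H) T (T g)"] by (auto simp: inv_into_into)
      then show "X \<in> (\<lambda>t. K #>\<^bsub>H\<^esub> inv_into (carrier H) T t) ` (T ` carrier H)" using g by blast
    qed
    ultimately show ?thesis by (meson finite_imageI finite_subset)
  qed
  obtain G' :: "nat monoid" and f where G': "group G'" "finite (carrier G')" "f \<in> hom (H Mod K) G'"
    "inj_on f (carrier (H Mod K))"
    using finite_group_nat_copy[OF K.factorgroup_is_group fin] by blast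
  have "f \<circ> (\<lambda>g. K #>\<^bsub>H\<^esub> g) \<in> hom H G'"
    by (rule Group.hom_compose[OF K.r_coset_hom_Mod G'(3)])
  moreover have "inj_on (f \<circ> (\<lambda>g. K #>\<^bsub>H\<^esub> g)) F"
  proof (rule inj_onI, rule ccontr)
    fix g h assume gh: "g \<in> F" "h \<in> F" "(f \<circ> (\<lambda>g. K #>\<^bsub>H\<^esub> g)) g = (f \<circ> (\<lambda>g. K #>\<^bsub>H\<^esub> g)) h" "g \<noteq> h"
    then have "K #>\<^bsub>H\<^esub> g = K #>\<^bsub>H\<^esub> h"
      using inj_onD[OF G'(4)] FH by (auto simp: FactGroup_def RCOSETS_def)
    then have "E g h" using gh FH coset_eq by blast
    moreover have "(g, h) \<in> P" using gh by (simp add: P_def)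
    ultimately show False using \<delta>I[of "(g, h)"] q[of "(g, h)"] by (auto simp: E_def \<delta>_def)
  qed
  ultimately show ?thesis using G' unfolding H_def by blast
qed

section \<open>Power series in several variables\<close>

definition monomial :: "nat \<Rightarrow> (nat \<Rightarrow> nat) \<Rightarrow> (nat \<Rightarrow> real) \<Rightarrow> real" where
  "monomial n \<alpha> y = (\<Prod>i<n. y i ^ \<alpha> i)"

definition mdegree :: "nat \<Rightarrow> (nat \<Rightarrow> nat) \<Rightarrow> nat" where
  "mdegree n \<alpha> = (\<Sum>i<n. \<alpha> i)"

definition indices_upto :: "nat \<Rightarrow> nat \<Rightarrow> (nat \<Rightarrow> nat) set" where
  "indices_upto n k = {\<alpha> \<in> multi_indices n. mdegree n \<alpha> \<le> k}"

definition sum_norm :: "nat \<Rightarrow> (nat \<Rightarrow> real) \<Rightarrow> real" where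
  "sum_norm n y = (\<Sum>i<n. \<bar>y i\<bar>)"

lemma finite_indices_upto: "finite (indices_upto n k)"
proof (rule finite_subset)
  show "indices_upto n k \<subseteq> {\<alpha>. \<forall>i. (i \<in> {..<n} \<longrightarrow> \<alpha> i \<in> {..k}) \<and> (i \<notin> {..<n} \<longrightarrow> \<alpha> i = 0)}"
  proof
    fix \<alpha> assume *: "\<alpha> \<in> indices_upto n k"
    have "\<alpha> i \<le> k" if "i < n" for i
      using * member_le_sum[of i "{..<n}" \<alpha>] that by (auto simp: indices_upto_def mdegree_def)
    with * show "\<alpha> \<in> {\<alpha>. \<forall>i. (i \<in> {..<n} \<longrightarrow> \<alpha> i \<in> {..k}) \<and> (i \<notin> {..<n} \<longrightarrow> \<alpha> i = 0)}"
      by (simp add: indices_upto_def multi_indices_def)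
  qed
  show "finite {\<alpha> :: nat \<Rightarrow> nat. \<forall>i. (i \<in> {..<n} \<longrightarrow> \<alpha> i \<in> {..k}) \<and> (i \<notin> {..<n} \<longrightarrow> \<alpha> i = 0)}"
    by (rule finite_set_of_finite_funs) auto
qed

lemma sum_norm_nonneg: "sum_norm n y \<ge> 0"
  by (simp add: sum_norm_def sum_nonneg)

lemma abs_le_sum_norm: "i < n \<Longrightarrow> \<bar>y i\<bar> \<le> sum_norm n y"
  unfolding sum_norm_def using member_le_sum[of i "{..<n}" "\<lambda>i. \<bar>y i\<bar>"] by simp

lemma abs_monomial_le: "\<bar>monomial n \<alpha> y\<bar> \<le> sum_norm n y ^ mdegree n \<alpha>"
proof -
  have "\<bar>monomial n \<alpha> y\<bar> = (\<Prod>i<n. \<bar>y i\<bar> ^ \<alpha> i)"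
    by (simp add: monomial_def abs_prod power_abs)
  also have "\<dots> \<le> (\<Prod>i<n. sum_norm n y ^ \<alpha> i)"
    by (intro prod_mono conjI power_mono abs_le_sum_norm) auto
  also have "\<dots> = sum_norm n y ^ mdegree n \<alpha>"
    by (simp add: mdegree_def power_sum)
  finally show ?thesis .
qed

lemma monomial_scale: "monomial n \<alpha> (\<lambda>i. t * y i) = t ^ mdegree n \<alpha> * monomial n \<alpha> y"
  by (simp add: monomial_def mdegree_def power_mult_distrib prod.distrib power_sum)

lemma monomial_add: "monomial n (\<lambda>i. \<alpha> i + \<beta> i) y = monomial n \<alpha> y * monomial n \<beta> y"
  by (simp add: monomial_def power_add prod.distrib)

lemma polynomial_sum_eq_0:
  fixes a :: "nat \<Rightarrow> real"
  assumes "finite M" "infinite S" "\<And>t. t \<in> S \<Longrightarrow> (\<Sum>m\<in>M. a m * t ^ m) = 0" "m \<in> M"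
  shows "a m = 0"
proof -
  define p where "p = (\<Sum>m\<in>M. monom (a m) m)"
  have "poly p t = 0" if "t \<in> S" for t
    using assms(3)[OF that] by (simp add: p_def poly_sum poly_monom)
  then have "S \<subseteq> {t. poly p t = 0}" by blast
  then have "p = 0" using poly_roots_finite[of p] assms(2) infinite_super by blast
  then have "coeff p m = 0" by simp
  then show ?thesis using assms(1,4) by (simp add: p_def coeff_sum)
qed

text \<open>Induction on the number of variables: with the first \<open>n\<close> coordinates fixed,
  the sum is a polynomial in the last one with infinitely many roots, so its coefficients vanish,
  and these are combinations of monomials in \<open>n\<close> variables. Grids of infinite sets are
  allowed so that the lemma applies to boxes around any centre.\<close>

lemma monomials_independent:
  assumes "finite D" "D \<subseteq> multi_indices n" "\<And>i. i < n \<Longrightarrow> infinite (S i)"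
    and "\<And>y. (\<forall>i<n. y i \<in> S i) \<Longrightarrow> (\<forall>i\<ge>n. y i = 0) \<Longrightarrow> (\<Sum>\<alpha>\<in>D. c \<alpha> * monomial n \<alpha> y) = 0"
    and "\<alpha> \<in> D"
  shows "c \<alpha> = 0"
  using assms
proof (induction n arbitrary: D c \<alpha>)
  case 0
  then have "\<beta> = (\<lambda>_. 0)" if "\<beta> \<in> D" for \<beta>
    using that by (auto simp: multi_indices_def)
  then have D0: "D = {\<lambda>_. 0}" using 0(5) by blast
  have "(\<Sum>\<alpha>\<in>D. c \<alpha> * monomial 0 \<alpha> (\<lambda>_. 0)) = 0" by (rule 0(4)) auto
  then have "c (\<lambda>_. 0) = 0" by (simp add: D0 monomial_def)
  then show ?case using 0(5) D0 by blast
next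
  case (Suc n)
  define m where "m = \<alpha> n"
  define D' where "D' = {\<beta> \<in> D. \<beta> n = m}"
  \<comment> \<open>\<open>r\<close> erases the last exponent, as membership in
    \<open>multi_indices n\<close> demands; on \<open>D'\<close> nothing is lost, since that
    exponent is always \<open>m\<close>.\<close>
  define r where "r \<beta> = \<beta>(n := (0::nat))" for \<beta> :: "nat \<Rightarrow> nat"
  have inj: "inj_on r D'"
    by (rule inj_on_inverseI[of _ "\<lambda>\<beta>. \<beta>(n := m)"]) (auto simp: r_def D'_def)
  have mono: "monomial (Suc n) \<beta> (y(n := t)) = monomial n (r \<beta>) y * t ^ \<beta> n" for \<beta> y t
    unfolding monomial_def r_def by (auto simp: lessThan_Suc intro!: prod.cong)
  have "(\<Sum>\<beta>\<in>r ` D'. c (\<beta>(n := m)) * monomial n \<beta> y) = 0"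
    if y: "\<forall>i<n. y i \<in> S i" "\<forall>i\<ge>n. y i = 0" for y
  proof -
    have "(\<Sum>j\<in>(\<lambda>\<beta>. \<beta> n) ` D. (\<Sum>\<beta>\<in>{\<beta> \<in> D. \<beta> n = j}. c \<beta> * monomial n (r \<beta>) y) * t ^ j) = 0"
      if "t \<in> S n" for t
    proof -
      have "(\<Sum>\<beta>\<in>D. c \<beta> * monomial (Suc n) \<beta> (y(n := t))) = 0"
        by (rule Suc.prems(4)) (use y that in \<open>auto simp: less_Suc_eq\<close>)
      then have "0 = (\<Sum>\<beta>\<in>D. c \<beta> * monomial (Suc n) \<beta> (y(n := t)))" ..
      also have "\<dots> = (\<Sum>j\<in>(\<lambda>\<beta>. \<beta> n) ` D. \<Sum>\<beta>\<in>{\<beta> \<in> D. \<beta> n = j}. c \<beta> * monomial (Suc n) \<beta> (y(n := t)))"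
        by (rule sum.image_gen[OF Suc.prems(1)])
      also have "\<dots> = (\<Sum>j\<in>(\<lambda>\<beta>. \<beta> n) ` D. (\<Sum>\<beta>\<in>{\<beta> \<in> D. \<beta> n = j}. c \<beta> * monomial n (r \<beta>) y) * t ^ j)"
        by (intro sum.cong refl) (auto simp: sum_distrib_right mono mult.assoc intro!: sum.cong)
      finally show ?thesis by simp
    qed
    then have "(\<Sum>\<beta>\<in>{\<beta> \<in> D. \<beta> n = m}. c \<beta> * monomial n (r \<beta>) y) = 0"
      using Suc.prems(1,5) Suc.prems(3)[of n]
      by (intro polynomial_sum_eq_0[where M = "(\<lambda>\<beta>. \<beta> n) ` D" and S = "S n" and m = m
            and a = "\<lambda>j. \<Sum>\<beta>\<in>{\<beta> \<in> D. \<beta> n = j}. c \<beta> * monomial n (r \<beta>) y"])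
        (auto simp: m_def)
    moreover have "(r \<beta>)(n := m) = \<beta>" if "\<beta> \<in> D'" for \<beta>
      using that by (auto simp: r_def D'_def)
    ultimately show ?thesis
      by (simp add: sum.reindex[OF inj] flip: D'_def)
  qed
  moreover have "r ` D' \<subseteq> multi_indices n"
    using Suc.prems(2) by (auto simp: multi_indices_def r_def D'_def)
  moreover have "finite (r ` D')" using Suc.prems(1) by (simp add: D'_def)
  ultimately have "c ((r \<alpha>)(n := m)) = 0"
    using Suc.IH[of "r ` D'" "\<lambda>\<beta>. c (\<beta>(n := m))" "r \<alpha>"] Suc.prems(3,5) by (auto simp: D'_def m_def)
  then show ?case by (simp add: r_def m_def)
qed

section \<open>Taylor polynomials and the vanishing of power series\<close>

text \<open>If some coefficient were nonzero, the nonzero homogeneous part of least degree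
  \<open>m \<le> k\<close> would dominate along rays \<open>t * y\<close> as \<open>t\<close> tends
  to 0, against the bound of order \<open>k + 1\<close>. Hence that part vanishes on a whole box,
  which contradicts the independence of monomials.\<close>

lemma small_polynomial_eq_0:
  assumes D: "finite D" "D \<subseteq> indices_upto n k" and "\<epsilon> > 0"
    and bound: "\<And>y. (\<forall>i\<ge>n. y i = 0) \<Longrightarrow> (\<forall>i<n. \<bar>y i\<bar> < \<epsilon>) \<Longrightarrow>
                  \<bar>\<Sum>\<alpha>\<in>D. c \<alpha> * monomial n \<alpha> y\<bar> \<le> C * sum_norm n y ^ Suc k"
    and \<alpha>: "\<alpha> \<in> D"
  shows "c \<alpha> = 0"
proof (rule ccontr)
  assume "c \<alpha> \<noteq> 0"
  define Z where "Z = {\<alpha> \<in> D. c \<alpha> \<noteq> 0}"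
  obtain \<gamma> where \<gamma>: "\<gamma> \<in> Z" and \<gamma>_min: "\<And>\<beta>. \<beta> \<in> Z \<Longrightarrow> mdegree n \<gamma> \<le> mdegree n \<beta>"
    using ex_has_least_nat[of "\<lambda>\<beta>. \<beta> \<in> Z" \<alpha> "mdegree n"] \<alpha> \<open>c \<alpha> \<noteq> 0\<close> by (auto simp: Z_def)
  define m where "m = mdegree n \<gamma>"
  have mk: "m \<le> k" using \<gamma> D by (auto simp: Z_def m_def indices_upto_def)
  have finZ: "finite Z" using D by (simp add: Z_def)
  have "(\<Sum>\<beta>\<in>{\<beta> \<in> Z. mdegree n \<beta> = m}. c \<beta> * monomial n \<beta> y) = 0"
    if y: "\<forall>i<n. y i \<in> {-\<epsilon><..<\<epsilon>}" "\<forall>i\<ge>n. y i = 0" for y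
  proof -
    \<comment> \<open>This is the polynomial at \<open>t * y\<close> divided by
      \<open>t ^ m\<close>. The truncated subtraction is exact by the choice of \<open>m\<close>,
      and \<open>0 ^ 0 = 1\<close> makes \<open>h 0\<close> the homogeneous part of degree
      \<open>m\<close>.\<close>
    define h where "h t = (\<Sum>\<beta>\<in>Z. c \<beta> * t ^ (mdegree n \<beta> - m) * monomial n \<beta> y)" for t
    have "(h \<longlongrightarrow> h 0) (at_right 0)"
      unfolding h_def by (intro tendsto_intros)
    moreover have "(h \<longlongrightarrow> 0) (at_right 0)"
    proof (rule Lim_null_comparison)
      show "((\<lambda>t. t * (\<bar>C\<bar> * sum_norm n y ^ Suc k)) \<longlongrightarrow> 0) (at_right 0)"
        by (auto intro!: tendsto_eq_intros)
      have "norm (h t) \<le> t * (\<bar>C\<bar> * sum_norm n y ^ Suc k)" if t: "0 < t" "t < 1" for t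
      proof -
        have "t ^ m * h t = (\<Sum>\<beta>\<in>Z. c \<beta> * monomial n \<beta> (\<lambda>i. t * y i))"
          unfolding h_def sum_distrib_left
        proof (rule sum.cong)
          fix \<beta> assume "\<beta> \<in> Z"
          then have "t ^ mdegree n \<beta> = t ^ m * t ^ (mdegree n \<beta> - m)"
            using \<gamma>_min[of \<beta>] by (simp add: m_def flip: power_add)
          then show "t ^ m * (c \<beta> * t ^ (mdegree n \<beta> - m) * monomial n \<beta> y) = c \<beta> * monomial n \<beta> (\<lambda>i. t * y i)"
            by (simp add: monomial_scale)
        qed simp
        also have "\<dots> = (\<Sum>\<beta>\<in>D. c \<beta> * monomial n \<beta> (\<lambda>i. t * y i))"
          using D(1) by (intro sum.mono_neutral_left) (auto simp: Z_def)
        finally have "\<bar>t ^ m * h t\<bar> \<le> C * sum_norm n (\<lambda>i. t * y i) ^ Suc k"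
        proof -
          have "\<bar>t * y i\<bar> < \<epsilon>" if "i < n" for i
          proof -
            have "\<bar>t * y i\<bar> \<le> \<bar>y i\<bar>" using t by (simp add: abs_mult mult_left_le_one_le)
            also have "\<dots> < \<epsilon>" using y that by auto
            finally show ?thesis .
          qed
          then show ?thesis
            using bound[of "\<lambda>i. t * y i"] y \<open>t ^ m * h t = _\<close>
              \<open>(\<Sum>\<beta>\<in>Z. c \<beta> * monomial n \<beta> (\<lambda>i. t * y i)) = _\<close> by simp
        qed
        also have "sum_norm n (\<lambda>i. t * y i) = t * sum_norm n y"
          using t by (simp add: sum_norm_def abs_mult sum_distrib_left)
        also have "C * (t * sum_norm n y) ^ Suc k \<le> \<bar>C\<bar> * (t * sum_norm n y) ^ Suc k"
          using t sum_norm_nonneg[of n y] by (intro mult_right_mono zero_le_power) auto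
        also have "\<dots> = t ^ m * (t ^ (k - m) * (t * (\<bar>C\<bar> * sum_norm n y ^ Suc k)))"
          using mk by (simp add: power_mult_distrib mult_ac flip: power_add)
        also have "t ^ (k - m) * (t * (\<bar>C\<bar> * sum_norm n y ^ Suc k)) \<le> 1 * (t * (\<bar>C\<bar> * sum_norm n y ^ Suc k))"
          using t sum_norm_nonneg[of n y] by (intro mult_right_mono power_le_one) auto
        finally have "t ^ m * \<bar>h t\<bar> \<le> t ^ m * (t * (\<bar>C\<bar> * sum_norm n y ^ Suc k))"
          using t by (simp add: abs_mult mult_left_mono)
        then show ?thesis using t by simp
      qed
      then show "\<forall>\<^sub>F t in at_right 0. norm (h t) \<le> t * (\<bar>C\<bar> * sum_norm n y ^ Suc k)"
        unfolding eventually_at_right_field by (intro exI[of _ 1]) auto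
    qed
    ultimately have "h 0 = 0" using tendsto_unique trivial_limit_at_right_real by blast
    moreover have "h 0 = (\<Sum>\<beta>\<in>Z. if mdegree n \<beta> = m then c \<beta> * monomial n \<beta> y else 0)"
      unfolding h_def using \<gamma>_min by (intro sum.cong) (auto simp: m_def power_0_left le_antisym)
    ultimately show ?thesis using finZ by (simp add: sum.inter_filter)
  qed
  moreover have "\<gamma> \<in> {\<beta> \<in> Z. mdegree n \<beta> = m}" using \<gamma> by (simp add: m_def)
  ultimately have "c \<gamma> = 0"
    using D finZ \<open>\<epsilon> > 0\<close> monomials_independent[of "{\<beta> \<in> Z. mdegree n \<beta> = m}" n "\<lambda>_. {-\<epsilon><..<\<epsilon>}" c \<gamma>]
    by (auto simp: Z_def indices_upto_def)
  then show False using \<gamma> by (simp add: Z_def)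
qed

text \<open>Convergence at the diagonal point with all coordinates \<open>\<rho>\<close> is
  absolute, so the numbers \<open>b \<alpha>\<close> are summable. A term of degree above
  \<open>k\<close> is at most \<open>(sum_norm n y / \<rho>) ^ Suc k * b \<alpha>\<close>, and
  summing over these terms gives the constant.\<close>

lemma taylor_remainder_bound:
  assumes "r > 0" and ps: "\<And>y. (\<forall>i\<ge>n. y i = 0) \<Longrightarrow> (\<forall>i<n. \<bar>y i\<bar> < r) \<Longrightarrow>
      ((\<lambda>\<alpha>. c \<alpha> * monomial n \<alpha> y) has_sum f y) (multi_indices n)"
  obtains C where "\<And>y. (\<forall>i\<ge>n. y i = 0) \<Longrightarrow> sum_norm n y \<le> r / 2 \<Longrightarrow>
      \<bar>f y - (\<Sum>\<alpha>\<in>indices_upto n k. c \<alpha> * monomial n \<alpha> y)\<bar> \<le> C * sum_norm n y ^ Suc k"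
proof
  define \<rho> where "\<rho> = r / 2"
  have \<rho>: "0 < \<rho>" "\<rho> < r" using assms(1) by (auto simp: \<rho>_def)
  define y0 where "y0 = (\<lambda>i. if i < n then \<rho> else 0)"
  define T where "T = multi_indices n - indices_upto n k"
  define b where "b \<alpha> = \<bar>c \<alpha>\<bar> * \<rho> ^ mdegree n \<alpha>" for \<alpha>
  have sub: "indices_upto n k \<subseteq> multi_indices n" by (auto simp: indices_upto_def)
  have "(\<lambda>\<alpha>. c \<alpha> * monomial n \<alpha> y0) summable_on multi_indices n"
    using \<rho> by (intro has_sum_imp_summable[OF ps]) (auto simp: y0_def)
  then have "(\<lambda>\<alpha>. norm (c \<alpha> * monomial n \<alpha> y0)) summable_on multi_indices n"
    by (rule summable_on_iff_abs_summable_on_real[THEN iffD1])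
  moreover have "norm (c \<alpha> * monomial n \<alpha> y0) = b \<alpha>" for \<alpha>
    using \<rho> by (simp add: b_def monomial_def y0_def mdegree_def abs_mult abs_prod power_sum)
  ultimately have "b summable_on T"
    using summable_on_subset_banach[of b "multi_indices n" T] by (simp add: T_def)
  then have b: "(b has_sum infsum b T) T" by simp
  fix y :: "nat \<Rightarrow> real" assume y: "\<forall>i\<ge>n. y i = 0" "sum_norm n y \<le> r / 2"
  have "\<bar>y i\<bar> < r" if "i < n" for i
    using abs_le_sum_norm[OF that, of y] y(2) \<rho> by (simp add: \<rho>_def)
  then have "((\<lambda>\<alpha>. c \<alpha> * monomial n \<alpha> y) has_sum f y) (multi_indices n)"
    using y by (intro ps) auto
  then have "((\<lambda>\<alpha>. c \<alpha> * monomial n \<alpha> y) has_sum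
      (f y - (\<Sum>\<alpha>\<in>indices_upto n k. c \<alpha> * monomial n \<alpha> y))) T"
    unfolding T_def by (intro has_sum_Diff has_sum_finite finite_indices_upto sub)
  moreover have "((\<lambda>\<alpha>. (sum_norm n y / \<rho>) ^ Suc k * b \<alpha>) has_sum ((sum_norm n y / \<rho>) ^ Suc k * infsum b T)) T"
    by (intro has_sum_cmult_right b)
  moreover have "norm (c \<alpha> * monomial n \<alpha> y) \<le> (sum_norm n y / \<rho>) ^ Suc k * b \<alpha>" if "\<alpha> \<in> T" for \<alpha>
  proof -
    have "mdegree n \<alpha> \<ge> Suc k" using that by (auto simp: T_def indices_upto_def)
    then obtain d where d: "mdegree n \<alpha> = Suc k + d" using le_Suc_ex by blast
    have "\<bar>monomial n \<alpha> y\<bar> \<le> sum_norm n y ^ Suc k * sum_norm n y ^ d"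
      using abs_monomial_le[of n \<alpha> y] unfolding d power_add .
    also have "\<dots> \<le> sum_norm n y ^ Suc k * \<rho> ^ d"
      using y(2) sum_norm_nonneg[of n y] by (intro mult_left_mono power_mono zero_le_power) (auto simp: \<rho>_def)
    also have "\<dots> = (sum_norm n y / \<rho>) ^ Suc k * \<rho> ^ mdegree n \<alpha>"
      using \<rho> unfolding d power_add by (simp add: power_divide)
    finally have "\<bar>c \<alpha>\<bar> * \<bar>monomial n \<alpha> y\<bar> \<le> \<bar>c \<alpha>\<bar> * ((sum_norm n y / \<rho>) ^ Suc k * \<rho> ^ mdegree n \<alpha>)"
      by (intro mult_left_mono) auto
    then show ?thesis by (simp add: b_def abs_mult mult_ac)
  qed
  ultimately have "norm (f y - (\<Sum>\<alpha>\<in>indices_upto n k. c \<alpha> * monomial n \<alpha> y)) \<le> (sum_norm n y / \<rho>) ^ Suc k * infsum b T"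
    by (rule norm_infsum_le)
  also have "\<dots> = infsum b T / \<rho> ^ Suc k * sum_norm n y ^ Suc k"
    by (simp add: power_divide)
  finally show "\<bar>f y - (\<Sum>\<alpha>\<in>indices_upto n k. c \<alpha> * monomial n \<alpha> y)\<bar> \<le>
      infsum b T / \<rho> ^ Suc k * sum_norm n y ^ Suc k" by simp
qed

text \<open>For \<open>k\<close> the degree of \<open>\<alpha>\<close>, both \<open>f\<close> and
  its Taylor remainder are of order \<open>k + 1\<close>; hence so is the Taylor polynomial of
  degree \<open>k\<close>, and such a polynomial is zero.\<close>

lemma flat_power_series_eq_0:
  assumes r: "r > 0" and ps: "\<And>y. (\<forall>i\<ge>n. y i = 0) \<Longrightarrow> (\<forall>i<n. \<bar>y i\<bar> < r) \<Longrightarrow>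
      ((\<lambda>\<alpha>. c \<alpha> * monomial n \<alpha> y) has_sum f y) (multi_indices n)"
    and flat: "\<And>k. \<exists>C. \<exists>\<epsilon>>0. \<forall>y. (\<forall>i\<ge>n. y i = 0) \<longrightarrow> (\<forall>i<n. \<bar>y i\<bar> < \<epsilon>) \<longrightarrow> \<bar>f y\<bar> \<le> C * sum_norm n y ^ k"
    and \<alpha>: "\<alpha> \<in> multi_indices n"
  shows "c \<alpha> = 0"
proof -
  define k where "k = mdegree n \<alpha>"
  obtain C where C: "\<And>y. (\<forall>i\<ge>n. y i = 0) \<Longrightarrow> sum_norm n y \<le> r / 2 \<Longrightarrow>
      \<bar>f y - (\<Sum>\<alpha>\<in>indices_upto n k. c \<alpha> * monomial n \<alpha> y)\<bar> \<le> C * sum_norm n y ^ Suc k"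
    using taylor_remainder_bound[OF r ps] by blast
  obtain C' \<epsilon> where \<epsilon>: "\<epsilon> > 0" and C': "\<And>y. (\<forall>i\<ge>n. y i = 0) \<Longrightarrow> (\<forall>i<n. \<bar>y i\<bar> < \<epsilon>) \<Longrightarrow>
      \<bar>f y\<bar> \<le> C' * sum_norm n y ^ Suc k"
    using flat[of "Suc k"] by blast
  \<comment> \<open>In a box of this size \<open>sum_norm n y\<close> is at most
    \<open>n * \<delta> \<le> r / 2\<close>, where the remainder estimate holds; adding 1 to
    \<open>n\<close> avoids division by 0 in dimension 0.\<close>
  define \<delta> where "\<delta> = min \<epsilon> (r / (2 * (real n + 1)))"
  have "\<delta> > 0" using r \<epsilon> by (simp add: \<delta>_def)
  show ?thesis
  proof (rule small_polynomial_eq_0[where c = c and \<alpha> = \<alpha> and C = "C + C'",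
        OF finite_indices_upto order_refl \<open>\<delta> > 0\<close>])
    show "\<alpha> \<in> indices_upto n k" using \<alpha> by (simp add: indices_upto_def k_def)
    fix y :: "nat \<Rightarrow> real" assume y: "\<forall>i\<ge>n. y i = 0" "\<forall>i<n. \<bar>y i\<bar> < \<delta>"
    have "sum_norm n y \<le> real n * \<delta>"
      using y(2) sum_bounded_above[of "{..<n}" "\<lambda>i. \<bar>y i\<bar>" \<delta>] by (simp add: sum_norm_def less_imp_le)
    also have "\<dots> \<le> real n * (r / (2 * (real n + 1)))" by (intro mult_left_mono) (auto simp: \<delta>_def)
    also have "\<dots> \<le> r / 2" using r by (simp add: field_simps)
    finally have 1: "sum_norm n y \<le> r / 2" .
    have 2: "\<forall>i<n. \<bar>y i\<bar> < \<epsilon>" using y(2) by (auto simp: \<delta>_def)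
    show "\<bar>\<Sum>\<alpha>\<in>indices_upto n k. c \<alpha> * monomial n \<alpha> y\<bar> \<le> (C + C') * sum_norm n y ^ Suc k"
      using C[OF y(1) 1] C'[OF y(1) 2] unfolding distrib_right by linarith
  qed
qed

text \<open>The radius of convergence is at least \<open>s > 1\<close>, so the complexified series
  is holomorphic on a disc with 1 in its interior. Its zeros accumulate at 1, hence it vanishes
  identically.\<close>

lemma real_power_series_eq_0:
  fixes a :: "nat \<Rightarrow> real"
  assumes s: "s > 1" "summable (\<lambda>m. a m * s ^ m)"
    and \<eta>: "\<eta> > 0" "\<And>t. \<bar>t - 1\<bar> < \<eta> \<Longrightarrow> (\<lambda>m. a m * t ^ m) sums 0"
  shows "a m = 0"
proof -
  define F where "F = Abs_fps (\<lambda>m. complex_of_real (a m))"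
  have "summable (\<lambda>m. complex_of_real (a m) * complex_of_real s ^ m)"
    using summable_of_real[OF s(2), where 'a = complex] by simp
  then have "conv_radius (\<lambda>m. complex_of_real (a m)) \<ge> norm (complex_of_real s)"
    by (rule conv_radius_geI)
  then have rad: "fps_conv_radius F \<ge> s"
    using s(1) by (simp add: F_def fps_conv_radius_def)
  have hol: "eval_fps F holomorphic_on ball 0 s"
  proof (rule holomorphic_on_eval_fps)
    have "ereal (norm z) < fps_conv_radius F" if "norm z < s" for z :: complex
      using order_less_le_trans[OF _ rad, of "ereal (norm z)"] that by simp
    then show "ball (0::complex) s \<subseteq> eball 0 (fps_conv_radius F)" by (auto simp: eball_def)
  qed
  have zero: "eval_fps F (of_real t) = 0" if "\<bar>t - 1\<bar> < \<eta>" for t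
  proof -
    have "(\<lambda>m. complex_of_real (a m * t ^ m)) sums complex_of_real 0"
      using \<eta>(2)[OF that] by (simp only: sums_of_real_iff)
    then show ?thesis by (simp add: eval_fps_def F_def sums_iff)
  qed
  define U where "U = complex_of_real ` {1 - \<eta><..<1 + \<eta>} \<inter> ball 0 s"
  have lim: "complex_of_real 1 islimpt U"
    unfolding islimpt_approachable
  proof (intro allI impI)
    fix e :: real assume e: "e > 0"
    \<comment> \<open>A zero different from 1, slightly to its right: closer than \<open>e\<close>,
      within the interval of zeros and inside the disc.\<close>
    define t where "t = 1 + min (min (e / 2) (\<eta> / 2)) ((s - 1) / 2)"
    have t: "t > 1" "t - 1 < e" "t - 1 < \<eta>" "t < s" using e \<eta>(1) s(1) by (auto simp: t_def min_def field_simps)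
    have "dist (complex_of_real t) (complex_of_real 1) < e"
      unfolding dist_of_real dist_real_def using t by simp
    then show "\<exists>x'\<in>U. x' \<noteq> complex_of_real 1 \<and> dist x' (complex_of_real 1) < e"
      using t \<eta>(1) by (intro bexI[of _ "complex_of_real t"]) (auto simp: U_def)
  qed
  have "eval_fps F z = 0" if "z \<in> ball 0 s" for z
  proof (rule analytic_continuation[OF hol open_ball connected_ball _ _ lim _ that])
    show "U \<subseteq> ball 0 s" by (auto simp: U_def)
    show "complex_of_real 1 \<in> ball 0 s" using s(1) by simp
    show "eval_fps F z = 0" if "z \<in> U" for z using that zero by (auto simp: U_def)
  qed
  then have "eventually (\<lambda>z. eval_fps F z = eval_fps 0 z) (nhds 0)"
    using s(1) by (intro eventually_nhds_in_open[of "ball 0 s", THEN eventually_mono]) auto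
  moreover have "fps_conv_radius F > 0"
    using rad s(1) by (metis ereal_less(2) less_trans order_less_le_trans zero_less_one)
  ultimately have "F = 0" by (intro eval_fps_eqD) auto
  then have "fps_nth F m = 0" by simp
  then show ?thesis by (simp add: F_def)
qed

text \<open>The expansion is around 0, but the zeros are near another point \<open>q\<close>. For
  \<open>y\<close> near \<open>q\<close>, the function \<open>f\<close> along the ray
  \<open>t * y\<close> is a power series in \<open>t\<close> whose coefficients are the homogeneous
  parts of the series at \<open>y\<close>, and it vanishes for \<open>t\<close> near 1. So each
  homogeneous part vanishes on the box around \<open>q\<close>, and its coefficients are 0.\<close>

lemma locally_vanishing_power_series_eq_0:
  assumes ps: "\<And>y. (\<forall>i\<ge>n. y i = 0) \<Longrightarrow> (\<forall>i<n. \<bar>y i\<bar> < r) \<Longrightarrow>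
      ((\<lambda>\<alpha>. c \<alpha> * monomial n \<alpha> y) has_sum f y) (multi_indices n)"
    and \<delta>: "\<delta> > 0"
    and in_box: "\<And>y i. (\<forall>j<n. \<bar>y j - q j\<bar> < \<delta>) \<Longrightarrow> i < n \<Longrightarrow> \<bar>y i\<bar> < r"
    and zero: "\<And>y. (\<forall>i\<ge>n. y i = 0) \<Longrightarrow> (\<forall>i<n. \<bar>y i - q i\<bar> < \<delta>) \<Longrightarrow> f y = 0"
    and \<alpha>: "\<alpha> \<in> multi_indices n"
  shows "c \<alpha> = 0"
proof -
  define D where "D m = {\<alpha> \<in> multi_indices n. mdegree n \<alpha> = m}" for m
  have finD: "finite (D m)" for m
    by (rule finite_subset[OF _ finite_indices_upto[of n m]]) (auto simp: D_def indices_upto_def)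
  have inf: "infinite {q i - \<delta><..<q i + \<delta>}" for i using \<delta> by simp
  have "(\<Sum>\<alpha>\<in>D m. c \<alpha> * monomial n \<alpha> y) = 0"
    if y: "\<forall>i<n. y i \<in> {q i - \<delta><..<q i + \<delta>}" "\<forall>i\<ge>n. y i = 0" for m y
  proof -
    define P where "P m = (\<Sum>\<alpha>\<in>D m. c \<alpha> * monomial n \<alpha> y)" for m
    have sums: "(\<lambda>m. P m * t ^ m) sums f (\<lambda>i. t * y i)" if t: "\<forall>i<n. \<bar>t * y i\<bar> < r" for t
    proof -
      have "((\<lambda>\<alpha>. c \<alpha> * monomial n \<alpha> (\<lambda>i. t * y i)) has_sum f (\<lambda>i. t * y i)) (multi_indices n)"
        using t y by (intro ps) auto
      \<comment> \<open>The sum is unconditional, so its terms may be grouped by degree; each group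
        \<open>D m\<close> is finite and homogeneous, which produces the power of
        \<open>t\<close>.\<close>
      also have "multi_indices n = snd ` Sigma UNIV D" by (force simp: D_def)
      finally have "((\<lambda>(m, \<alpha>). c \<alpha> * monomial n \<alpha> (\<lambda>i. t * y i)) has_sum f (\<lambda>i. t * y i)) (Sigma UNIV D)"
        by (subst (asm) has_sum_reindex) (auto simp: inj_on_def D_def o_def case_prod_beta')
      then have "((\<lambda>m. \<Sum>\<alpha>\<in>D m. c \<alpha> * monomial n \<alpha> (\<lambda>i. t * y i)) has_sum f (\<lambda>i. t * y i)) UNIV"
        by (rule has_sum_Sigma') (use finD in auto)
      then have "(\<lambda>m. \<Sum>\<alpha>\<in>D m. c \<alpha> * monomial n \<alpha> (\<lambda>i. t * y i)) sums f (\<lambda>i. t * y i)"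
        by (rule has_sum_imp_sums)
      moreover have "(\<Sum>\<alpha>\<in>D m. c \<alpha> * monomial n \<alpha> (\<lambda>i. t * y i)) = P m * t ^ m" for m
        unfolding P_def sum_distrib_right by (intro sum.cong) (auto simp: monomial_scale D_def)
      ultimately show ?thesis by simp
    qed
    have near: "\<exists>\<eta>>0. \<forall>t. \<bar>t - 1\<bar> < \<eta> \<longrightarrow> (\<forall>i<n. \<bar>t * y i - q i\<bar> < \<delta>)"
    proof -
      have "eventually (\<lambda>t. \<bar>t * y i - q i\<bar> < \<delta>) (nhds 1)" if "i < n" for i
      proof -
        have "((\<lambda>t. \<bar>t * y i - q i\<bar>) \<longlongrightarrow> \<bar>1 * y i - q i\<bar>) (nhds 1)" by (intro tendsto_intros filterlim_ident)
        moreover have "\<bar>1 * y i - q i\<bar> < \<delta>" using y(1) that by (auto simp: abs_less_iff)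
        ultimately show ?thesis by (rule order_tendstoD(2))
      qed
      then have "eventually (\<lambda>t. \<forall>i\<in>{..<n}. \<bar>t * y i - q i\<bar> < \<delta>) (nhds 1)"
        by (intro eventually_ball_finite) auto
      then show ?thesis
        unfolding eventually_nhds_metric dist_real_def by auto
    qed
    then obtain \<eta> where \<eta>: "\<eta> > 0" "\<And>t. \<bar>t - 1\<bar> < \<eta> \<Longrightarrow> \<forall>i<n. \<bar>t * y i - q i\<bar> < \<delta>" by blast
    have "P m = 0" for m
    proof (rule real_power_series_eq_0)
      show "1 + \<eta> / 2 > 1" "\<eta> > 0" using \<eta> by auto
      \<comment> \<open>The scaled point is still in the box around \<open>q\<close>, hence in the
        polydisc; this gives convergence at a parameter strictly beyond 1.\<close>
      have "\<forall>i<n. \<bar>(1 + \<eta> / 2) * y i\<bar> < r" using \<eta>(2)[of "1 + \<eta> / 2"] \<eta>(1) in_box[of "\<lambda>i. (1 + \<eta> / 2) * y i"] by auto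
      from sums[OF this] show "summable (\<lambda>m. P m * (1 + \<eta> / 2) ^ m)" by (simp add: sums_iff)
      fix t :: real assume t: "\<bar>t - 1\<bar> < \<eta>"
      then have "\<forall>i<n. \<bar>t * y i\<bar> < r" using \<eta>(2)[of t] in_box[of "\<lambda>i. t * y i"] by auto
      from sums[OF this] show "(\<lambda>m. P m * t ^ m) sums 0" using zero[of "\<lambda>i. t * y i"] \<eta>(2)[OF t] y(2) by simp
    qed
    then show ?thesis by (simp add: P_def)
  qed
  then show ?thesis
    using \<alpha> inf
    by (intro monomials_independent[where c = c and \<alpha> = \<alpha> and n = n and D = "D (mdegree n \<alpha>)"
          and S = "\<lambda>i. {q i - \<delta><..<q i + \<delta>}"] finD) (auto simp: D_def)
qed

section \<open>Analytic maps of a manifold\<close>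

text \<open>A basic open set of the product topology constrains coordinates separately. Those from
  \<open>n\<close> on are 0 for both points, so the minimum of \<open>n\<close> radii
  suffices.\<close>

lemma Euclidean_space_open_contains_box:
  assumes "openin (Euclidean_space n) S" "x \<in> S"
  obtains r where "r > 0" "\<And>y. (\<forall>i\<ge>n. y i = 0) \<Longrightarrow> (\<forall>i<n. \<bar>y i - x i\<bar> < r) \<Longrightarrow> y \<in> S"
proof -
  obtain T where T: "openin (powertop_real UNIV) T" "S = T \<inter> {x. \<forall>i\<ge>n. x i = 0}"
    using assms(1) by (auto simp: Euclidean_space_def openin_subtopology)
  then obtain U where U: "\<And>i. open (U i)" "\<And>i. x i \<in> U i" "Pi\<^sub>E UNIV U \<subseteq> T"
    using assms(2) unfolding openin_product_topology_alt by (auto simp: PiE_iff) metis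
  have "\<exists>e>0. \<forall>t. \<bar>t - x i\<bar> < e \<longrightarrow> t \<in> U i" for i
    using U(1,2)[of i] unfolding open_dist dist_real_def by auto
  then obtain e where e: "\<And>i. e i > 0" "\<And>i t. \<bar>t - x i\<bar> < e i \<Longrightarrow> t \<in> U i" by metis
  \<comment> \<open>The element 1 keeps the set nonempty when \<open>n = 0\<close>.\<close>
  define r where "r = Min (insert 1 (e ` {..<n}))"
  show ?thesis
  proof
    show "r > 0" using e by (auto simp: r_def)
    fix y :: "nat \<Rightarrow> real" assume y: "\<forall>i\<ge>n. y i = 0" "\<forall>i<n. \<bar>y i - x i\<bar> < r"
    have "y i \<in> U i" for i
    proof (cases "i < n")
      case True
      then have "r \<le> e i" by (auto simp: r_def)
      then show ?thesis using y True by (intro e(2)) auto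
    next
      case False
      then have "y i = x i" using y T assms(2) by auto
      then show ?thesis using U(2) by metis
    qed
    then have "y \<in> T" using U(3) by auto
    then show "y \<in> S" using T y by auto
  qed
qed

lemma chart_inj_on: "is_chart n N U \<phi> \<Longrightarrow> inj_on \<phi> U"
  unfolding is_chart_def
  by (metis homeomorphic_imp_injective_map inf.absorb2 openin_subset topspace_subtopology)

lemma chart_coordinate_0:
  assumes "is_chart n N U \<phi>" "x \<in> U" "i \<ge> n"
  shows "\<phi> x i = 0"
proof -
  obtain V where V: "openin N U" "openin (Euclidean_space n) V"
    "homeomorphic_map (subtopology N U) (subtopology (Euclidean_space n) V) \<phi>"
    using assms(1) by (auto simp: is_chart_def)
  have "\<phi> ` topspace (subtopology N U) = topspace (subtopology (Euclidean_space n) V)"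
    by (rule homeomorphic_imp_surjective_map[OF V(3)])
  moreover have "x \<in> topspace (subtopology N U)" using V(1) assms(2) openin_subset by fastforce
  ultimately have "\<phi> x \<in> topspace (Euclidean_space n)" by auto
  then show ?thesis using assms(3) by (simp add: topspace_Euclidean_space)
qed

lemma chart_open_image:
  assumes "is_chart n N U \<phi>" "openin N W" "W \<subseteq> U"
  shows "openin (Euclidean_space n) (\<phi> ` W)"
proof -
  obtain V where V: "openin N U" "openin (Euclidean_space n) V"
    "homeomorphic_map (subtopology N U) (subtopology (Euclidean_space n) V) \<phi>"
    using assms(1) by (auto simp: is_chart_def)
  have "openin (subtopology N U) W" using assms V(1) by (simp add: openin_open_subtopology)
  then have "openin (subtopology (Euclidean_space n) V) (\<phi> ` W)"
    using homeomorphic_imp_open_map[OF V(3)] by (simp add: open_map_def)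
  then show ?thesis using V(2) by (simp add: openin_open_subtopology)
qed

lemma chart_coordinate_continuous:
  assumes "is_chart n N U \<phi>"
  shows "continuous_map (subtopology N U) euclideanreal (\<lambda>x. \<phi> x i)"
proof -
  obtain V where "homeomorphic_map (subtopology N U) (subtopology (Euclidean_space n) V) \<phi>"
    using assms by (auto simp: is_chart_def)
  then have "continuous_map (subtopology N U) (powertop_real UNIV) \<phi>"
    by (auto dest!: homeomorphic_imp_continuous_map simp: continuous_map_in_subtopology Euclidean_space_def)
  then show ?thesis by (auto simp: continuous_map_componentwise_UNIV)
qed

lemma chart_small_neighbourhood:
  assumes "is_chart n N U \<phi>" "x0 \<in> U" "\<epsilon> > 0"
  obtains W where "openin N W" "x0 \<in> W" "W \<subseteq> U" "\<forall>x\<in>W. \<forall>i<n. \<bar>\<phi> x i - \<phi> x0 i\<bar> < \<epsilon>"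
proof
  have U: "openin N U" using assms(1) by (simp add: is_chart_def)
  define B where "B i = {x \<in> U. \<phi> x i \<in> {\<phi> x0 i - \<epsilon><..<\<phi> x0 i + \<epsilon>}}" for i
  define W where "W = U \<inter> (\<Inter>i\<in>{..<n}. B i)"
  have "openin N (B i)" for i
  proof -
    have "topspace (subtopology N U) = U" using U openin_subset by fastforce
    then have "B i = {x \<in> topspace (subtopology N U). \<phi> x i \<in> {\<phi> x0 i - \<epsilon><..<\<phi> x0 i + \<epsilon>}}"
      by (simp only: B_def)
    also have "openin (subtopology N U) \<dots>"
      by (rule openin_continuous_map_preimage[OF chart_coordinate_continuous[OF assms(1)]]) auto
    finally show ?thesis using openin_open_subtopology[OF U] by blast
  qed
  then show "openin N W"
    unfolding W_def using U by (intro openin_Int_Inter) auto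
  show "x0 \<in> W" "W \<subseteq> U" using assms by (auto simp: W_def B_def)
  show "\<forall>x\<in>W. \<forall>i<n. \<bar>\<phi> x i - \<phi> x0 i\<bar> < \<epsilon>"
  proof (intro ballI allI impI)
    fix x i assume "x \<in> W" "i < n"
    then have "x \<in> B i" by (auto simp: W_def)
    then show "\<bar>\<phi> x i - \<phi> x0 i\<bar> < \<epsilon>" by (auto simp: B_def abs_less_iff)
  qed
qed

text \<open>This is the bridge between Landau symbols along \<open>nhdsin N x0\<close> and estimates
  on coordinate boxes. Boxes are neighbourhoods since coordinates are continuous; conversely the
  open image of a neighbourhood contains a box, and injectivity of the chart brings its points
  back.\<close>

lemma eventually_nhdsin_chart:
  assumes "is_chart n N U \<phi>" "x0 \<in> U"
  shows "eventually Q (nhdsin N x0) \<longleftrightarrow> (\<exists>\<epsilon>>0. \<forall>x\<in>U. (\<forall>i<n. \<bar>\<phi> x i - \<phi> x0 i\<bar> < \<epsilon>) \<longrightarrow> Q x)"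
proof
  have U: "openin N U" using assms(1) by (simp add: is_chart_def)
  have x0: "x0 \<in> topspace N" using openin_subset[OF U] assms(2) by auto
  {
    assume "eventually Q (nhdsin N x0)"
    then obtain S where S: "openin N S" "x0 \<in> S" "\<forall>x\<in>S. Q x" using x0 by (auto simp: eventually_nhdsin)
    have op: "openin (Euclidean_space n) (\<phi> ` (S \<inter> U))" and mem: "\<phi> x0 \<in> \<phi> ` (S \<inter> U)"
      using S U assms(2) by (auto intro!: chart_open_image[OF assms(1)])
    obtain r where r: "r > 0" "\<And>y. (\<forall>i\<ge>n. y i = 0) \<Longrightarrow> (\<forall>i<n. \<bar>y i - \<phi> x0 i\<bar> < r) \<Longrightarrow> y \<in> \<phi> ` (S \<inter> U)"
      using Euclidean_space_open_contains_box[OF op mem] by blast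
    have "Q x" if x: "x \<in> U" "\<forall>i<n. \<bar>\<phi> x i - \<phi> x0 i\<bar> < r" for x
    proof -
      have "\<phi> x \<in> \<phi> ` (S \<inter> U)" using r(2)[of "\<phi> x"] x chart_coordinate_0[OF assms(1)] by auto
      then have "x \<in> S" using inj_onD[OF chart_inj_on[OF assms(1)]] x(1) by auto
      then show ?thesis using S by auto
    qed
    then show "\<exists>\<epsilon>>0. \<forall>x\<in>U. (\<forall>i<n. \<bar>\<phi> x i - \<phi> x0 i\<bar> < \<epsilon>) \<longrightarrow> Q x" using r(1) by blast
  next
    assume "\<exists>\<epsilon>>0. \<forall>x\<in>U. (\<forall>i<n. \<bar>\<phi> x i - \<phi> x0 i\<bar> < \<epsilon>) \<longrightarrow> Q x"
    then obtain \<epsilon> where \<epsilon>: "\<epsilon> > 0" "\<forall>x\<in>U. (\<forall>i<n. \<bar>\<phi> x i - \<phi> x0 i\<bar> < \<epsilon>) \<longrightarrow> Q x" by blast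
    obtain W where W: "openin N W" "x0 \<in> W" "W \<subseteq> U" "\<forall>x\<in>W. \<forall>i<n. \<bar>\<phi> x i - \<phi> x0 i\<bar> < \<epsilon>"
      by (rule chart_small_neighbourhood[OF assms \<epsilon>(1)])
    then have "\<forall>x\<in>W. Q x" using \<epsilon>(2) by blast
    then show "eventually Q (nhdsin N x0)" unfolding eventually_nhdsin using W(1,2) by blast
  }
qed

lemma chart_contains_box:
  assumes "is_chart n N U \<phi>" "openin N W" "W \<subseteq> U" "x0 \<in> W"
  obtains \<epsilon> where "\<epsilon> > 0"
    "\<And>y. (\<forall>i\<ge>n. y i = 0) \<Longrightarrow> (\<forall>i<n. \<bar>y i\<bar> < \<epsilon>) \<Longrightarrow> \<exists>x\<in>W. \<phi> x = (\<lambda>i. \<phi> x0 i + y i)"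
proof -
  obtain r where r: "r > 0" "\<And>y. (\<forall>i\<ge>n. y i = 0) \<Longrightarrow> (\<forall>i<n. \<bar>y i - \<phi> x0 i\<bar> < r) \<Longrightarrow> y \<in> \<phi> ` W"
    using Euclidean_space_open_contains_box[OF chart_open_image[OF assms(1-3)] imageI[OF assms(4)]] by blast
  show ?thesis
  proof
    show "r > 0" by fact
    fix y :: "nat \<Rightarrow> real" assume y: "\<forall>i\<ge>n. y i = 0" "\<forall>i<n. \<bar>y i\<bar> < r"
    have "(\<lambda>i. \<phi> x0 i + y i) \<in> \<phi> ` W"
      using y assms chart_coordinate_0[OF assms(1)] by (intro r(2)) auto
    then show "\<exists>x\<in>W. \<phi> x = (\<lambda>i. \<phi> x0 i + y i)" by force
  qed
qed

lemma real_analytic_on_chart_expansion: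
  assumes "is_chart n N U \<phi>" "W \<subseteq> U" "x \<in> W" "real_analytic_on n f (\<phi> ` W)"
  obtains r c where "r > 0" "\<And>y. (\<forall>i\<ge>n. y i = 0) \<Longrightarrow> (\<forall>i<n. \<bar>y i\<bar> < r) \<Longrightarrow>
      ((\<lambda>\<alpha>. c \<alpha> * monomial n \<alpha> y) has_sum f (\<lambda>i. \<phi> x i + y i)) (multi_indices n)"
proof -
  obtain r c where r: "r > 0" and c: "\<And>y. y \<in> topspace (Euclidean_space n) \<Longrightarrow> (\<forall>i<n. \<bar>y i - \<phi> x i\<bar> < r) \<Longrightarrow>
      ((\<lambda>\<alpha>. c \<alpha> * (\<Prod>i<n. (y i - \<phi> x i) ^ \<alpha> i)) has_sum f y) (multi_indices n)"
    using assms(3,4) unfolding real_analytic_on_def by blast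
  have "((\<lambda>\<alpha>. c \<alpha> * monomial n \<alpha> y) has_sum f (\<lambda>i. \<phi> x i + y i)) (multi_indices n)"
    if y: "\<forall>i\<ge>n. y i = 0" "\<forall>i<n. \<bar>y i\<bar> < r" for y
  proof -
    have "(\<lambda>i. \<phi> x i + y i) \<in> topspace (Euclidean_space n)"
      using y assms(2,3) chart_coordinate_0[OF assms(1)] by (auto simp: topspace_Euclidean_space)
    from c[OF this] show ?thesis using y by (simp add: monomial_def)
  qed
  with r show ?thesis by (rule that)
qed

section \<open>Power series of analytic maps and the identity theorem\<close>

lemma analytic_self_map_expansion:
  assumes f: "analytic_self_map n N \<A> f" and charts: "(U, \<phi>) \<in> \<A>" "(V, \<psi>) \<in> \<A>"
    and U: "is_chart n N U \<phi>" and x: "x \<in> U" "f x \<in> V" and j: "j < n"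
  obtains r c where "r > 0" "\<And>z. z \<in> U \<Longrightarrow> (\<forall>i<n. \<bar>\<phi> z i - \<phi> x i\<bar> < r) \<Longrightarrow>
      ((\<lambda>\<alpha>. c \<alpha> * monomial n \<alpha> (\<lambda>i. \<phi> z i - \<phi> x i)) has_sum \<psi> (f z) j) (multi_indices n)"
proof -
  have "real_analytic_on n (\<lambda>y. (\<psi> \<circ> f \<circ> inv_into U \<phi>) y j) (\<phi> ` (U \<inter> f -` V))"
    using f charts j unfolding analytic_self_map_def real_analytic_map_on_def by blast
  then obtain r c where r: "r > 0" and c: "\<And>y. (\<forall>i\<ge>n. y i = 0) \<Longrightarrow> (\<forall>i<n. \<bar>y i\<bar> < r) \<Longrightarrow>
      ((\<lambda>\<alpha>. c \<alpha> * monomial n \<alpha> y) has_sum (\<psi> \<circ> f \<circ> inv_into U \<phi>) (\<lambda>i. \<phi> x i + y i) j) (multi_indices n)"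
    using real_analytic_on_chart_expansion[OF U, of "U \<inter> f -` V" x] x by blast
  have "((\<lambda>\<alpha>. c \<alpha> * monomial n \<alpha> (\<lambda>i. \<phi> z i - \<phi> x i)) has_sum \<psi> (f z) j) (multi_indices n)"
    if "z \<in> U" "\<forall>i<n. \<bar>\<phi> z i - \<phi> x i\<bar> < r" for z
    using c[of "\<lambda>i. \<phi> z i - \<phi> x i"] that x(1) chart_coordinate_0[OF U] inv_into_f_f[OF chart_inj_on[OF U]]
    by simp
  with r show ?thesis by (rule that)
qed

text \<open>Each coordinate of each map comes with its own radius. Here a single radius is found for
  all of them, small enough that the box is also covered by the chart and mapped into
  \<open>V\<close> by both maps; afterwards only the difference series \<open>c j\<close>
  matter.\<close>

lemma analytic_self_maps_difference_expansion:
  assumes g: "analytic_self_map n N \<A> g" and h: "analytic_self_map n N \<A> h"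
    and charts: "(U, \<phi>) \<in> \<A>" "(V, \<psi>) \<in> \<A>"
    and U: "is_chart n N U \<phi>" and V: "is_chart n N V \<psi>" and x: "x \<in> U" "g x \<in> V" "h x = g x"
  obtains r c where "r > 0"
    "\<And>y. (\<forall>i\<ge>n. y i = 0) \<Longrightarrow> (\<forall>i<n. \<bar>y i\<bar> < r) \<Longrightarrow> \<exists>z\<in>U. \<phi> z = (\<lambda>i. \<phi> x i + y i)"
    "\<And>z j. z \<in> U \<Longrightarrow> (\<forall>i<n. \<bar>\<phi> z i - \<phi> x i\<bar> < r) \<Longrightarrow> j < n \<Longrightarrow>
      ((\<lambda>\<alpha>. c j \<alpha> * monomial n \<alpha> (\<lambda>i. \<phi> z i - \<phi> x i)) has_sum (\<psi> (g z) j - \<psi> (h z) j)) (multi_indices n)"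
    "\<And>z. z \<in> U \<Longrightarrow> (\<forall>i<n. \<bar>\<phi> z i - \<phi> x i\<bar> < r) \<Longrightarrow> g z \<in> V \<and> h z \<in> V"
proof -
  define P where "P f j r c \<longleftrightarrow> r > 0 \<and> (\<forall>z\<in>U. (\<forall>i<n. \<bar>\<phi> z i - \<phi> x i\<bar> < r) \<longrightarrow>
      ((\<lambda>\<alpha>. c \<alpha> * monomial n \<alpha> (\<lambda>i. \<phi> z i - \<phi> x i)) has_sum \<psi> (f z) j) (multi_indices n))" for f j r c
  have ex: "\<exists>r c. P f j r c" if "analytic_self_map n N \<A> f" "f x \<in> V" "j < n" for f j
    unfolding P_def
    using analytic_self_map_expansion[OF that(1) charts U x(1) that(2,3)] by metis
  have "\<exists>r c. j < n \<longrightarrow> P g j r c" "\<exists>r c. j < n \<longrightarrow> P h j r c" for j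
    using ex[OF g x(2)] ex[OF h, of j] x(2,3) by auto
  then obtain r1 c1 r2 c2 where P: "\<And>j. j < n \<Longrightarrow> P g j (r1 j) (c1 j)" "\<And>j. j < n \<Longrightarrow> P h j (r2 j) (c2 j)"
    by metis
  have 1: "r1 j > 0" "\<And>z. z \<in> U \<Longrightarrow> (\<forall>i<n. \<bar>\<phi> z i - \<phi> x i\<bar> < r1 j) \<Longrightarrow>
      ((\<lambda>\<alpha>. c1 j \<alpha> * monomial n \<alpha> (\<lambda>i. \<phi> z i - \<phi> x i)) has_sum \<psi> (g z) j) (multi_indices n)" if "j < n" for j
    using P(1)[OF that] unfolding P_def by blast+
  have 2: "r2 j > 0" "\<And>z. z \<in> U \<Longrightarrow> (\<forall>i<n. \<bar>\<phi> z i - \<phi> x i\<bar> < r2 j) \<Longrightarrow>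
      ((\<lambda>\<alpha>. c2 j \<alpha> * monomial n \<alpha> (\<lambda>i. \<phi> z i - \<phi> x i)) has_sum \<psi> (h z) j) (multi_indices n)" if "j < n" for j
    using P(2)[OF that] unfolding P_def by blast+
  have oU: "openin N U" and oV: "openin N V" using U V by (auto simp: is_chart_def)
  have pre: "openin N {z \<in> topspace N. f z \<in> V}" if "analytic_self_map n N \<A> f" for f
    using that oV by (auto simp: analytic_self_map_def intro: openin_continuous_map_preimage)
  define W where "W = U \<inter> ({z \<in> topspace N. g z \<in> V} \<inter> {z \<in> topspace N. h z \<in> V})"
  have W: "openin N W" "W \<subseteq> U" "x \<in> W"
    unfolding W_def using oU pre[OF g] pre[OF h] x openin_subset[OF oU] by auto
  obtain r3 where r3: "r3 > 0" "\<And>y. (\<forall>i\<ge>n. y i = 0) \<Longrightarrow> (\<forall>i<n. \<bar>y i\<bar> < r3) \<Longrightarrow> \<exists>z\<in>W. \<phi> z = (\<lambda>i. \<phi> x i + y i)"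
    using chart_contains_box[OF U W] by blast
  define r where "r = Min (insert r3 (r1 ` {..<n} \<union> r2 ` {..<n}))"
  have r: "r \<le> r3" "\<And>j. j < n \<Longrightarrow> r \<le> r1 j" "\<And>j. j < n \<Longrightarrow> r \<le> r2 j" by (auto simp: r_def)
  show ?thesis
  proof
    show "r > 0" using r3(1) 1(1) 2(1) by (auto simp: r_def)
    show "\<exists>z\<in>U. \<phi> z = (\<lambda>i. \<phi> x i + y i)" if "\<forall>i\<ge>n. y i = 0" "\<forall>i<n. \<bar>y i\<bar> < r" for y
      using r3(2)[of y] that r(1) W(2) by fastforce
    fix z assume z: "z \<in> U" "\<forall>i<n. \<bar>\<phi> z i - \<phi> x i\<bar> < r"
    \<comment> \<open>A point of \<open>W\<close> with the same coordinates as \<open>z\<close>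
      exists, and injectivity of the chart identifies it with \<open>z\<close>.\<close>
    obtain z' where "z' \<in> W" "\<phi> z' = (\<lambda>i. \<phi> x i + (\<phi> z i - \<phi> x i))"
      using r3(2)[of "\<lambda>i. \<phi> z i - \<phi> x i"] z r(1) x(1) chart_coordinate_0[OF U] by fastforce
    then have "z \<in> W" using inj_onD[OF chart_inj_on[OF U], of z' z] z(1) W(2) by auto
    then show "g z \<in> V \<and> h z \<in> V" by (auto simp: W_def)
    fix j assume j: "j < n"
    have "((\<lambda>\<alpha>. c1 j \<alpha> * monomial n \<alpha> (\<lambda>i. \<phi> z i - \<phi> x i)) has_sum \<psi> (g z) j) (multi_indices n)"
      using z r(2)[OF j] by (intro 1(2)[OF j]) fastforce+
    moreover have "((\<lambda>\<alpha>. c2 j \<alpha> * monomial n \<alpha> (\<lambda>i. \<phi> z i - \<phi> x i)) has_sum \<psi> (h z) j) (multi_indices n)"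
      using z r(3)[OF j] by (intro 2(2)[OF j]) fastforce+
    ultimately show "((\<lambda>\<alpha>. (c1 j \<alpha> - c2 j \<alpha>) * monomial n \<alpha> (\<lambda>i. \<phi> z i - \<phi> x i)) has_sum (\<psi> (g z) j - \<psi> (h z) j)) (multi_indices n)"
      using has_sum_add[OF _ has_sum_uminusI] by (fastforce simp: left_diff_distrib)
  qed
qed

text \<open>Two triggers force all coefficients of the difference series at \<open>x\<close> to
  vanish: agreement on some nonempty open subset, needed to spread coincidence over the manifold,
  and flatness at \<open>x\<close>, needed to recover a map from its jets. The neighbourhood
  \<open>W\<close> is fixed before \<open>W'\<close>, so that an agreement set merely meeting
  \<open>W\<close> suffices.\<close>

lemma analytic_self_maps_local_coincidence:
  assumes g: "analytic_self_map n N \<A> g" and h: "analytic_self_map n N \<A> h"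
    and charts: "(U, \<phi>) \<in> \<A>" "(V, \<psi>) \<in> \<A>"
    and U: "is_chart n N U \<phi>" and V: "is_chart n N V \<psi>" and x: "x \<in> U" "g x \<in> V" "h x = g x"
  shows "\<exists>W. openin N W \<and> x \<in> W \<and>
      (\<forall>W'. openin N W' \<and> W' \<subseteq> W \<and> W' \<noteq> {} \<and> (\<forall>z\<in>W'. g z = h z) \<longrightarrow> (\<forall>z\<in>W. g z = h z)) \<and>
      ((\<forall>j<n. \<forall>k. (\<lambda>z. \<psi> (g z) j - \<psi> (h z) j) \<in> O[nhdsin N x](\<lambda>z. sum_norm n (\<lambda>i. \<phi> z i - \<phi> x i) ^ k)) \<longrightarrow>
        (\<forall>z\<in>W. g z = h z))"
proof -
  obtain r c where r: "r > 0"
    and surj: "\<And>y. (\<forall>i\<ge>n. y i = 0) \<Longrightarrow> (\<forall>i<n. \<bar>y i\<bar> < r) \<Longrightarrow> \<exists>z\<in>U. \<phi> z = (\<lambda>i. \<phi> x i + y i)"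
    and c: "\<And>z j. z \<in> U \<Longrightarrow> (\<forall>i<n. \<bar>\<phi> z i - \<phi> x i\<bar> < r) \<Longrightarrow> j < n \<Longrightarrow>
      ((\<lambda>\<alpha>. c j \<alpha> * monomial n \<alpha> (\<lambda>i. \<phi> z i - \<phi> x i)) has_sum (\<psi> (g z) j - \<psi> (h z) j)) (multi_indices n)"
    and inV: "\<And>z. z \<in> U \<Longrightarrow> (\<forall>i<n. \<bar>\<phi> z i - \<phi> x i\<bar> < r) \<Longrightarrow> g z \<in> V \<and> h z \<in> V"
    using analytic_self_maps_difference_expansion[OF assms] by blast
  define e where "e y = inv_into U \<phi> (\<lambda>i. \<phi> x i + y i)" for y
  have e: "e y \<in> U" "\<phi> (e y) = (\<lambda>i. \<phi> x i + y i)" if "\<forall>i\<ge>n. y i = 0" "\<forall>i<n. \<bar>y i\<bar> < r" for y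
  proof -
    have "(\<lambda>i. \<phi> x i + y i) \<in> \<phi> ` U" using surj[OF that] by force
    then show "e y \<in> U" "\<phi> (e y) = (\<lambda>i. \<phi> x i + y i)"
      unfolding e_def by (auto intro: inv_into_into f_inv_into_f)
  qed
  define f where "f j y = \<psi> (g (e y)) j - \<psi> (h (e y)) j" for j y
  have f: "((\<lambda>\<alpha>. c j \<alpha> * monomial n \<alpha> y) has_sum f j y) (multi_indices n)"
    if "j < n" "\<forall>i\<ge>n. y i = 0" "\<forall>i<n. \<bar>y i\<bar> < r" for j y
    using c[OF e(1), of y j] e(2)[of y] that by (simp add: f_def)
  have eq: "g z = h z" if zero: "\<And>j \<alpha>. j < n \<Longrightarrow> \<alpha> \<in> multi_indices n \<Longrightarrow> c j \<alpha> = 0"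
    and z: "z \<in> U" "\<forall>i<n. \<bar>\<phi> z i - \<phi> x i\<bar> < r" for z
  proof -
    have "\<psi> (g z) j = \<psi> (h z) j" for j
    proof (cases "j < n")
      case True
      have "((\<lambda>\<alpha>. c j \<alpha> * monomial n \<alpha> (\<lambda>i. \<phi> z i - \<phi> x i)) has_sum 0) (multi_indices n)"
        using zero[OF True] by (intro has_sum_0) auto
      then show ?thesis using has_sum_unique[OF c[OF z True]] by fastforce
    next
      case False
      then show ?thesis using inV[OF z] chart_coordinate_0[OF V] by simp
    qed
    then have "\<psi> (g z) = \<psi> (h z)" by auto
    then show ?thesis using inV[OF z] inj_onD[OF chart_inj_on[OF V]] by blast
  qed
  obtain W where W: "openin N W" "x \<in> W" "W \<subseteq> U" "\<And>z i. z \<in> W \<Longrightarrow> i < n \<Longrightarrow> \<bar>\<phi> z i - \<phi> x i\<bar> < r"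
    using chart_small_neighbourhood[OF U x(1) r] by metis
  show ?thesis
  proof (intro exI conjI allI impI)
    show "openin N W" "x \<in> W" by fact+
    fix W' assume "openin N W' \<and> W' \<subseteq> W \<and> W' \<noteq> {} \<and> (\<forall>z\<in>W'. g z = h z)"
    then have W': "openin N W'" "W' \<subseteq> W" "W' \<noteq> {}" "\<And>z. z \<in> W' \<Longrightarrow> g z = h z" by auto
    then obtain z0 where z0: "z0 \<in> W'" by blast
    obtain \<delta> where \<delta>: "\<delta> > 0" "\<And>y. (\<forall>i\<ge>n. y i = 0) \<Longrightarrow> (\<forall>i<n. \<bar>y i\<bar> < \<delta>) \<Longrightarrow> \<exists>z\<in>W'. \<phi> z = (\<lambda>i. \<phi> z0 i + y i)"
      using chart_contains_box[OF U W'(1) _ z0] W'(2) W(3) by blast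
    \<comment> \<open>The series \<open>c j\<close> is centred at \<open>x\<close>, while agreement
      is known near \<open>z0\<close>; \<open>q\<close> is the displacement of \<open>z0\<close> in
      coordinates centred at \<open>x\<close>.\<close>
    define q where "q i = \<phi> z0 i - \<phi> x i" for i
    have q0: "q i = 0" if "i \<ge> n" for i
      using chart_coordinate_0[OF U _ that] x(1) z0 W'(2) W(3) by (auto simp: q_def)
    have near: "\<exists>z\<in>W'. \<phi> z = (\<lambda>i. \<phi> x i + y i)" if "\<forall>i\<ge>n. y i = 0" "\<forall>i<n. \<bar>y i - q i\<bar> < \<delta>" for y
    proof -
      have "\<exists>z\<in>W'. \<phi> z = (\<lambda>i. \<phi> z0 i + (y i - q i))"
        by (rule \<delta>(2)) (use that q0 in auto)
      then obtain z where "z \<in> W'" "\<phi> z = (\<lambda>i. \<phi> z0 i + (y i - q i))" by blast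
      then show ?thesis by (intro bexI[of _ z]) (auto simp: q_def)
    qed
    have "c j \<alpha> = 0" if j: "j < n" and \<alpha>: "\<alpha> \<in> multi_indices n" for j \<alpha>
    proof (rule locally_vanishing_power_series_eq_0[where c = "c j" and f = "f j" and r = r and q = q and \<delta> = \<delta>, OF _ \<delta>(1) _ _ \<alpha>])
      show "((\<lambda>\<alpha>. c j \<alpha> * monomial n \<alpha> y) has_sum f j y) (multi_indices n)"
        if "\<forall>i\<ge>n. y i = 0" "\<forall>i<n. \<bar>y i\<bar> < r" for y using f[OF j that] .
      have small: "\<bar>y i\<bar> < r" if y: "\<forall>j<n. \<bar>y j - q j\<bar> < \<delta>" and i: "i < n" for y i
      proof -
        \<comment> \<open>The coordinates of \<open>y\<close> from \<open>n\<close> on are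
          unrestricted here, so they are cut off before \<open>near\<close> applies.\<close>
        define y' where "y' i = (if i < n then y i else 0)" for i
        obtain z where "z \<in> W'" "\<phi> z = (\<lambda>i. \<phi> x i + y' i)" using near[of y'] y by (auto simp: y'_def)
        then show ?thesis using W(4)[of z i] W'(2) i by (auto simp: y'_def)
      qed
      then show "\<bar>y i\<bar> < r" if "\<forall>j<n. \<bar>y j - q j\<bar> < \<delta>" "i < n" for y i using that by blast
      fix y :: "nat \<Rightarrow> real" assume y: "\<forall>i\<ge>n. y i = 0" "\<forall>i<n. \<bar>y i - q i\<bar> < \<delta>"
      obtain z where z: "z \<in> W'" "\<phi> z = (\<lambda>i. \<phi> x i + y i)" using near[OF y] by blast
      have "\<forall>i<n. \<bar>y i\<bar> < r" using small y(2) by blast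
      then have "e y = z"
        using e[of y] y z W'(2) W(3) inj_onD[OF chart_inj_on[OF U], of "e y" z] by auto
      then show "f j y = 0" using W'(4) z(1) by (simp add: f_def)
    qed
    then show "\<forall>z\<in>W. g z = h z" using W by (intro ballI eq) auto
  next
    assume flat: "\<forall>j<n. \<forall>k. (\<lambda>z. \<psi> (g z) j - \<psi> (h z) j) \<in> O[nhdsin N x](\<lambda>z. sum_norm n (\<lambda>i. \<phi> z i - \<phi> x i) ^ k)"
    have "c j \<alpha> = 0" if j: "j < n" and \<alpha>: "\<alpha> \<in> multi_indices n" for j \<alpha>
    proof (rule flat_power_series_eq_0[where c = "c j" and f = "f j" and r = r, OF r _ _ \<alpha>])
      show "((\<lambda>\<alpha>. c j \<alpha> * monomial n \<alpha> y) has_sum f j y) (multi_indices n)"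
        if "\<forall>i\<ge>n. y i = 0" "\<forall>i<n. \<bar>y i\<bar> < r" for y using f[OF j that] .
      fix k
      from flat[rule_format, OF j] obtain C where
        "\<forall>\<^sub>F z in nhdsin N x. norm (\<psi> (g z) j - \<psi> (h z) j) \<le> C * norm (sum_norm n (\<lambda>i. \<phi> z i - \<phi> x i) ^ k)"
        by (rule landau_o.bigE)
      then obtain \<epsilon> where \<epsilon>: "\<epsilon> > 0" "\<And>z. z \<in> U \<Longrightarrow> (\<forall>i<n. \<bar>\<phi> z i - \<phi> x i\<bar> < \<epsilon>) \<Longrightarrow>
          \<bar>\<psi> (g z) j - \<psi> (h z) j\<bar> \<le> C * sum_norm n (\<lambda>i. \<phi> z i - \<phi> x i) ^ k"
        unfolding eventually_nhdsin_chart[OF U x(1)] by (auto simp: power_abs abs_of_nonneg[OF sum_norm_nonneg])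
      have "\<bar>f j y\<bar> \<le> C * sum_norm n y ^ k" if y: "\<forall>i\<ge>n. y i = 0" "\<forall>i<n. \<bar>y i\<bar> < min \<epsilon> r" for y
        using \<epsilon>(2)[OF e(1), of y] e(2)[of y] y by (simp add: f_def)
      then show "\<exists>C. \<exists>\<epsilon>>0. \<forall>y. (\<forall>i\<ge>n. y i = 0) \<longrightarrow> (\<forall>i<n. \<bar>y i\<bar> < \<epsilon>) \<longrightarrow> \<bar>f j y\<bar> \<le> C * sum_norm n y ^ k"
        using \<epsilon>(1) r by (intro exI[of _ C] exI[of _ "min \<epsilon> r"]) auto
    qed
    then show "\<forall>z\<in>W. g z = h z" using W by (intro ballI eq) auto
  qed
qed

text \<open>\<open>E\<close> is the interior of the coincidence set, and it is also closed. A point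
  outside it with \<open>g y \<noteq> h y\<close> is handled by the Hausdorff property; if
  \<open>g y = h y\<close>, a neighbourhood as in the local lemma that met \<open>E\<close> would
  lie in \<open>E\<close>. Connectedness then makes the nonempty set \<open>E\<close> the whole
  space.\<close>

lemma analytic_self_maps_identity:
  assumes N: "analytic_manifold n N \<A>" "connected_space N"
    and g: "analytic_self_map n N \<A> g" and h: "analytic_self_map n N \<A> h"
    and W0: "openin N W0" "W0 \<noteq> {}" "\<And>z. z \<in> W0 \<Longrightarrow> g z = h z"
    and x: "x \<in> topspace N"
  shows "g x = h x"
proof -
  define E where "E = \<Union>{W. openin N W \<and> (\<forall>z\<in>W. g z = h z)}"
  have E: "openin N E" "E \<subseteq> topspace N" unfolding E_def using openin_subset by (auto intro!: openin_Union)
  have cont: "continuous_map N N g" "continuous_map N N h" using g h by (auto simp: analytic_self_map_def)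
  have "openin N (topspace N - E)"
  proof (subst openin_subopen, intro ballI)
    fix y assume y: "y \<in> topspace N - E"
    have gy: "g y \<in> topspace N" "h y \<in> topspace N" using cont y by (auto simp: continuous_map_def)
    have "\<exists>T. openin N T \<and> y \<in> T \<and> T \<inter> E = {}"
    proof (cases "g y = h y")
      case False
      then obtain A B where AB: "openin N A" "openin N B" "g y \<in> A" "h y \<in> B" "disjnt A B"
        using N(1) gy unfolding analytic_manifold_def Hausdorff_space_def by metis
      define T where "T = {z \<in> topspace N. g z \<in> A} \<inter> {z \<in> topspace N. h z \<in> B}"
      have "openin N T" unfolding T_def using cont AB
        by (intro openin_Int openin_continuous_map_preimage) auto
      moreover have "T \<inter> E = {}" using AB(5) by (auto simp: T_def E_def disjnt_def)
      ultimately show ?thesis using y AB by (auto simp: T_def)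
    next
      case True
      obtain U \<phi> V \<psi> where UV: "(U, \<phi>) \<in> \<A>" "(V, \<psi>) \<in> \<A>" "y \<in> U" "g y \<in> V"
        using N(1) y gy unfolding analytic_manifold_def by blast
      have ch: "is_chart n N U \<phi>" "is_chart n N V \<psi>" using N(1) UV by (auto simp: analytic_manifold_def)
      obtain W where W: "openin N W" "y \<in> W" "\<And>W'. openin N W' \<and> W' \<subseteq> W \<and> W' \<noteq> {} \<and>
          (\<forall>z\<in>W'. g z = h z) \<Longrightarrow> \<forall>z\<in>W. g z = h z"
        using analytic_self_maps_local_coincidence[OF g h UV(1,2) ch UV(3,4) True[symmetric]] by blast
      have "W \<inter> E = {}"
      proof (rule ccontr)
        assume "W \<inter> E \<noteq> {}"
        then have "\<forall>z\<in>W. g z = h z" using W(1) E(1) by (intro W(3)[of "W \<inter> E"]) (auto simp: E_def)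
        then have "y \<in> E" using W by (auto simp: E_def)
        then show False using y by simp
      qed
      then show ?thesis using W by blast
    qed
    then obtain T where "openin N T" "y \<in> T" "T \<inter> E = {}" by blast
    then show "\<exists>T. openin N T \<and> y \<in> T \<and> T \<subseteq> topspace N - E"
      using openin_subset by (intro exI[of _ T]) auto
  qed
  then have "closedin N E" using E by (simp add: closedin_def)
  then have "E = {} \<or> E = topspace N" using N(2) E(1) by (simp add: connected_space_clopen_in)
  moreover have "E \<noteq> {}" using W0 by (auto simp: E_def)
  ultimately show ?thesis using x by (auto simp: E_def)
qed

section \<open>Jets at a point\<close>

locale pointed_chart =
  fixes n :: nat and N :: "'a topology" and U :: "'a set" and \<phi> :: "'a \<Rightarrow> nat \<Rightarrow> real" and x0 :: 'a
  assumes chart: "is_chart n N U \<phi>" and x0: "x0 \<in> U"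
begin

definition \<nu> :: "'a \<Rightarrow> real" where
  "\<nu> x = sum_norm n (\<lambda>i. \<phi> x i - \<phi> x0 i)"

definition M :: "(nat \<Rightarrow> nat) \<Rightarrow> 'a \<Rightarrow> real" where
  "M \<alpha> x = monomial n \<alpha> (\<lambda>i. \<phi> x i - \<phi> x0 i)"

text \<open>The filter \<open>nhdsin N x0\<close> does not delete the point itself, so for
  \<open>k > 0\<close> membership forces the value 0 at \<open>x0\<close>. Behaviour away from
  \<open>x0\<close>, in particular outside \<open>U\<close>, is irrelevant.\<close>

abbreviation vanishing :: "nat \<Rightarrow> ('a \<Rightarrow> real) set" where
  "vanishing k \<equiv> O[nhdsin N x0](\<lambda>x. \<nu> x ^ k)"

definition taylor :: "nat \<Rightarrow> ((nat \<Rightarrow> nat) \<Rightarrow> real) \<Rightarrow> ('a \<Rightarrow> real) \<Rightarrow> bool" where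
  "taylor k c F \<longleftrightarrow> (\<lambda>x. F x - (\<Sum>\<alpha>\<in>indices_upto n k. c \<alpha> * M \<alpha> x)) \<in> vanishing (Suc k)"

definition has_taylor :: "nat \<Rightarrow> ('a \<Rightarrow> real) \<Rightarrow> bool" where
  "has_taylor k F \<longleftrightarrow> (\<exists>c. taylor k c F)"

text \<open>Coefficients at indices outside \<open>indices_upto n k\<close> are arbitrary here;
  within that set they are determined by \<open>F\<close> whenever an expansion exists.\<close>

definition jet :: "nat \<Rightarrow> ('a \<Rightarrow> real) \<Rightarrow> (nat \<Rightarrow> nat) \<Rightarrow> real" where
  "jet k F = (SOME c. taylor k c F)"

lemma \<nu>_nonneg: "\<nu> x \<ge> 0"
  by (simp add: \<nu>_def sum_norm_nonneg)

lemma x0_topspace: "x0 \<in> topspace N"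
  using chart x0 openin_subset by (fastforce simp: is_chart_def)

lemma eventually_chart: "eventually Q (nhdsin N x0) \<longleftrightarrow> (\<exists>\<epsilon>>0. \<forall>x\<in>U. (\<forall>i<n. \<bar>\<phi> x i - \<phi> x0 i\<bar> < \<epsilon>) \<longrightarrow> Q x)"
  by (rule eventually_nhdsin_chart[OF chart x0])

lemma eventually_at_x0: "eventually Q (nhdsin N x0) \<Longrightarrow> Q x0"
  using x0_topspace by (auto simp: eventually_nhdsin)

lemma eventually_in_U: "eventually (\<lambda>x. x \<in> U) (nhdsin N x0)"
  unfolding eventually_chart by (auto intro: exI[of _ 1])

lemma eventually_\<nu>_le:
  assumes "e > 0"
  shows "eventually (\<lambda>x. \<nu> x \<le> e) (nhdsin N x0)"
  unfolding eventually_chart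
proof (intro exI conjI ballI impI)
  show "e / (real n + 1) > 0" using assms by simp
  fix x assume "\<forall>i<n. \<bar>\<phi> x i - \<phi> x0 i\<bar> < e / (real n + 1)"
  then have "\<nu> x \<le> real n * (e / (real n + 1))"
    using sum_bounded_above[of "{..<n}" "\<lambda>i. \<bar>\<phi> x i - \<phi> x0 i\<bar>" "e / (real n + 1)"]
    by (simp add: \<nu>_def sum_norm_def less_imp_le)
  also have "\<dots> \<le> e" using assms by (simp add: field_simps)
  finally show "\<nu> x \<le> e" .
qed

lemma vanishing_mono: "k \<le> l \<Longrightarrow> vanishing l \<subseteq> vanishing k"
proof (rule landau_o.big.subsetI)
  assume "k \<le> l"
  show "(\<lambda>x. \<nu> x ^ l) \<in> vanishing k"
    by (intro landau_o.bigI[of 1] eventually_mono[OF eventually_\<nu>_le[of 1]])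
      (use \<open>k \<le> l\<close> in \<open>auto simp: power_decreasing \<nu>_nonneg\<close>)
qed

lemma M_vanishing: "M \<alpha> \<in> vanishing (mdegree n \<alpha>)"
proof (rule landau_o.bigI[of 1])
  have "\<bar>M \<alpha> x\<bar> \<le> \<nu> x ^ mdegree n \<alpha>" for x
    unfolding M_def \<nu>_def by (rule abs_monomial_le)
  then show "\<forall>\<^sub>F x in nhdsin N x0. norm (M \<alpha> x) \<le> 1 * norm (\<nu> x ^ mdegree n \<alpha>)"
    using \<nu>_nonneg by (intro always_eventually) simp
qed simp

lemma vanishing_cmult: "F \<in> vanishing k \<Longrightarrow> (\<lambda>x. a * F x) \<in> vanishing k"
  by (cases "a = 0") auto

text \<open>The difference of two Taylor polynomials has degree at most \<open>k\<close> and
  vanishes to order \<open>k + 1\<close>. Since the chart covers a box around the base point, this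
  is an estimate for an honest polynomial, which must be 0.\<close>

lemma taylor_unique:
  assumes "taylor k c F" "taylor k d F" "\<alpha> \<in> indices_upto n k"
  shows "c \<alpha> = d \<alpha>"
proof -
  have "(\<lambda>x. (F x - (\<Sum>\<alpha>\<in>indices_upto n k. d \<alpha> * M \<alpha> x)) - (F x - (\<Sum>\<alpha>\<in>indices_upto n k. c \<alpha> * M \<alpha> x)))
      \<in> vanishing (Suc k)"
    by (rule sum_in_bigo(2)[OF assms(2,1)[unfolded taylor_def]])
  then have "(\<lambda>x. \<Sum>\<alpha>\<in>indices_upto n k. (c \<alpha> - d \<alpha>) * M \<alpha> x) \<in> vanishing (Suc k)"
    by (simp add: left_diff_distrib sum_subtractf)
  then obtain C where "\<forall>\<^sub>F x in nhdsin N x0. norm (\<Sum>\<alpha>\<in>indices_upto n k. (c \<alpha> - d \<alpha>) * M \<alpha> x) \<le> C * norm (\<nu> x ^ Suc k)"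
    by (rule landau_o.bigE)
  then obtain \<epsilon> where \<epsilon>: "\<epsilon> > 0" "\<And>x. x \<in> U \<Longrightarrow> \<forall>i<n. \<bar>\<phi> x i - \<phi> x0 i\<bar> < \<epsilon> \<Longrightarrow>
      \<bar>\<Sum>\<alpha>\<in>indices_upto n k. (c \<alpha> - d \<alpha>) * M \<alpha> x\<bar> \<le> C * \<nu> x ^ Suc k"
    unfolding eventually_chart by (auto simp: abs_of_nonneg[OF \<nu>_nonneg] abs_mult power_abs)
  have U: "openin N U" using chart by (simp add: is_chart_def)
  obtain \<delta> where \<delta>: "\<delta> > 0" "\<And>y. (\<forall>i\<ge>n. y i = 0) \<Longrightarrow> (\<forall>i<n. \<bar>y i\<bar> < \<delta>) \<Longrightarrow> \<exists>x\<in>U. \<phi> x = (\<lambda>i. \<phi> x0 i + y i)"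
    using chart_contains_box[OF chart U order_refl x0] by blast
  have "c \<alpha> - d \<alpha> = 0"
  proof (rule small_polynomial_eq_0[where c = "\<lambda>\<alpha>. c \<alpha> - d \<alpha>" and C = C and \<epsilon> = "min \<epsilon> \<delta>",
        OF finite_indices_upto order_refl _ _ assms(3)])
    show "min \<epsilon> \<delta> > 0" using \<epsilon> \<delta> by simp
    fix y :: "nat \<Rightarrow> real" assume y: "\<forall>i\<ge>n. y i = 0" "\<forall>i<n. \<bar>y i\<bar> < min \<epsilon> \<delta>"
    then obtain x where x: "x \<in> U" "\<phi> x = (\<lambda>i. \<phi> x0 i + y i)" using \<delta>(2)[of y] by auto
    show "\<bar>\<Sum>\<alpha>\<in>indices_upto n k. (c \<alpha> - d \<alpha>) * monomial n \<alpha> y\<bar> \<le> C * sum_norm n y ^ Suc k"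
      using \<epsilon>(2)[OF x(1)] y(2) by (simp add: x(2) M_def \<nu>_def)
  qed
  then show ?thesis by simp
qed

lemma taylor_jet: "has_taylor k F \<Longrightarrow> taylor k (jet k F) F"
  unfolding has_taylor_def jet_def by (rule someI_ex[where P = "\<lambda>c. taylor k c F"])

lemma jet_eqI: "taylor k c F \<Longrightarrow> \<alpha> \<in> indices_upto n k \<Longrightarrow> jet k F \<alpha> = c \<alpha>"
  using taylor_unique taylor_jet has_taylor_def by blast

lemma taylor_add:
  assumes "taylor k c F" "taylor k d G"
  shows "taylor k (\<lambda>\<alpha>. c \<alpha> + d \<alpha>) (\<lambda>x. F x + G x)"
  using sum_in_bigo(1)[OF assms[unfolded taylor_def]]
  unfolding taylor_def by (simp add: distrib_right sum.distrib algebra_simps)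

lemma taylor_cmult:
  assumes "taylor k c F"
  shows "taylor k (\<lambda>\<alpha>. a * c \<alpha>) (\<lambda>x. a * F x)"
  using vanishing_cmult[OF assms[unfolded taylor_def], of a]
  unfolding taylor_def by (simp add: right_diff_distrib sum_distrib_left mult.assoc)

lemma has_taylor_add: "has_taylor k F \<Longrightarrow> has_taylor k G \<Longrightarrow> has_taylor k (\<lambda>x. F x + G x)"
  using taylor_add unfolding has_taylor_def by blast

lemma has_taylor_cmult: "has_taylor k F \<Longrightarrow> has_taylor k (\<lambda>x. a * F x)"
  using taylor_cmult unfolding has_taylor_def by blast

lemma has_taylor_vanishing: "F \<in> vanishing (Suc k) \<Longrightarrow> has_taylor k F"
  unfolding has_taylor_def taylor_def by (intro exI[of _ "\<lambda>_. 0"]) simp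

lemma has_taylor_M:
  assumes "\<alpha> \<in> multi_indices n"
  shows "has_taylor k (M \<alpha>)"
proof (cases "mdegree n \<alpha> \<le> k")
  case True
  then have "\<alpha> \<in> indices_upto n k" using assms by (simp add: indices_upto_def)
  then have "(\<Sum>\<beta>\<in>indices_upto n k. (if \<beta> = \<alpha> then 1 else 0) * M \<beta> x) = M \<alpha> x" for x
    using finite_indices_upto by (simp add: if_distrib[of "\<lambda>c. c * _"] sum.delta cong: if_cong)
  then show ?thesis
    unfolding has_taylor_def taylor_def by (intro exI[of _ "\<lambda>\<beta>. if \<beta> = \<alpha> then 1 else 0"]) simp
next
  case False
  then show ?thesis
    using M_vanishing[of \<alpha>] vanishing_mono[of "Suc k" "mdegree n \<alpha>"] by (intro has_taylor_vanishing) auto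
qed

lemma has_taylor_sum:
  assumes "\<And>i. i \<in> A \<Longrightarrow> has_taylor k (F i)"
  shows "has_taylor k (\<lambda>x. \<Sum>i\<in>A. F i x)"
  using assms
proof (induction A rule: infinite_finite_induct)
  case (insert i A)
  then show ?case using has_taylor_add by simp
qed (auto intro: has_taylor_vanishing)

lemma taylor_cong:
  assumes "\<forall>\<^sub>F x in nhdsin N x0. F x = G x"
  shows "taylor k c F \<longleftrightarrow> taylor k c G"
  unfolding taylor_def
  by (intro landau_o.big.in_cong eventually_mono[OF assms]) simp

lemma has_taylor_const: "has_taylor k (\<lambda>_. a)"
  using has_taylor_cmult[OF has_taylor_M[of "\<lambda>_. 0" k], of a]
  by (simp add: multi_indices_def M_def monomial_def)

lemma polynomial_bounded: "(\<lambda>x. \<Sum>\<alpha>\<in>A. c \<alpha> * M \<alpha> x) \<in> vanishing 0"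
proof -
  have "(\<lambda>x. c \<alpha> * M \<alpha> x) \<in> vanishing 0" for \<alpha>
    using M_vanishing[of \<alpha>] vanishing_mono[of 0 "mdegree n \<alpha>"] by (intro vanishing_cmult) auto
  then show ?thesis by (intro big_sum_in_bigo)
qed

lemma has_taylor_bounded:
  assumes "has_taylor k F"
  shows "F \<in> vanishing 0"
proof -
  obtain c where "taylor k c F" using assms by (auto simp: has_taylor_def)
  then have "(\<lambda>x. F x - (\<Sum>\<alpha>\<in>indices_upto n k. c \<alpha> * M \<alpha> x)) \<in> vanishing 0"
    unfolding taylor_def using vanishing_mono[of 0 "Suc k"] by auto
  from sum_in_bigo(1)[OF this polynomial_bounded[of c "indices_upto n k"]] show ?thesis by simp
qed

text \<open>With Taylor polynomials \<open>P\<close> and \<open>Q\<close>, write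
  \<open>F * G = (F - P) * G + P * (G - Q) + P * Q\<close>. Boundedness of \<open>G\<close> and
  \<open>P\<close> makes the first two terms vanish to order \<open>k + 1\<close>; monomials of
  \<open>P * Q\<close> of degree above \<open>k\<close> do so as well.\<close>

lemma has_taylor_mult:
  assumes "has_taylor k F" "has_taylor k G"
  shows "has_taylor k (\<lambda>x. F x * G x)"
proof -
  obtain c d where c: "taylor k c F" and d: "taylor k d G" using assms by (auto simp: has_taylor_def)
  define P where "P x = (\<Sum>\<alpha>\<in>indices_upto n k. c \<alpha> * M \<alpha> x)" for x
  define Q where "Q x = (\<Sum>\<alpha>\<in>indices_upto n k. d \<alpha> * M \<alpha> x)" for x
  have 1: "has_taylor k (\<lambda>x. (F x - P x) * G x)"
    using landau_o.big.mult[OF c[unfolded taylor_def] has_taylor_bounded[OF assms(2)]]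
    by (intro has_taylor_vanishing) (simp add: P_def)
  have 2: "has_taylor k (\<lambda>x. P x * (G x - Q x))"
    using landau_o.big.mult[OF polynomial_bounded[of c "indices_upto n k"] d[unfolded taylor_def]]
    by (intro has_taylor_vanishing) (simp add: P_def Q_def)
  have "has_taylor k (\<lambda>x. c \<alpha> * (d \<beta> * M (\<lambda>i. \<alpha> i + \<beta> i) x))"
    if "\<alpha> \<in> indices_upto n k" "\<beta> \<in> indices_upto n k" for \<alpha> \<beta>
    using that by (intro has_taylor_cmult has_taylor_M) (auto simp: indices_upto_def multi_indices_def)
  then have "has_taylor k (\<lambda>x. \<Sum>\<alpha>\<in>indices_upto n k. \<Sum>\<beta>\<in>indices_upto n k. c \<alpha> * (d \<beta> * M (\<lambda>i. \<alpha> i + \<beta> i) x))"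
    by (intro has_taylor_sum)
  also have "(\<lambda>x. \<Sum>\<alpha>\<in>indices_upto n k. \<Sum>\<beta>\<in>indices_upto n k. c \<alpha> * (d \<beta> * M (\<lambda>i. \<alpha> i + \<beta> i) x)) = (\<lambda>x. P x * Q x)"
    by (auto simp: P_def Q_def sum_product M_def monomial_add mult_ac)
  finally have 3: "has_taylor k (\<lambda>x. P x * Q x)" .
  have "has_taylor k (\<lambda>x. (F x - P x) * G x + P x * (G x - Q x) + P x * Q x)"
    by (intro has_taylor_add 1 2 3)
  also have "(\<lambda>x. (F x - P x) * G x + P x * (G x - Q x) + P x * Q x) = (\<lambda>x. F x * G x)"
    by (auto simp: algebra_simps)
  finally show ?thesis .
qed

lemma has_taylor_power: "has_taylor k F \<Longrightarrow> has_taylor k (\<lambda>x. F x ^ m)"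
  by (induction m) (auto intro: has_taylor_mult has_taylor_const)

lemma has_taylor_prod:
  assumes "\<And>i. i \<in> A \<Longrightarrow> has_taylor k (F i)"
  shows "has_taylor k (\<lambda>x. \<Prod>i\<in>A. F i x)"
  using assms
  by (induction A rule: infinite_finite_induct) (auto intro: has_taylor_mult has_taylor_const)

text \<open>The remainder estimate in coordinates is carried over to \<open>N\<close>. Reading
  \<open>F\<close> through the inverse chart makes sense only on a box covered by the chart, hence
  the minimum of two radii.\<close>

lemma has_taylor_power_series:
  assumes "r > 0" and ps: "\<And>z. z \<in> U \<Longrightarrow> (\<forall>i<n. \<bar>\<phi> z i - \<phi> x0 i\<bar> < r) \<Longrightarrow>
      ((\<lambda>\<alpha>. c \<alpha> * monomial n \<alpha> (\<lambda>i. \<phi> z i - \<phi> x0 i)) has_sum F z) (multi_indices n)"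
  shows "has_taylor k F"
proof -
  have U: "openin N U" using chart by (simp add: is_chart_def)
  obtain \<delta> where \<delta>: "\<delta> > 0" "\<And>y. (\<forall>i\<ge>n. y i = 0) \<Longrightarrow> (\<forall>i<n. \<bar>y i\<bar> < \<delta>) \<Longrightarrow> \<exists>x\<in>U. \<phi> x = (\<lambda>i. \<phi> x0 i + y i)"
    using chart_contains_box[OF chart U order_refl x0] by blast
  define s where "s = min \<delta> r"
  have s: "s > 0" using \<delta> assms(1) by (simp add: s_def)
  define f where "f y = F (inv_into U \<phi> (\<lambda>i. \<phi> x0 i + y i))" for y
  have f: "((\<lambda>\<alpha>. c \<alpha> * monomial n \<alpha> y) has_sum f y) (multi_indices n)"
    if y: "\<forall>i\<ge>n. y i = 0" "\<forall>i<n. \<bar>y i\<bar> < s" for y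
  proof -
    have "\<forall>i<n. \<bar>y i\<bar> < \<delta>" using y by (auto simp: s_def)
    then obtain x where x: "x \<in> U" "\<phi> x = (\<lambda>i. \<phi> x0 i + y i)" using \<delta>(2)[OF y(1)] by blast
    then have "f y = F x" using inv_into_f_f[OF chart_inj_on[OF chart] x(1)] by (simp add: f_def)
    then show ?thesis using ps[OF x(1)] y by (simp add: x(2) s_def)
  qed
  have F: "F x = f (\<lambda>i. \<phi> x i - \<phi> x0 i)" if "x \<in> U" for x
    using inv_into_f_f[OF chart_inj_on[OF chart] that] by (simp add: f_def)
  obtain C where C: "\<And>y. (\<forall>i\<ge>n. y i = 0) \<Longrightarrow> sum_norm n y \<le> s / 2 \<Longrightarrow>
      \<bar>f y - (\<Sum>\<alpha>\<in>indices_upto n k. c \<alpha> * monomial n \<alpha> y)\<bar> \<le> C * sum_norm n y ^ Suc k"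
    using taylor_remainder_bound[OF s f] by blast
  have "taylor k c F"
    unfolding taylor_def
  proof (rule bigoI)
    have "\<forall>\<^sub>F x in nhdsin N x0. \<nu> x \<le> s / 2 \<and> x \<in> U"
      using s by (intro eventually_conj eventually_\<nu>_le eventually_in_U) auto
    then show "\<forall>\<^sub>F x in nhdsin N x0. norm (F x - (\<Sum>\<alpha>\<in>indices_upto n k. c \<alpha> * M \<alpha> x)) \<le> C * norm (\<nu> x ^ Suc k)"
    proof (rule eventually_mono)
      fix x assume x: "\<nu> x \<le> s / 2 \<and> x \<in> U"
      then show "norm (F x - (\<Sum>\<alpha>\<in>indices_upto n k. c \<alpha> * M \<alpha> x)) \<le> C * norm (\<nu> x ^ Suc k)"
        using C[of "\<lambda>i. \<phi> x i - \<phi> x0 i"] chart_coordinate_0[OF chart] x0 \<nu>_nonneg[of x]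
        by (simp add: F M_def \<nu>_def)
    qed
  qed
  then show ?thesis by (auto simp: has_taylor_def)
qed

end

section \<open>Pullback of jets by analytic maps fixing the point\<close>

locale pointed_analytic_chart = pointed_chart +
  fixes \<A> :: "'a chart set"
  assumes in_atlas: "(U, \<phi>) \<in> \<A>"
begin

text \<open>Global maps stand in for their germs: the jets below depend only on the behaviour near
  \<open>x0\<close>.\<close>

definition germs :: "('a \<Rightarrow> 'a) set" where
  "germs = {g. analytic_self_map n N \<A> g \<and> g x0 = x0}"

lemma has_taylor_coordinate:
  assumes "g \<in> germs" "j < n"
  shows "has_taylor k (\<lambda>x. \<phi> (g x) j - \<phi> x0 j)"
proof -
  have g: "analytic_self_map n N \<A> g" "g x0 \<in> U" using assms x0 by (auto simp: germs_def)
  obtain r c where "r > 0" "\<And>z. z \<in> U \<Longrightarrow> (\<forall>i<n. \<bar>\<phi> z i - \<phi> x0 i\<bar> < r) \<Longrightarrow>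
      ((\<lambda>\<alpha>. c \<alpha> * monomial n \<alpha> (\<lambda>i. \<phi> z i - \<phi> x0 i)) has_sum \<phi> (g z) j) (multi_indices n)"
    using analytic_self_map_expansion[OF g(1) in_atlas in_atlas chart x0 g(2) assms(2)] by blast
  then have "has_taylor k (\<lambda>x. \<phi> (g x) j)" by (rule has_taylor_power_series)
  from has_taylor_add[OF this has_taylor_const[of k "- \<phi> x0 j"]] show ?thesis by simp
qed

lemma has_taylor_pullback:
  assumes "g \<in> germs"
  shows "has_taylor k (\<lambda>x. M \<alpha> (g x))"
  unfolding M_def monomial_def
  by (intro has_taylor_prod has_taylor_power has_taylor_coordinate[OF assms]) simp

text \<open>Each coordinate displacement of \<open>g x\<close> from \<open>x0\<close> has an
  expansion of order 0, whose constant term is 0 because \<open>g\<close> fixes \<open>x0\<close>;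
  what remains is of order 1. Consequently composition with \<open>g\<close> does not lower the
  order of vanishing.\<close>

lemma \<nu>_pullback:
  assumes "g \<in> germs"
  shows "(\<lambda>x. \<nu> (g x)) \<in> vanishing 1"
proof -
  have "(\<lambda>x. \<bar>\<phi> (g x) j - \<phi> x0 j\<bar>) \<in> vanishing 1" if j: "j < n" for j
  proof -
    define F where "F x = \<phi> (g x) j - \<phi> x0 j" for x
    have ind: "indices_upto n 0 = {\<lambda>_. 0}"
      by (auto simp: indices_upto_def multi_indices_def mdegree_def fun_eq_iff) (metis lessThan_iff not_le)
    obtain c where "taylor 0 c F"
      using has_taylor_coordinate[OF assms j, of 0] by (auto simp: has_taylor_def F_def[abs_def])
    then have c: "(\<lambda>x. F x - c (\<lambda>_. 0)) \<in> vanishing 1"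
      by (simp add: taylor_def ind M_def monomial_def)
    then obtain C where "\<forall>\<^sub>F x in nhdsin N x0. norm (F x - c (\<lambda>_. 0)) \<le> C * norm (\<nu> x ^ 1)"
      by (rule landau_o.bigE)
    \<comment> \<open>The estimate also holds at \<open>x0\<close> itself, where
      \<open>\<nu>\<close> is 0 and \<open>F\<close> is 0.\<close>
    from eventually_at_x0[OF this] have "c (\<lambda>_. 0) = 0"
      using assms by (simp add: F_def germs_def \<nu>_def sum_norm_def)
    then show ?thesis using c by (simp add: F_def)
  qed
  then show ?thesis unfolding \<nu>_def[of "g _"] sum_norm_def by (intro big_sum_in_bigo) auto
qed

lemma filterlim_germ:
  assumes "g \<in> germs"
  shows "filterlim g (nhdsin N x0) (nhdsin N x0)"
  unfolding filterlim_iff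
proof (intro allI impI)
  fix P assume "eventually P (nhdsin N x0)"
  then obtain S where S: "openin N S" "x0 \<in> S" "\<forall>x\<in>S. P x"
    using x0_topspace by (auto simp: eventually_nhdsin)
  have "openin N {x \<in> topspace N. g x \<in> S}"
    using assms S by (auto simp: germs_def analytic_self_map_def intro: openin_continuous_map_preimage)
  then show "\<forall>\<^sub>F x in nhdsin N x0. P (g x)"
    using S x0_topspace assms unfolding eventually_nhdsin
    by (intro disjI2 exI[of _ "{x \<in> topspace N. g x \<in> S}"]) (auto simp: germs_def)
qed

lemma vanishing_pullback:
  assumes "g \<in> germs" "F \<in> vanishing k"
  shows "(\<lambda>x. F (g x)) \<in> vanishing k"
proof -
  have "(\<lambda>x. F (g x)) \<in> O[nhdsin N x0](\<lambda>x. \<nu> (g x) ^ k)"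
    by (rule landau_o.big.compose[OF assms(2) filterlim_germ[OF assms(1)]])
  also have "(\<lambda>x. \<nu> (g x) ^ k) \<in> vanishing k"
    using landau_o.big_power[OF \<nu>_pullback[OF assms(1)], of k] by simp
  finally show ?thesis .
qed

text \<open>The matrix of composition with \<open>g\<close> on \<open>k\<close>-jets: row
  \<open>\<alpha>\<close> holds the Taylor coefficients of the pulled-back monomial. Pullback
  reverses products, but listing coefficients in rows reverses them once more, so the matrices
  multiply in the order of the maps.\<close>

definition jet_rep :: "nat \<Rightarrow> ('a \<Rightarrow> 'a) \<Rightarrow> (nat \<Rightarrow> nat) \<Rightarrow> (nat \<Rightarrow> nat) \<Rightarrow> real" where
  "jet_rep k g \<alpha> = jet k (\<lambda>x. M \<alpha> (g x))"

lemma taylor_jet_rep: "g \<in> germs \<Longrightarrow> taylor k (jet_rep k g \<alpha>) (\<lambda>x. M \<alpha> (g x))"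
  unfolding jet_rep_def by (intro taylor_jet has_taylor_pullback)

text \<open>Expand the monomial after \<open>g\<close>, substitute \<open>h\<close>, and expand
  again; the first error keeps its order under substitution. Since multiplication in
  \<open>BijGroup\<close> is composition restricted to the space, \<open>f\<close> is compared with
  it on \<open>topspace N\<close>.\<close>

lemma jet_rep_mult:
  assumes g: "g \<in> germs" and h: "h \<in> germs" and gh: "\<And>x. x \<in> topspace N \<Longrightarrow> f x = g (h x)"
    and \<beta>: "\<beta> \<in> indices_upto n k"
  shows "jet_rep k f \<alpha> \<beta> = (\<Sum>\<gamma>\<in>indices_upto n k. jet_rep k g \<alpha> \<gamma> * jet_rep k h \<gamma> \<beta>)"
proof -
  let ?D = "indices_upto n k"
  have 1: "(\<lambda>x. M \<alpha> (g (h x)) - (\<Sum>\<gamma>\<in>?D. jet_rep k g \<alpha> \<gamma> * M \<gamma> (h x))) \<in> vanishing (Suc k)"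
    using vanishing_pullback[OF h taylor_jet_rep[OF g, of k \<alpha>, unfolded taylor_def]] .
  have "(\<lambda>x. jet_rep k g \<alpha> \<gamma> * (M \<gamma> (h x) - (\<Sum>\<beta>\<in>?D. jet_rep k h \<gamma> \<beta> * M \<beta> x))) \<in> vanishing (Suc k)" for \<gamma>
    by (rule vanishing_cmult[OF taylor_jet_rep[OF h, unfolded taylor_def]])
  then have 2: "(\<lambda>x. \<Sum>\<gamma>\<in>?D. jet_rep k g \<alpha> \<gamma> * (M \<gamma> (h x) - (\<Sum>\<beta>\<in>?D. jet_rep k h \<gamma> \<beta> * M \<beta> x))) \<in> vanishing (Suc k)"
    by (intro big_sum_in_bigo)
  have "(\<Sum>\<gamma>\<in>?D. jet_rep k g \<alpha> \<gamma> * (\<Sum>\<beta>\<in>?D. jet_rep k h \<gamma> \<beta> * M \<beta> x)) =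
      (\<Sum>\<beta>\<in>?D. (\<Sum>\<gamma>\<in>?D. jet_rep k g \<alpha> \<gamma> * jet_rep k h \<gamma> \<beta>) * M \<beta> x)" for x
    unfolding sum_distrib_left sum_distrib_right by (subst sum.swap) (simp add: mult.assoc)
  then have "taylor k (\<lambda>\<beta>. \<Sum>\<gamma>\<in>?D. jet_rep k g \<alpha> \<gamma> * jet_rep k h \<gamma> \<beta>) (\<lambda>x. M \<alpha> (g (h x)))"
    using sum_in_bigo(1)[OF 1 2] unfolding taylor_def by (simp add: right_diff_distrib sum_subtractf)
  moreover have "\<forall>\<^sub>F x in nhdsin N x0. M \<alpha> (g (h x)) = M \<alpha> (f x)"
    using gh x0_topspace by (auto simp: eventually_nhdsin intro!: exI[of _ "topspace N"])
  ultimately show ?thesis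
    unfolding jet_rep_def[of k f] by (intro jet_eqI[OF _ \<beta>]) (simp add: taylor_cong)
qed

lemma jet_rep_one:
  assumes id: "\<And>x. x \<in> topspace N \<Longrightarrow> f x = x" and ind: "\<alpha> \<in> indices_upto n k" "\<beta> \<in> indices_upto n k"
  shows "jet_rep k f \<alpha> \<beta> = (if \<alpha> = \<beta> then 1 else 0)"
proof -
  have "(\<Sum>\<beta>\<in>indices_upto n k. (if \<alpha> = \<beta> then 1 else 0) * M \<beta> x) = M \<alpha> x" for x
    using finite_indices_upto ind by (simp add: if_distrib[of "\<lambda>c. c * _"] sum.delta' cong: if_cong)
  then have "taylor k (\<lambda>\<beta>. if \<alpha> = \<beta> then 1 else 0) (M \<alpha>)" by (simp add: taylor_def)
  moreover have "\<forall>\<^sub>F x in nhdsin N x0. M \<alpha> x = M \<alpha> (f x)"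
    using id x0_topspace by (auto simp: eventually_nhdsin intro!: exI[of _ "topspace N"])
  ultimately show ?thesis
    unfolding jet_rep_def by (intro jet_eqI[OF _ ind(2)]) (simp add: taylor_cong)
qed

text \<open>By the identity theorem distinct maps differ on every neighbourhood of
  \<open>x0\<close>, so some coordinate of their difference fails to vanish to some order
  \<open>k0\<close>. Coordinates are monomials of degree 1, so equal matrices of high order would
  contradict this. Separation for all large \<open>k\<close> lets finitely many pairs share one
  \<open>k\<close>.\<close>

lemma jet_rep_faithful:
  assumes N: "analytic_manifold n N \<A>" "connected_space N" and g: "g \<in> germs" and h: "h \<in> germs"
    and neq: "z \<in> topspace N" "g z \<noteq> h z"
  shows "\<exists>k0. \<forall>k\<ge>k0. \<exists>\<alpha>\<in>indices_upto n k. \<exists>\<beta>\<in>indices_upto n k. jet_rep k g \<alpha> \<beta> \<noteq> jet_rep k h \<alpha> \<beta>"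
proof -
  have gh: "analytic_self_map n N \<A> g" "analytic_self_map n N \<A> h" "g x0 \<in> U" "h x0 = g x0"
    using g h x0 by (auto simp: germs_def)
  obtain W where W: "openin N W" "x0 \<in> W"
    "(\<forall>j<n. \<forall>k. (\<lambda>x. \<phi> (g x) j - \<phi> (h x) j) \<in> vanishing k) \<longrightarrow> (\<forall>x\<in>W. g x = h x)"
    using analytic_self_maps_local_coincidence[OF gh(1,2) in_atlas in_atlas chart chart x0 gh(3,4)]
    unfolding \<nu>_def by blast
  have "\<not> (\<forall>x\<in>W. g x = h x)"
    using analytic_self_maps_identity[OF N gh(1,2) W(1)] W(2) neq by blast
  then obtain j k0 where j: "j < n" and nv: "(\<lambda>x. \<phi> (g x) j - \<phi> (h x) j) \<notin> vanishing k0" using W(3) by blast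
  define e where "e = (\<lambda>i. if i = j then 1 else 0 :: nat)"
  have M: "M e x = \<phi> x j - \<phi> x0 j" for x
    using j by (simp add: M_def monomial_def e_def if_distrib[of "\<lambda>m. _ ^ m"] prod.delta cong: if_cong)
  show ?thesis
  proof (intro exI allI impI)
    \<comment> \<open>The successor guarantees \<open>k \<ge> 1\<close>, so that the index
      \<open>e\<close> of degree 1 is available.\<close>
    fix k assume k: "k \<ge> Suc k0"
    have e: "e \<in> indices_upto n k"
      using j k by (auto simp: indices_upto_def multi_indices_def mdegree_def e_def)
    have "\<exists>\<beta>\<in>indices_upto n k. jet_rep k g e \<beta> \<noteq> jet_rep k h e \<beta>"
    proof (rule ccontr)
      assume "\<not> ?thesis"
      then have eq: "(\<Sum>\<beta>\<in>indices_upto n k. jet_rep k g e \<beta> * M \<beta> x) = (\<Sum>\<beta>\<in>indices_upto n k. jet_rep k h e \<beta> * M \<beta> x)" for x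
        by (intro sum.cong) auto
      have "(\<lambda>x. M e (g x) - M e (h x)) \<in> vanishing (Suc k)"
        using sum_in_bigo(2)[OF taylor_jet_rep[OF g, of k e, unfolded taylor_def] taylor_jet_rep[OF h, of k e, unfolded taylor_def]]
        by (simp add: eq)
      then show False using nv k vanishing_mono[of k0 "Suc k"] by (auto simp: M)
    qed
    then show "\<exists>\<alpha>\<in>indices_upto n k. \<exists>\<beta>\<in>indices_upto n k. jet_rep k g \<alpha> \<beta> \<noteq> jet_rep k h \<alpha> \<beta>" using e by blast
  qed
qed

end

theorem proposition5p2:
  fixes n :: nat and N :: "'a topology" and \<A> :: "'a chart set"
    and x\<^sub>0 :: 'a and G :: "('a \<Rightarrow> 'a) set"
  assumes "analytic_manifold n N \<A>"
    and "connected_space N"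
    and "x\<^sub>0 \<in> topspace N"
    and "subgroup G (BijGroup (topspace N))"
    and "countable G"
    and "G \<subseteq> analytic_diffeos n N \<A>"
    and "\<And>g. g \<in> G \<Longrightarrow> g x\<^sub>0 = x\<^sub>0"
  shows "locally_embeddable TYPE(ell2) (BijGroup (topspace N)\<lparr>carrier := G\<rparr>)"
proof -
  define \<G> where "\<G> = BijGroup (topspace N)\<lparr>carrier := G\<rparr>"
  interpret \<G>: group \<G>
    unfolding \<G>_def by (rule subgroup.subgroup_is_group[OF assms(4) group_BijGroup])
  have carrier: "carrier \<G> = G" by (simp add: \<G>_def)
  have Bij: "g \<in> Bij (topspace N)" if "g \<in> G" for g
    using that assms(6) by (auto simp: analytic_diffeos_def)
  have mult: "(g \<otimes>\<^bsub>\<G>\<^esub> h) x = g (h x)" if "g \<in> G" "h \<in> G" "x \<in> topspace N" for g h x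
    using Bij that by (simp add: \<G>_def BijGroup_def compose_eq)
  have one: "\<one>\<^bsub>\<G>\<^esub> x = x" if "x \<in> topspace N" for x
    using that by (simp add: \<G>_def BijGroup_def)
  obtain U \<phi> where U: "(U, \<phi>) \<in> \<A>" "x\<^sub>0 \<in> U"
    using assms(1,3) unfolding analytic_manifold_def by blast
  then have chart: "is_chart n N U \<phi>" using assms(1) by (auto simp: analytic_manifold_def)
  interpret pointed_analytic_chart n N U \<phi> x\<^sub>0 \<A>
    by unfold_locales (use chart U in auto)
  have germs: "g \<in> germs" if "g \<in> G" for g
    using that assms(6,7) by (auto simp: germs_def analytic_diffeos_def)
  have "\<exists>(G' :: nat monoid) \<psi>. coarsely_embeddable TYPE(ell2) G' \<and> \<psi> \<in> F \<rightarrow> carrier G' \<and>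
      (\<one>\<^bsub>\<G>\<^esub> \<in> F \<longrightarrow> \<psi> \<one>\<^bsub>\<G>\<^esub> = \<one>\<^bsub>G'\<^esub>) \<and>
      (\<forall>g\<in>F. \<forall>h\<in>F. g \<otimes>\<^bsub>\<G>\<^esub> h \<in> F \<longrightarrow> \<psi> (g \<otimes>\<^bsub>\<G>\<^esub> h) = \<psi> g \<otimes>\<^bsub>G'\<^esub> \<psi> h) \<and>
      (\<forall>g\<in>F. \<forall>h\<in>F. g \<noteq> h \<longrightarrow> \<psi> g \<noteq> \<psi> h)"
    if F: "finite F" "F \<subseteq> carrier \<G>" for F
  proof -
    have FG: "g \<in> G" if "g \<in> F" for g using that F carrier by auto
    define P where "P = {p \<in> F \<times> F. fst p \<noteq> snd p}"
    define sep where "sep p k \<longleftrightarrow> (\<exists>\<alpha>\<in>indices_upto n k. \<exists>\<beta>\<in>indices_upto n k.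
        jet_rep k (fst p) \<alpha> \<beta> \<noteq> jet_rep k (snd p) \<alpha> \<beta>)" for p k
    have "eventually (sep p) sequentially" if "p \<in> P" for p
    proof -
      have p: "fst p \<in> G" "snd p \<in> G" "fst p \<noteq> snd p" using that FG by (auto simp: P_def)
      \<comment> \<open>Elements of \<open>Bij\<close> are extensional, so distinct ones differ at a
        point of the manifold.\<close>
      then obtain z where "z \<in> topspace N" "fst p z \<noteq> snd p z"
        using extensionalityI[OF Bij_imp_extensional Bij_imp_extensional, OF Bij Bij] by blast
      then show ?thesis
        unfolding eventually_sequentially sep_def
        by (rule jet_rep_faithful[OF assms(1,2) germs[OF p(1)] germs[OF p(2)]])
    qed
    then have "eventually (\<lambda>k. \<forall>p\<in>P. sep p k) sequentially"
      using F by (intro eventually_ball_finite) (auto simp: P_def)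
    then obtain k where k: "\<And>p. p \<in> P \<Longrightarrow> sep p k"
      unfolding eventually_sequentially by blast
    have "\<exists>(G' :: nat monoid) \<psi>. group G' \<and> finite (carrier G') \<and>
        \<psi> \<in> hom (\<G>\<lparr>carrier := generate \<G> F\<rparr>) G' \<and> inj_on \<psi> F"
    proof (rule \<G>.separating_finite_quotient[where \<rho> = "jet_rep k", OF F finite_indices_upto])
      show "jet_rep k (g \<otimes>\<^bsub>\<G>\<^esub> h) \<alpha> \<beta> = (\<Sum>\<gamma>\<in>indices_upto n k. jet_rep k g \<alpha> \<gamma> * jet_rep k h \<gamma> \<beta>)"
        if "g \<in> carrier \<G>" "h \<in> carrier \<G>" "\<beta> \<in> indices_upto n k" for g h \<alpha> \<beta>
        using that carrier by (intro jet_rep_mult germs mult) auto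
      show "jet_rep k \<one>\<^bsub>\<G>\<^esub> \<alpha> \<beta> = (if \<alpha> = \<beta> then 1 else 0)"
        if "\<alpha> \<in> indices_upto n k" "\<beta> \<in> indices_upto n k" for \<alpha> \<beta>
        using that by (intro jet_rep_one one)
      show "\<exists>\<alpha>\<in>indices_upto n k. \<exists>\<beta>\<in>indices_upto n k. jet_rep k g \<alpha> \<beta> \<noteq> jet_rep k h \<alpha> \<beta>"
        if "g \<in> F" "h \<in> F" "g \<noteq> h" for g h
        using k[of "(g, h)"] that by (simp add: P_def sep_def)
    qed
    then obtain G' :: "nat monoid" and \<psi> where G': "group G'" "finite (carrier G')"
      and hom: "\<psi> \<in> hom (\<G>\<lparr>carrier := generate \<G> F\<rparr>) G'" and inj: "inj_on \<psi> F" by blast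
    have sub: "group (\<G>\<lparr>carrier := generate \<G> F\<rparr>)"
      by (rule subgroup.subgroup_is_group[OF \<G>.generate_is_subgroup[OF F(2)] \<G>.group_axioms])
    \<comment> \<open>\<open>\<psi>\<close> is a homomorphism on the subgroup generated by
      \<open>F\<close>; this puts the elements of \<open>F\<close> into its domain.\<close>
    have gen: "g \<in> generate \<G> F" if "g \<in> F" for g using that by (rule generate.incl)
    show ?thesis
    proof (intro exI conjI ballI impI)
      show "coarsely_embeddable TYPE(ell2) G'" by (rule coarsely_embeddable_finite[OF G'])
      show "\<psi> \<in> F \<rightarrow> carrier G'" using hom gen by (auto simp: hom_def)
      show "\<psi> \<one>\<^bsub>\<G>\<^esub> = \<one>\<^bsub>G'\<^esub>" using hom_one[OF hom sub G'(1)] by simp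
      show "\<psi> (g \<otimes>\<^bsub>\<G>\<^esub> h) = \<psi> g \<otimes>\<^bsub>G'\<^esub> \<psi> h" if "g \<in> F" "h \<in> F" for g h
        using hom_mult[OF hom, of g h] gen that by simp
      show "\<psi> g \<noteq> \<psi> h" if "g \<in> F" "h \<in> F" "g \<noteq> h" for g h
        using inj that by (auto dest: inj_onD)
    qed
  qed
  then show ?thesis
    unfolding locally_embeddable_def \<G>_def[symmetric]
    using \<G>.group_axioms assms(5) carrier by simp
qed

end
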